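(* Let $\Omega=\mathbf{R}^d\setminus\{0\}$, so $d_\Omega(x)=|x|$, let $\delta,\delta'\geq0$, $c(s)=s^\delta(1+s)^{\delta'-\delta}$ for $s>0$, $c_\Omega(x)=c(|x|)$, and let $H$ be the corresponding submarkovian operator on $L_2(\Omega)$ defined in the context. Assume $\delta+\delta'\leq4$. If $d+2(\delta\wedge\delta')-4>0$ then the Rellich inequality $$(H\varphi,H\varphi)\geq a_2\,(c_\Omega d_\Omega^{-2}\varphi,\,c_\Omega d_\Omega^{-2}\varphi)$$ is valid for all $\varphi\in D(H)$ with $a_2=d^2(d+2(\delta\wedge\delta')-4)^2/16$. The value of $a_2$ is optimal.
   Context: $L_2(\Omega)$ is the real $L_2$-space with respect to Lebesgue measure, with inner product $(\cdot,\cdot)$. The form $h$ is the closure of $\varphi\in C_c^\infty(\Omega)\mapsto h(\varphi)=\sum_{k=1}^d(\partial_k\varphi,c_\Omega\,\partial_k\varphi)$, a Dirichlet form with domain $D(h)$, and $H$ is the positive self-adjoint operator associated with $h$ ($D(h)=D(H^{1/2})$, $h(\varphi)=\|H^{1/2}\varphi\|_2^2$). $\wedge$ denotes minimum. "Optimal" means that $a_2$ is the largest constant for which the inequality holds for all $\varphi\in D(H)$. *)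

theory Defs
  imports "HOL-Analysis.Analysis"
begin

subsection \<open>The real space \<open>L\<^sub>2(\<Omega>)\<close>\<close>

text \<open>Elements of \<open>L\<^sub>2(\<Omega>)\<close> are represented by square-integrable functions on the whole space
  whose values off \<open>\<Omega>\<close> are irrelevant; they are not identified when equal almost everywhere,
  so every notion below is invariant under changes on null sets of \<open>\<Omega>\<close>.\<close>

definition L2 :: "('a::euclidean_space) set \<Rightarrow> ('a \<Rightarrow> real) set" where
  "L2 \<Omega> = {f. f \<in> borel_measurable (lebesgue_on \<Omega>) \<and> integrable (lebesgue_on \<Omega>) (\<lambda>x. (f x)\<^sup>2)}"

definition L2_inner :: "('a::euclidean_space) set \<Rightarrow> ('a \<Rightarrow> real) \<Rightarrow> ('a \<Rightarrow> real) \<Rightarrow> real" where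
  "L2_inner \<Omega> f g = (\<integral>x. f x * g x \<partial>lebesgue_on \<Omega>)"

definition L2_norm :: "('a::euclidean_space) set \<Rightarrow> ('a \<Rightarrow> real) \<Rightarrow> real" where
  "L2_norm \<Omega> f = sqrt (L2_inner \<Omega> f f)"

subsection \<open>Unbounded operators on \<open>L\<^sub>2(\<Omega>)\<close>\<close>

text \<open>A (possibly unbounded) operator \<open>A\<close> is represented by its graph: \<open>(f, g) \<in> A\<close> means that
  \<open>f \<in> D(A)\<close> and \<open>g = A f\<close> almost everywhere on \<open>\<Omega>\<close>.\<close>

definition L2_operator :: "('a::euclidean_space) set \<Rightarrow> ('a \<Rightarrow> real) rel \<Rightarrow> bool" where
  "L2_operator \<Omega> A \<longleftrightarrow>
     A \<subseteq> L2 \<Omega> \<times> L2 \<Omega> \<and>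
     (\<lambda>x. 0, \<lambda>x. 0) \<in> A \<and>
     (\<forall>f g f' g' a b. (f, g) \<in> A \<longrightarrow> (f', g') \<in> A \<longrightarrow>
        (\<lambda>x. a * f x + b * f' x, \<lambda>x. a * g x + b * g' x) \<in> A) \<and>
     (\<forall>f g f' g'. (f, g) \<in> A \<longrightarrow> f' \<in> L2 \<Omega> \<longrightarrow> g' \<in> L2 \<Omega> \<longrightarrow>
        (AE x in lebesgue_on \<Omega>. f x = f' x) \<longrightarrow> (AE x in lebesgue_on \<Omega>. g x = g' x) \<longrightarrow>
        (f', g') \<in> A) \<and>
     (\<forall>f g g'. (f, g) \<in> A \<longrightarrow> (f, g') \<in> A \<longrightarrow> (AE x in lebesgue_on \<Omega>. g x = g' x))"

definition L2_dense :: "('a::euclidean_space) set \<Rightarrow> ('a \<Rightarrow> real) set \<Rightarrow> bool" where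
  "L2_dense \<Omega> D \<longleftrightarrow> (\<forall>f\<in>L2 \<Omega>. \<forall>e>0. \<exists>g\<in>D. L2_norm \<Omega> (\<lambda>x. f x - g x) < e)"

definition L2_adjoint :: "('a::euclidean_space) set \<Rightarrow> ('a \<Rightarrow> real) rel \<Rightarrow> ('a \<Rightarrow> real) rel" where
  "L2_adjoint \<Omega> A = {(u, v). u \<in> L2 \<Omega> \<and> v \<in> L2 \<Omega> \<and>
     (\<forall>(f, g)\<in>A. L2_inner \<Omega> g u = L2_inner \<Omega> f v)}"

definition positive_selfadjoint :: "('a::euclidean_space) set \<Rightarrow> ('a \<Rightarrow> real) rel \<Rightarrow> bool" where
  "positive_selfadjoint \<Omega> A \<longleftrightarrow>
     L2_operator \<Omega> A \<and> L2_dense \<Omega> (Domain A) \<and> L2_adjoint \<Omega> A = A \<and>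
     (\<forall>(f, g)\<in>A. L2_inner \<Omega> f g \<ge> 0)"

text \<open>\<open>S = A\<^sup>1\<^sup>/\<^sup>2\<close>: the positive self-adjoint square root; the relational square \<open>S O S\<close> carries the
  natural domain \<open>{f \<in> D(S). S f \<in> D(S)}\<close>.\<close>

definition is_operator_sqrt ::
    "('a::euclidean_space) set \<Rightarrow> ('a \<Rightarrow> real) rel \<Rightarrow> ('a \<Rightarrow> real) rel \<Rightarrow> bool" where
  "is_operator_sqrt \<Omega> S A \<longleftrightarrow> positive_selfadjoint \<Omega> S \<and> S O S = A"

subsection \<open>Test functions\<close>

definition partial_deriv :: "'d::finite \<Rightarrow> (real^'d \<Rightarrow> real) \<Rightarrow> real^'d \<Rightarrow> real" where
  "partial_deriv k f x = deriv (\<lambda>t. f (x + t *\<^sub>R axis k 1)) 0"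

primrec C_class :: "nat \<Rightarrow> (real^'d::finite \<Rightarrow> real) \<Rightarrow> bool" where
  "C_class 0 f \<longleftrightarrow> continuous_on UNIV f"
| "C_class (Suc n) f \<longleftrightarrow> f differentiable_on UNIV \<and> (\<forall>k. C_class n (partial_deriv k f))"

text \<open>A function in \<open>C\<^sub>c\<^sup>\<infinity>(\<Omega>)\<close> is identified with its extension by zero.\<close>

definition Cc_infinity :: "(real^'d::finite) set \<Rightarrow> (real^'d \<Rightarrow> real) set" where
  "Cc_infinity \<Omega> = {\<phi>. (\<forall>n. C_class n \<phi>) \<and>
     compact (closure {x. \<phi> x \<noteq> 0}) \<and> closure {x. \<phi> x \<noteq> 0} \<subseteq> \<Omega>}"

subsection \<open>Quadratic forms, closures and the associated operator\<close>

definition form_approx :: "('a::euclidean_space) set \<Rightarrow> ('a \<Rightarrow> real) set \<Rightarrow>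
    (('a \<Rightarrow> real) \<Rightarrow> real) \<Rightarrow> (nat \<Rightarrow> 'a \<Rightarrow> real) \<Rightarrow> ('a \<Rightarrow> real) \<Rightarrow> bool" where
  "form_approx \<Omega> D q u \<phi> \<longleftrightarrow>
     (\<forall>n. u n \<in> D) \<and>
     (\<lambda>n. L2_norm \<Omega> (\<lambda>x. u n x - \<phi> x)) \<longlonglongrightarrow> 0 \<and>
     (\<forall>e>0. \<exists>N. \<forall>m\<ge>N. \<forall>n\<ge>N. q (\<lambda>x. u m x - u n x) < e)"

definition form_closure_dom :: "('a::euclidean_space) set \<Rightarrow> ('a \<Rightarrow> real) set \<Rightarrow>
    (('a \<Rightarrow> real) \<Rightarrow> real) \<Rightarrow> ('a \<Rightarrow> real) set" where
  "form_closure_dom \<Omega> D q = {\<phi>\<in>L2 \<Omega>. \<exists>u. form_approx \<Omega> D q u \<phi>}"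

text \<open>The value is independent of the approximating sequence when \<open>q\<close> is closable.\<close>

definition form_closure :: "('a::euclidean_space) set \<Rightarrow> ('a \<Rightarrow> real) set \<Rightarrow>
    (('a \<Rightarrow> real) \<Rightarrow> real) \<Rightarrow> ('a \<Rightarrow> real) \<Rightarrow> real" where
  "form_closure \<Omega> D q \<phi> = (THE a. \<exists>u. form_approx \<Omega> D q u \<phi> \<and> (\<lambda>n. q (u n)) \<longlonglongrightarrow> a)"

definition associated_operator :: "('a::euclidean_space) set \<Rightarrow> ('a \<Rightarrow> real) set \<Rightarrow>
    (('a \<Rightarrow> real) \<Rightarrow> real) \<Rightarrow> ('a \<Rightarrow> real) rel \<Rightarrow> bool" where
  "associated_operator \<Omega> D h H \<longleftrightarrow>
     positive_selfadjoint \<Omega> H \<and>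
     (\<exists>S. is_operator_sqrt \<Omega> S H \<and> Domain S = D \<and>
        (\<forall>(\<phi>, \<psi>)\<in>S. h \<phi> = (L2_norm \<Omega> \<psi>)\<^sup>2))"

definition h_core :: "(real^'d::finite) set \<Rightarrow> (real^'d \<Rightarrow> real) \<Rightarrow> (real^'d \<Rightarrow> real) \<Rightarrow> real" where
  "h_core \<Omega> c\<^sub>\<Omega> \<phi> =
     (\<Sum>k\<in>UNIV. L2_inner \<Omega> (partial_deriv k \<phi>) (\<lambda>x. c\<^sub>\<Omega> x * partial_deriv k \<phi> x))"

definition h_dom :: "(real^'d::finite) set \<Rightarrow> (real^'d \<Rightarrow> real) \<Rightarrow> (real^'d \<Rightarrow> real) set" where
  "h_dom \<Omega> c\<^sub>\<Omega> = form_closure_dom \<Omega> (Cc_infinity \<Omega>) (h_core \<Omega> c\<^sub>\<Omega>)"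

definition h_form :: "(real^'d::finite) set \<Rightarrow> (real^'d \<Rightarrow> real) \<Rightarrow> (real^'d \<Rightarrow> real) \<Rightarrow> real" where
  "h_form \<Omega> c\<^sub>\<Omega> = form_closure \<Omega> (Cc_infinity \<Omega>) (h_core \<Omega> c\<^sub>\<Omega>)"

subsection \<open>The weight and the Rellich inequality\<close>

definition c_weight :: "real \<Rightarrow> real \<Rightarrow> real \<Rightarrow> real" where
  "c_weight \<delta> \<delta>' s = s powr \<delta> * (1 + s) powr (\<delta>' - \<delta>)"

definition boundary_dist :: "('a::euclidean_space) set \<Rightarrow> 'a \<Rightarrow> real" where
  "boundary_dist \<Omega> x = infdist x (- \<Omega>)"

lemma boundary_dist_punctured: "boundary_dist (UNIV - {0}) x = norm x"
proof -
  have "- (UNIV - {0 :: 'a}) = {0}" by auto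
  then show ?thesis by (simp add: boundary_dist_def)
qed

text \<open>Finiteness of the right-hand side is part of the inequality; it must be asserted
  explicitly because the Bochner integral of a non-integrable function is \<open>0\<close>.\<close>

definition rellich_inequality ::
    "('a::euclidean_space) set \<Rightarrow> ('a \<Rightarrow> real) \<Rightarrow> ('a \<Rightarrow> real) rel \<Rightarrow> real \<Rightarrow> bool" where
  "rellich_inequality \<Omega> c\<^sub>\<Omega> H a \<longleftrightarrow>
     (\<forall>(\<phi>, H\<phi>)\<in>H.
        (\<lambda>x. c\<^sub>\<Omega> x / (boundary_dist \<Omega> x)\<^sup>2 * \<phi> x) \<in> L2 \<Omega> \<and>
        L2_inner \<Omega> H\<phi> H\<phi> \<ge>
          a * L2_inner \<Omega> (\<lambda>x. c\<^sub>\<Omega> x / (boundary_dist \<Omega> x)\<^sup>2 * \<phi> x)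
                         (\<lambda>x. c\<^sub>\<Omega> x / (boundary_dist \<Omega> x)\<^sup>2 * \<phi> x))"

end

theory Submission
  imports Defs
begin

text \<open>Let \<open>\<omega> = c(r) / r\<^sup>2\<close>, \<open>p = r c'/c\<close>, \<open>m = \<delta> \<and> \<delta>'\<close> and \<open>A = d (d + 2 m - 4) / 4\<close>, the root of the
  optimal constant.  For a smooth bounded truncation \<open>W\<close> of \<open>\<omega>\<close> one shows
  \<open>(H \<phi>, W \<phi>) \<ge> A \<parallel>W \<phi>\<parallel>\<^sup>2\<close>; the Cauchy-Schwarz inequality and monotone convergence then give
  \<open>\<parallel>H \<phi>\<parallel> \<ge> A \<parallel>\<omega> \<phi>\<parallel>\<close>.  For a test function \<open>u\<close> the form \<open>h(u, W u)\<close> is bounded below by completing a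
  square and integrating by parts against a radial field; the coefficient of \<open>\<omega> W u\<^sup>2\<close> that
  remains is \<open>((d - 2 + p)\<^sup>2 - g\<^sup>2 (p - 2)\<^sup>2) / 4 + r p' / 2\<close> with \<open>g = W / \<omega> \<in> [0, 1]\<close>, and this is at
  least \<open>d (d - 4 + 2 p) / 4 + r p' / 2 \<ge> A\<close>.  Since \<open>W\<close> and \<open>c |\<nabla>W|\<^sup>2\<close> are bounded, multiplication by
  \<open>W\<close> is continuous for the form norm, so the inequality extends from the form core to \<open>D(H)\<close>.

  Optimality: with \<open>s = (d + 2 m - 4) / 2\<close> the function \<open>r\<^sup>-\<^sup>s\<close> is formally an eigenfunction,
  \<open>H r\<^sup>-\<^sup>s \<approx> A \<omega> r\<^sup>-\<^sup>s\<close>, near the end (origin or infinity) where \<open>p\<close> tends to \<open>m\<close>.  Multiplying by a bump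
  in \<open>ln r\<close> dilated by \<open>L\<close> causes a relative error \<open>O(1 / L)\<close>, because \<open>(\<omega> r\<^sup>-\<^sup>s)\<^sup>2\<close> is comparable to \<open>r\<^sup>-\<^sup>d\<close>,
  which gives all logarithmic shells comparable mass.\<close>

subsection \<open>Smooth functions on open sets\<close>

text \<open>The obstacle is that \<open>H\<close> is known only through some square root
  \<open>S\<close> whose domain is the form domain. Statements on \<open>D(H)\<close> are therefore
  reached by limits in the form norm, and multiplication by \<open>\<omega>\<close>, which may be
  unbounded, need not respect that norm; hence the truncation. It is the rational expression
  \<open>N \<omega> / (N + \<omega>)\<close> and not a minimum, because its product with a test
  function must again be a test function. It costs nothing in the constant: it enters the decisive
  bracket only through \<open>- g^2\<close> with \<open>g \<le> 1\<close>, so the untruncated case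
  is the worst one. The optimality half needs information of another kind: that test functions lie
  in \<open>D(H)\<close> and that \<open>H\<close> acts on them as minus the divergence of
  \<open>c\<close> times the gradient. This follows from the self-adjointness of \<open>S\<close>.
  The form itself is a closure given by a definite description, so closability has to be settled
  before any of its values is known; integration by parts against test functions does this and is
  also the source of the lower bound.\<close>

lemma partial_deriv_eq_frechet:
  assumes "(f has_derivative f') (at x)"
  shows "partial_deriv k f x = f' (axis k 1)"
proof -
  have "((\<lambda>t::real. x + t *\<^sub>R axis k 1) has_derivative (\<lambda>t. t *\<^sub>R axis k 1)) (at 0)"
    by (auto intro!: derivative_eq_intros)
  then have "((\<lambda>t::real. f (x + t *\<^sub>R axis k 1)) has_derivative (\<lambda>t. f' (t *\<^sub>R axis k 1))) (at 0)"
    using has_derivative_compose[of "\<lambda>t::real. x + t *\<^sub>R axis k 1" _ 0 UNIV f f'] assms by simp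
  moreover have "f' (t *\<^sub>R axis k 1) = f' (axis k 1) * t" for t
    using linear_scale[OF has_derivative_linear[OF assms]] by simp
  ultimately have "((\<lambda>t::real. f (x + t *\<^sub>R axis k 1)) has_real_derivative f' (axis k 1)) (at 0)"
    by (simp add: has_field_derivative_def)
  then show ?thesis
    unfolding partial_deriv_def by (rule DERIV_imp_deriv)
qed

lemma partial_deriv_cong:
  assumes "open S" "x \<in> S" "\<And>y. y \<in> S \<Longrightarrow> f y = g y"
  shows "partial_deriv k f x = partial_deriv k g x"
proof -
  have "((\<lambda>t::real. x + t *\<^sub>R axis k 1) \<longlongrightarrow> x + 0 *\<^sub>R axis k 1) (nhds 0)"
    by (intro tendsto_intros filterlim_ident)
  then have "((\<lambda>t::real. x + t *\<^sub>R axis k 1) \<longlongrightarrow> x) (nhds 0)"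
    by simp
  then have "\<forall>\<^sub>F t in nhds 0. x + t *\<^sub>R axis k 1 \<in> S"
    using assms(1,2) by (rule topological_tendstoD)
  then have "\<forall>\<^sub>F t in nhds 0. f (x + t *\<^sub>R axis k 1) = g (x + t *\<^sub>R axis k 1)"
    by eventually_elim (rule assms(3))
  then show ?thesis
    unfolding partial_deriv_def by (intro deriv_cong_ev) auto
qed

text \<open>\<open>C_class\<close> refers to the whole space, whereas \<open>norm\<close>,
  \<open>ln\<close> and the weights are smooth only away from the origin; hence a version relative
  to a set. The values that \<open>partial_deriv\<close> takes off \<open>S\<close> do not matter as
  long as \<open>S\<close> is open.\<close>

primrec C_on :: "(real^'d::finite) set \<Rightarrow> nat \<Rightarrow> (real^'d \<Rightarrow> real) \<Rightarrow> bool" where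
  "C_on S 0 f \<longleftrightarrow> continuous_on S f"
| "C_on S (Suc n) f \<longleftrightarrow> (\<forall>x\<in>S. f differentiable at x) \<and> (\<forall>k. C_on S n (partial_deriv k f))"

definition smooth_on :: "(real^'d::finite) set \<Rightarrow> (real^'d \<Rightarrow> real) \<Rightarrow> bool" where
  "smooth_on S f \<longleftrightarrow> (\<forall>n. C_on S n f)"

lemma C_class_iff_C_on: "C_class n f \<longleftrightarrow> C_on UNIV n f"
  by (induction n arbitrary: f) (auto simp: differentiable_on_def)

lemma C_on_imp_continuous_on: "C_on S n f \<Longrightarrow> continuous_on S f"
  by (cases n) (auto intro!: continuous_at_imp_continuous_on differentiable_imp_continuous_within)

lemma C_on_SucD: "C_on S (Suc n) f \<Longrightarrow> C_on S n f"
proof (induction n arbitrary: f)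
  case 0
  then show ?case using C_on_imp_continuous_on by fastforce
next
  case (Suc n)
  have "C_on S n (partial_deriv k f)" for k
    using Suc.prems by (intro Suc.IH) (auto simp only: C_on.simps)
  then show ?case
    using Suc.prems by (auto simp only: C_on.simps)
qed

lemma C_on_cong:
  assumes "open S" "\<And>x. x \<in> S \<Longrightarrow> f x = g x"
  shows "C_on S n f \<longleftrightarrow> C_on S n g"
  using assms(2)
proof (induction n arbitrary: f g)
  case 0
  then show ?case by (simp cong: continuous_on_cong)
next
  case (Suc n)
  have "C_on S n (partial_deriv k f) \<longleftrightarrow> C_on S n (partial_deriv k g)" for k
    by (rule Suc.IH) (use Suc.prems assms(1) in \<open>auto intro: partial_deriv_cong\<close>)
  moreover have "f differentiable at x \<longleftrightarrow> g differentiable at x" if "x \<in> S" for x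
    unfolding differentiable_def
    using has_derivative_transform_within_open[OF _ assms(1) that, of f _ UNIV g]
      has_derivative_transform_within_open[OF _ assms(1) that, of g _ UNIV f] Suc.prems
    by auto
  ultimately show ?case by auto
qed

lemma C_on_congI:
  "open S \<Longrightarrow> C_on S n g \<Longrightarrow> (\<And>x. x \<in> S \<Longrightarrow> f x = g x) \<Longrightarrow> C_on S n f"
  using C_on_cong[of S f g n] by blast

lemma C_on_subset: "C_on T n f \<Longrightarrow> S \<subseteq> T \<Longrightarrow> C_on S n f"
  by (induction n arbitrary: f) (auto intro: continuous_on_subset)

text \<open>Gluing: together with the smoothness of zero off the support, this carries smoothness
  from \<open>\<Omega>\<close> to the whole space, as \<open>Cc_infinity\<close> demands.\<close>

lemma C_on_Un:
  assumes "open S" "open T" "C_on S n f" "C_on T n f"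
  shows "C_on (S \<union> T) n f"
  using assms(3,4)
  by (induction n arbitrary: f) (auto intro: continuous_on_open_Un assms(1,2))

section \<open>Closure of smoothness under arithmetic and composition\<close>

lemma partial_deriv_const [simp]: "partial_deriv k (\<lambda>x. c) = (\<lambda>x. 0)"
  by (simp add: partial_deriv_def fun_eq_iff)

lemma C_on_const: "C_on S n (\<lambda>x. c)"
  by (induction n arbitrary: c) (auto intro: continuous_intros)

lemma partial_deriv_add:
  assumes "f differentiable at x" "g differentiable at x"
  shows "partial_deriv k (\<lambda>x. f x + g x) x = partial_deriv k f x + partial_deriv k g x"
proof -
  obtain f' g' where d: "(f has_derivative f') (at x)" "(g has_derivative g') (at x)"
    using assms by (auto simp: differentiable_def)
  show ?thesis
    by (simp add: partial_deriv_eq_frechet[OF has_derivative_add[OF d]] d[THEN partial_deriv_eq_frechet])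
qed

lemma partial_deriv_mult:
  assumes "f differentiable at x" "g differentiable at x"
  shows "partial_deriv k (\<lambda>x. f x * g x) x = f x * partial_deriv k g x + partial_deriv k f x * g x"
proof -
  obtain f' g' where d: "(f has_derivative f') (at x)" "(g has_derivative g') (at x)"
    using assms by (auto simp: differentiable_def)
  show ?thesis
    by (simp add: partial_deriv_eq_frechet[OF has_derivative_mult[OF d]] d[THEN partial_deriv_eq_frechet])
qed

lemma C_on_add: "open S \<Longrightarrow> C_on S n f \<Longrightarrow> C_on S n g \<Longrightarrow> C_on S n (\<lambda>x. f x + g x)"
proof (induction n arbitrary: f g)
  case 0
  then show ?case by (simp add: continuous_on_add continuous_on_mult)
next
  case (Suc n)
  have "C_on S n (\<lambda>x. partial_deriv k f x + partial_deriv k g x)" for k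
    using Suc by auto
  then have "C_on S n (partial_deriv k (\<lambda>x. f x + g x))" for k
    by (rule C_on_congI[OF \<open>open S\<close>]) (use Suc.prems in \<open>auto intro: partial_deriv_add\<close>)
  then show ?case
    using Suc.prems by (auto intro: differentiable_add)
qed

lemma C_on_mult: "open S \<Longrightarrow> C_on S n f \<Longrightarrow> C_on S n g \<Longrightarrow> C_on S n (\<lambda>x. f x * g x)"
proof (induction n arbitrary: f g)
  case 0
  then show ?case by (simp add: continuous_on_add continuous_on_mult)
next
  case (Suc n)
  have "C_on S n (\<lambda>x. f x * partial_deriv k g x + partial_deriv k f x * g x)" for k
    using Suc C_on_SucD[of S n f] C_on_SucD[of S n g] by (intro C_on_add) auto
  then have "C_on S n (partial_deriv k (\<lambda>x. f x * g x))" for k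
    by (rule C_on_congI[OF \<open>open S\<close>]) (use Suc.prems in \<open>auto intro: partial_deriv_mult\<close>)
  then show ?case
    using Suc.prems by (auto intro: differentiable_mult)
qed

lemma has_derivative_coord: "((\<lambda>x::real^'d. x $ i) has_derivative (\<lambda>x. x $ i)) (at x)"
  by (intro bounded_linear_imp_has_derivative bounded_linear_vec_nth)

lemma C_on_coord: "C_on S n (\<lambda>x::real^'d::finite. x $ i)"
proof (cases n)
  case 0
  then show ?thesis by (auto intro: continuous_intros)
next
  case (Suc m)
  have "partial_deriv k (\<lambda>x::real^'d. x $ i) = (\<lambda>x. axis k 1 $ i)" for k
    by (rule ext) (rule partial_deriv_eq_frechet[OF has_derivative_coord])
  then show ?thesis
    using Suc has_derivative_coord by (auto simp: differentiable_def C_on_const)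
qed

lemma partial_deriv_chain:
  assumes "(F has_real_derivative F') (at (f x))" "f differentiable at x"
  shows "(\<lambda>x. F (f x)) differentiable at x"
    and "partial_deriv k (\<lambda>x. F (f x)) x = F' * partial_deriv k f x"
proof -
  obtain f' where f': "(f has_derivative f') (at x)"
    using assms by (auto simp: differentiable_def)
  have "((\<lambda>x. F (f x)) has_derivative (\<lambda>h. F' * f' h)) (at x)"
    using has_derivative_compose[OF f' assms(1)[unfolded has_field_derivative_def]] by simp
  then show "(\<lambda>x. F (f x)) differentiable at x"
    and "partial_deriv k (\<lambda>x. F (f x)) x = F' * partial_deriv k f x"
    by (auto simp: differentiable_def partial_deriv_eq_frechet[OF f'] dest: partial_deriv_eq_frechet)
qed

text \<open>Smoothness of a composition is obtained for a whole family of outer functions at once: the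
  family only has to be closed under differentiation up to linear combinations of two members.\<close>

lemma C_on_compose_family:
  fixes F :: "'i \<Rightarrow> real \<Rightarrow> real"
  assumes "open S"
    and F: "\<And>i t. t \<in> T \<Longrightarrow> (F i has_real_derivative \<alpha> i * F (\<sigma> i) t + \<beta> i * F (\<tau> i) t) (at t)"
    and T: "\<And>x. x \<in> S \<Longrightarrow> f x \<in> T"
  shows "C_on S n f \<Longrightarrow> C_on S n (\<lambda>x. F i (f x))"
proof (induction n arbitrary: i)
  case 0
  have "continuous_on T (F i)"
    using F by (meson DERIV_isCont continuous_at_imp_continuous_on)
  with 0 T show ?case
    by (auto intro: continuous_on_compose2)
next
  case (Suc n)
  have "C_on S n (\<lambda>x. (\<alpha> i * F (\<sigma> i) (f x) + \<beta> i * F (\<tau> i) (f x)) * partial_deriv k f x)" for k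
    using Suc.IH[OF C_on_SucD[OF Suc.prems]] Suc.prems
    by (intro C_on_mult C_on_add C_on_const \<open>open S\<close>) auto
  moreover have "partial_deriv k (\<lambda>x. F i (f x)) x
      = (\<alpha> i * F (\<sigma> i) (f x) + \<beta> i * F (\<tau> i) (f x)) * partial_deriv k f x" if "x \<in> S" for x k
    by (rule partial_deriv_chain) (use that F T Suc.prems in auto)
  ultimately have "C_on S n (partial_deriv k (\<lambda>x. F i (f x)))" for k
    by (subst C_on_cong[OF \<open>open S\<close>]) auto
  moreover have "(\<lambda>x. F i (f x)) differentiable at x" if "x \<in> S" for x
    by (rule partial_deriv_chain) (use that F T Suc.prems in auto)
  ultimately show ?case by auto
qed

lemma C_on_powr:
  assumes "open S" "\<And>x. x \<in> S \<Longrightarrow> f x > 0" "C_on S n f"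
  shows "C_on S n (\<lambda>x. f x powr a)"
proof -
  \<comment> \<open>The summand with coefficient 0 only fits the pattern of
    \<open>C_on_compose_family\<close>.\<close>
  have d: "((\<lambda>t. t powr i) has_real_derivative i * t powr (i - 1) + 0 * t powr i) (at t)"
    if "t \<in> {0<..}" for i t :: real
    using has_real_derivative_powr[of t i] that by simp
  show ?thesis
    by (rule C_on_compose_family[where F = "\<lambda>a t. t powr a" and T = "{0<..}", OF assms(1) d _ assms(3)])
      (simp_all add: assms(2))
qed

text \<open>The derivative of \<open>ln\<close> is the power \<open>t powr (-1)\<close>, so one
  order is peeled off by hand and \<open>C_on_powr\<close> does the rest.\<close>

lemma C_on_ln:
  assumes "open S" "\<And>x. x \<in> S \<Longrightarrow> f x > 0" "C_on S n f"
  shows "C_on S n (\<lambda>x. ln (f x))"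
proof (cases n)
  case 0
  then show ?thesis
    using assms by (fastforce intro: continuous_on_ln)
next
  case (Suc m)
  have f: "f differentiable at x" "C_on S m (partial_deriv k f)" if "x \<in> S" for x k
    using assms(3) Suc that by auto
  have d: "(ln has_real_derivative f x powr (-1)) (at (f x))" if "x \<in> S" for x
    using assms(2)[OF that] DERIV_ln[of "f x"] by (simp add: powr_minus)
  have "C_on S m (\<lambda>x. f x powr (-1) * partial_deriv k f x)" for k
    using assms(3) Suc by (intro C_on_mult C_on_powr assms(1,2) C_on_SucD[of S m f]) auto
  then have "C_on S m (partial_deriv k (\<lambda>x. ln (f x)))" for k
    by (rule C_on_congI[OF \<open>open S\<close>]) (rule partial_deriv_chain(2)[OF d f(1)])
  then show ?thesis
    using partial_deriv_chain(1)[OF d f(1)] Suc by auto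
qed

text \<open>The flat function \<open>exp (- 1 / t)\<close> times a power. The free real exponent
  makes the family stable under differentiation: differentiating the power lowers it by 1,
  differentiating the exponential by 2.\<close>

definition flat :: "real \<Rightarrow> real \<Rightarrow> real" where
  "flat a t = (if t > 0 then t powr a * exp (- 1 / t) else 0)"

text \<open>For \<open>t < 1\<close> the factor \<open>t powr a\<close> is at most
  \<open>(1 / t) ^ k\<close> once \<open>k \<ge> - a\<close>, and in the variable
  \<open>1 / t\<close> the exponential beats every power.\<close>

lemma flat_tendsto_0: "(flat a \<longlongrightarrow> 0) (at_right 0)"
proof -
  obtain k :: nat where k: "real k \<ge> - a"
    using real_arch_simple by blast
  have "((\<lambda>t. (inverse t) ^ k / exp (inverse t)) \<longlongrightarrow> (0::real)) (at_right 0)"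
    using filterlim_compose[OF tendsto_power_div_exp_0 filterlim_inverse_at_top_right] .
  moreover have "\<forall>\<^sub>F t in at_right (0::real). t \<in> {0<..<1}"
    by (rule eventually_at_right_real) simp
  then have "\<forall>\<^sub>F t in at_right (0::real). norm (flat a t) \<le> (inverse t) ^ k / exp (inverse t)"
  proof eventually_elim
    case (elim t)
    have "t powr a \<le> t powr (- real k)"
      using elim k by (intro powr_mono') auto
    also have "\<dots> = inverse t ^ k"
      using elim by (simp add: powr_minus powr_realpow power_inverse)
    finally show ?case
      using elim by (simp add: flat_def exp_minus divide_inverse mult_right_mono)
  qed
  ultimately show ?thesis
    by (rule Lim_null_comparison[rotated])
qed

lemma flat_has_derivative:
  "(flat a has_real_derivative a * flat (a - 1) t + 1 * flat (a - 2) t) (at t)"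
proof -
  consider "t > 0" | "t < 0" | "t = 0" by linarith
  then show ?thesis
  proof cases
    case 1
    have "((\<lambda>t. t powr a * exp (- 1 / t)) has_real_derivative
        a * t powr (a - 1) * exp (- 1 / t) + t powr a * (exp (- 1 / t) * (1 / t\<^sup>2))) (at t)"
      using 1 by (auto intro!: derivative_eq_intros simp: power2_eq_square)
    moreover have "a * t powr (a - 1) * exp (- 1 / t) + t powr a * (exp (- 1 / t) * (1 / t\<^sup>2))
        = a * flat (a - 1) t + 1 * flat (a - 2) t"
      using 1 by (simp add: flat_def powr_diff)
    ultimately have "((\<lambda>t. t powr a * exp (- 1 / t)) has_real_derivative
        a * flat (a - 1) t + 1 * flat (a - 2) t) (at t)"
      by (simp only:)
    then show ?thesis
      by (rule has_field_derivative_transform_within_open[where S = "{0<..}"]) (use 1 in \<open>auto simp: flat_def\<close>)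
  next
    case 2
    have "((\<lambda>t. 0) has_real_derivative a * flat (a - 1) t + 1 * flat (a - 2) t) (at t)"
      using 2 by (auto simp: flat_def)
    then show ?thesis
      by (rule has_field_derivative_transform_within_open[where S = "{..<0}"]) (use 2 in \<open>auto simp: flat_def\<close>)
  next
    case 3
    \<comment> \<open>At the origin the difference quotient is 0 on the left and is again a flat
      function, \<open>flat (a - 1) h\<close>, on the right.\<close>
    have "((\<lambda>h. flat a h / h) \<longlongrightarrow> 0) (at 0)"
      unfolding filterlim_at_split
    proof
      show "((\<lambda>h. flat a h / h) \<longlongrightarrow> 0) (at_left 0)"
        by (rule tendsto_eventually) (auto simp: eventually_at_filter flat_def)
      have "\<forall>\<^sub>F h in at_right 0. flat (a - 1) h = flat a h / h"
        by (auto simp: eventually_at_filter flat_def powr_diff)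
      then show "((\<lambda>h. flat a h / h) \<longlongrightarrow> 0) (at_right 0)"
        using flat_tendsto_0 tendsto_cong by fast
    qed
    then show ?thesis
      using 3 by (simp add: DERIV_def flat_def)
  qed
qed

lemma C_on_flat: "open S \<Longrightarrow> C_on S n f \<Longrightarrow> C_on S n (\<lambda>x. flat a (f x))"
  using C_on_compose_family[where F = flat and T = UNIV, OF _ flat_has_derivative] by blast

lemma smooth_on_rules:
  assumes "open S"
  shows smooth_on_const: "smooth_on S (\<lambda>x. c)"
    and smooth_on_coord: "smooth_on S (\<lambda>x. x $ i)"
    and smooth_on_add: "smooth_on S f \<Longrightarrow> smooth_on S g \<Longrightarrow> smooth_on S (\<lambda>x. f x + g x)"
    and smooth_on_mult: "smooth_on S f \<Longrightarrow> smooth_on S g \<Longrightarrow> smooth_on S (\<lambda>x. f x * g x)"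
    and smooth_on_powr: "(\<And>x. x \<in> S \<Longrightarrow> f x > 0) \<Longrightarrow> smooth_on S f \<Longrightarrow> smooth_on S (\<lambda>x. f x powr a)"
    and smooth_on_ln: "(\<And>x. x \<in> S \<Longrightarrow> f x > 0) \<Longrightarrow> smooth_on S f \<Longrightarrow> smooth_on S (\<lambda>x. ln (f x))"
    and smooth_on_flat: "smooth_on S f \<Longrightarrow> smooth_on S (\<lambda>x. flat a (f x))"
  using assms by (auto simp: smooth_on_def C_on_const C_on_coord C_on_add C_on_mult C_on_powr C_on_ln C_on_flat)

lemma smooth_on_sum:
  assumes "open S" "\<And>i. i \<in> I \<Longrightarrow> smooth_on S (f i)"
  shows "smooth_on S (\<lambda>x. \<Sum>i\<in>I. f i x)"
  using assms(2)
  by (induction I rule: infinite_finite_induct) (auto intro: smooth_on_rules assms(1))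

lemma smooth_on_cong:
  "open S \<Longrightarrow> (\<And>x. x \<in> S \<Longrightarrow> f x = g x) \<Longrightarrow> smooth_on S f \<longleftrightarrow> smooth_on S g"
  unfolding smooth_on_def using C_on_cong by blast

lemma smooth_on_subset: "smooth_on T f \<Longrightarrow> S \<subseteq> T \<Longrightarrow> smooth_on S f"
  unfolding smooth_on_def using C_on_subset by blast

lemma smooth_on_partial_deriv: "smooth_on S f \<Longrightarrow> smooth_on S (partial_deriv k f)"
  unfolding smooth_on_def by (metis C_on.simps(2))

lemma smooth_on_differentiable: "smooth_on S f \<Longrightarrow> x \<in> S \<Longrightarrow> f differentiable at x"
  unfolding smooth_on_def by (metis C_on.simps(2))

lemma smooth_on_continuous: "smooth_on S f \<Longrightarrow> continuous_on S f"
  unfolding smooth_on_def by (metis C_on.simps(1))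

lemma norm_eq_powr: "norm (x :: real^'d::finite) = (\<Sum>i\<in>UNIV. x $ i * x $ i) powr (1 / 2)"
  by (simp add: norm_vec_def L2_set_def powr_half_sqrt sum_nonneg power2_eq_square)

lemma smooth_on_norm:
  assumes "open S" "0 \<notin> S"
  shows "smooth_on S (\<lambda>x :: real^'d::finite. norm x)"
proof -
  have "(\<Sum>i\<in>UNIV. x $ i * x $ i) > 0" if "x \<in> S" for x
    using that assms(2) by (metis inner_gt_zero_iff inner_vec_def inner_real_def)
  then show ?thesis
    unfolding norm_eq_powr by (intro smooth_on_powr smooth_on_sum smooth_on_mult smooth_on_coord assms(1))
qed

subsection \<open>Semi-inner products and integration by parts\<close>

locale semi_inner =
  fixes V :: "('a \<Rightarrow> real) set" and B :: "('a \<Rightarrow> real) \<Rightarrow> ('a \<Rightarrow> real) \<Rightarrow> real"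
  assumes lin_closed: "f \<in> V \<Longrightarrow> g \<in> V \<Longrightarrow> (\<lambda>x. a * f x + b * g x) \<in> V"
    and sym: "f \<in> V \<Longrightarrow> g \<in> V \<Longrightarrow> B f g = B g f"
    and lin_left: "f \<in> V \<Longrightarrow> g \<in> V \<Longrightarrow> h \<in> V \<Longrightarrow> B (\<lambda>x. a * f x + b * g x) h = a * B f h + b * B g h"
    and nonneg: "f \<in> V \<Longrightarrow> B f f \<ge> 0"
begin

definition seminorm :: "('a \<Rightarrow> real) \<Rightarrow> real" where
  "seminorm f = sqrt (B f f)"

lemma seminorm_nonneg: "f \<in> V \<Longrightarrow> seminorm f \<ge> 0"
  by (simp add: seminorm_def nonneg)

lemma seminorm_power2: "f \<in> V \<Longrightarrow> (seminorm f)\<^sup>2 = B f f"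
  by (simp add: seminorm_def nonneg)

lemma lin_right:
  "f \<in> V \<Longrightarrow> g \<in> V \<Longrightarrow> h \<in> V \<Longrightarrow> B h (\<lambda>x. a * f x + b * g x) = a * B h f + b * B h g"
  using lin_left[of f g h a b] sym[of h "\<lambda>x. a * f x + b * g x"] sym[of h f] sym[of h g]
    lin_closed[of f g a b] by simp

lemma expand:
  assumes "f \<in> V" "g \<in> V"
  shows "B (\<lambda>x. a * f x + b * g x) (\<lambda>x. a * f x + b * g x)
    = a\<^sup>2 * B f f + 2 * a * b * B f g + b\<^sup>2 * B g g"
  using assms by (simp add: lin_left lin_right lin_closed sym[of g f] power2_eq_square algebra_simps)

lemma diff_closed: "f \<in> V \<Longrightarrow> g \<in> V \<Longrightarrow> (\<lambda>x. f x - g x) \<in> V"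
  and add_closed: "f \<in> V \<Longrightarrow> g \<in> V \<Longrightarrow> (\<lambda>x. f x + g x) \<in> V"
  using lin_closed[of f g 1 "-1"] lin_closed[of f g 1 1] by simp_all

lemma diff_left: "f \<in> V \<Longrightarrow> g \<in> V \<Longrightarrow> h \<in> V \<Longrightarrow> B (\<lambda>x. f x - g x) h = B f h - B g h"
  using lin_left[of f g h 1 "-1"] by simp

lemma diff_right: "f \<in> V \<Longrightarrow> g \<in> V \<Longrightarrow> h \<in> V \<Longrightarrow> B h (\<lambda>x. f x - g x) = B h f - B h g"
  using lin_right[of f g h 1 "-1"] by simp

lemma expand_diff:
  "f \<in> V \<Longrightarrow> g \<in> V \<Longrightarrow> B (\<lambda>x. f x - g x) (\<lambda>x. f x - g x) = B f f - 2 * B f g + B g g"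
  using expand[of f g 1 "-1"] by simp

lemma expand_add:
  "f \<in> V \<Longrightarrow> g \<in> V \<Longrightarrow> B (\<lambda>x. f x + g x) (\<lambda>x. f x + g x) = B f f + 2 * B f g + B g g"
  using expand[of f g 1 1] by simp

lemma Cauchy_Schwarz:
  assumes "f \<in> V" "g \<in> V"
  shows "\<bar>B f g\<bar> \<le> seminorm f * seminorm g"
proof -
  have *: "0 \<le> a\<^sup>2 * B f f + 2 * a * b * B f g + b\<^sup>2 * B g g" for a b
    using nonneg[OF lin_closed[OF assms, of a b]] expand[OF assms, of a b] by simp
  have "(B f g)\<^sup>2 \<le> B f f * B g g"
  proof (cases "B g g = 0")
    case True
    \<comment> \<open>Without definiteness this case is not vacuous. The quadratic is affine in
      \<open>b\<close> here, and the \<open>b\<close> chosen below makes it equal to -1 unless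
      \<open>B f g\<close> vanishes.\<close>
    have "B f g = 0"
    proof (rule ccontr)
      assume "B f g \<noteq> 0"
      then have "2 * 1 * (- (B f f + 1) / (2 * B f g)) * B f g = - (B f f + 1)"
        by simp
      then show False
        using *[of 1 "- (B f f + 1) / (2 * B f g)"] True by simp
    qed
    then show ?thesis using True by simp
  next
    case False
    then have pos: "B g g > 0"
      using nonneg[OF assms(2)] by simp
    \<comment> \<open>The usual minimising pair \<open>1\<close> and \<open>- B f g / B g g\<close>,
      scaled by \<open>B g g\<close> to avoid the division.\<close>
    have "0 \<le> B g g * (B f f * B g g - (B f g)\<^sup>2)"
      using *[of "B g g" "- B f g"] by (simp add: power2_eq_square algebra_simps)
    then show ?thesis
      using pos by (simp add: zero_le_mult_iff)
  qed
  then have "sqrt ((B f g)\<^sup>2) \<le> sqrt (B f f * B g g)"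
    by (rule real_sqrt_le_mono)
  then show ?thesis
    by (simp add: seminorm_def real_sqrt_mult)
qed

lemma seminorm_triangle:
  assumes "f \<in> V" "g \<in> V"
  shows "seminorm (\<lambda>x. f x + g x) \<le> seminorm f + seminorm g"
proof (rule power2_le_imp_le)
  have "(seminorm (\<lambda>x. f x + g x))\<^sup>2 = (seminorm f)\<^sup>2 + 2 * B f g + (seminorm g)\<^sup>2"
    using assms by (simp add: seminorm_power2 add_closed expand_add)
  also have "\<dots> \<le> (seminorm f + seminorm g)\<^sup>2"
    using Cauchy_Schwarz[OF assms] by (simp add: power2_sum)
  finally show "(seminorm (\<lambda>x. f x + g x))\<^sup>2 \<le> (seminorm f + seminorm g)\<^sup>2" .
qed (use assms in \<open>simp add: seminorm_nonneg\<close>)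

lemma seminorm_diff_commute:
  assumes "f \<in> V" "g \<in> V"
  shows "seminorm (\<lambda>x. f x - g x) = seminorm (\<lambda>x. g x - f x)"
  using assms by (simp add: seminorm_def expand_diff sym)

lemma seminorm_diff_le:
  assumes "f \<in> V" "g \<in> V"
  shows "\<bar>seminorm f - seminorm g\<bar> \<le> seminorm (\<lambda>x. f x - g x)"
  using seminorm_triangle[of "\<lambda>x. f x - g x" g] seminorm_triangle[of "\<lambda>x. g x - f x" f]
    seminorm_diff_commute[OF assms] assms by (simp add: diff_closed)

lemma tendsto_seminorm:
  assumes "\<And>n. u n \<in> V" "f \<in> V" "(\<lambda>n. seminorm (\<lambda>x. u n x - f x)) \<longlonglongrightarrow> 0"
  shows "(\<lambda>n. seminorm (u n)) \<longlonglongrightarrow> seminorm f"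
proof -
  have "(\<lambda>n. seminorm (u n) - seminorm f) \<longlonglongrightarrow> 0"
    by (rule Lim_null_comparison[OF always_eventually assms(3)]) (use assms seminorm_diff_le in auto)
  then show ?thesis
    by (simp add: LIM_zero_iff)
qed

lemma tendsto_left:
  assumes "\<And>n. u n \<in> V" "f \<in> V" "g \<in> V" "(\<lambda>n. seminorm (\<lambda>x. u n x - f x)) \<longlonglongrightarrow> 0"
  shows "(\<lambda>n. B (u n) g) \<longlonglongrightarrow> B f g"
proof -
  have "(\<lambda>n. B (u n) g - B f g) \<longlonglongrightarrow> 0"
  proof (rule Lim_null_comparison[OF always_eventually])
    show "\<forall>n. norm (B (u n) g - B f g) \<le> seminorm (\<lambda>x. u n x - f x) * seminorm g"
      using Cauchy_Schwarz[of "\<lambda>x. u _ x - f x" g] assms(1-3) by (simp add: diff_closed diff_left)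
    show "(\<lambda>n. seminorm (\<lambda>x. u n x - f x) * seminorm g) \<longlonglongrightarrow> 0"
      using tendsto_mult_right[OF assms(4), of "seminorm g"] by simp
  qed
  then show ?thesis
    by (simp add: LIM_zero_iff)
qed

end

section \<open>The space L2 as an instance\<close>

lemma L2_mult_integrable:
  assumes "f \<in> L2 \<Omega>" "g \<in> L2 \<Omega>"
  shows "integrable (lebesgue_on \<Omega>) (\<lambda>x. f x * g x)"
proof (rule Bochner_Integration.integrable_bound)
  show "integrable (lebesgue_on \<Omega>) (\<lambda>x. (f x)\<^sup>2 + (g x)\<^sup>2)"
    using assms by (auto simp: L2_def)
  show "(\<lambda>x. f x * g x) \<in> borel_measurable (lebesgue_on \<Omega>)"
    using assms by (auto simp: L2_def)
  have "\<bar>a * b\<bar> \<le> a\<^sup>2 + b\<^sup>2" for a b :: real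
    using sum_squares_bound[of "\<bar>a\<bar>" "\<bar>b\<bar>"] mult_nonneg_nonneg[of "\<bar>a\<bar>" "\<bar>b\<bar>"]
    unfolding abs_mult power2_abs by linarith
  then show "AE x in lebesgue_on \<Omega>. norm (f x * g x) \<le> norm ((f x)\<^sup>2 + (g x)\<^sup>2)"
    by simp
qed

interpretation L2: semi_inner "L2 \<Omega>" "L2_inner \<Omega>" for \<Omega> :: "('a::euclidean_space) set"
proof
  fix f g :: "'a \<Rightarrow> real" and a b
  assume fg: "f \<in> L2 \<Omega>" "g \<in> L2 \<Omega>"
  have "integrable (lebesgue_on \<Omega>) (\<lambda>x. a\<^sup>2 * (f x)\<^sup>2 + (2 * a * b) * (f x * g x) + b\<^sup>2 * (g x)\<^sup>2)"
    using L2_mult_integrable[OF fg] fg by (auto simp: L2_def)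
  moreover have "a\<^sup>2 * (f x)\<^sup>2 + (2 * a * b) * (f x * g x) + b\<^sup>2 * (g x)\<^sup>2 = (a * f x + b * g x)\<^sup>2" for x
    by (simp add: power2_eq_square algebra_simps)
  ultimately show "(\<lambda>x. a * f x + b * g x) \<in> L2 \<Omega>"
    using fg by (auto simp: L2_def)
  show "L2_inner \<Omega> f g = L2_inner \<Omega> g f"
    by (simp add: L2_inner_def mult.commute)
  fix h assume h: "h \<in> L2 \<Omega>"
  have "(a * f x + b * g x) * h x = a * (f x * h x) + b * (g x * h x)" for x
    by (simp add: algebra_simps)
  then show "L2_inner \<Omega> (\<lambda>x. a * f x + b * g x) h = a * L2_inner \<Omega> f h + b * L2_inner \<Omega> g h"
    using L2_mult_integrable[OF fg(1) h] L2_mult_integrable[OF fg(2) h] by (simp add: L2_inner_def)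
qed (simp add: L2_inner_def)

lemma L2_norm_eq_seminorm: "L2_norm \<Omega> f = L2.seminorm \<Omega> f"
  by (simp add: L2_norm_def L2.seminorm_def)

lemma L2_dominated:
  assumes "g \<in> L2 \<Omega>" "f \<in> borel_measurable (lebesgue_on \<Omega>)" "C \<ge> 0"
    and "\<And>x. x \<in> \<Omega> \<Longrightarrow> \<bar>f x\<bar> \<le> C * \<bar>g x\<bar>"
  shows "f \<in> L2 \<Omega>" and "L2_norm \<Omega> f \<le> C * L2_norm \<Omega> g"
proof -
  have le: "(f x)\<^sup>2 \<le> C\<^sup>2 * (g x)\<^sup>2" if "x \<in> space (lebesgue_on \<Omega>)" for x
    using power_mono[OF assms(4)[of x] abs_ge_zero, of 2] that by (simp add: power_mult_distrib)
  have g: "integrable (lebesgue_on \<Omega>) (\<lambda>x. C\<^sup>2 * (g x)\<^sup>2)"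
    using assms(1) by (auto simp: L2_def)
  have f: "integrable (lebesgue_on \<Omega>) (\<lambda>x. (f x)\<^sup>2)"
    by (rule Bochner_Integration.integrable_bound[OF g]) (use assms(2) le in auto)
  then show "f \<in> L2 \<Omega>"
    using assms(2) by (simp add: L2_def)
  have "(\<integral>x. (f x)\<^sup>2 \<partial>lebesgue_on \<Omega>) \<le> (\<integral>x. C\<^sup>2 * (g x)\<^sup>2 \<partial>lebesgue_on \<Omega>)"
    by (rule integral_mono[OF f g le])
  then have "L2_inner \<Omega> f f \<le> C\<^sup>2 * L2_inner \<Omega> g g"
    by (simp add: L2_inner_def power2_eq_square)
  then have "sqrt (L2_inner \<Omega> f f) \<le> sqrt (C\<^sup>2 * L2_inner \<Omega> g g)"
    by (rule real_sqrt_le_mono)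
  then show "L2_norm \<Omega> f \<le> C * L2_norm \<Omega> g"
    using assms(3) by (simp add: L2_norm_def real_sqrt_mult)
qed

lemma continuous_on_measurable_lebesgue_on:
  fixes f :: "'a::euclidean_space \<Rightarrow> real"
  assumes "open S" "continuous_on S f"
  shows "f \<in> borel_measurable (lebesgue_on S)"
  using assms by (intro continuous_imp_measurable_on_sets_lebesgue) auto

text \<open>\<open>\<Omega>\<close> and the complement of \<open>K\<close> are open and cover the
  space; \<open>f\<close> is smooth on the first and zero on the second. Smoothness inside
  \<open>\<Omega>\<close> thus suffices, which admits factors that are singular at the
  origin.\<close>

lemma Cc_infinityI:
  assumes "open \<Omega>" "smooth_on \<Omega> f" "compact K" "K \<subseteq> \<Omega>" "\<And>x. x \<notin> K \<Longrightarrow> f x = 0"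
  shows "f \<in> Cc_infinity \<Omega>"
proof -
  have "open (- K)"
    using assms(3) by (simp add: compact_imp_closed open_Compl)
  then have "smooth_on (- K) f"
    using smooth_on_cong[of "- K" f "\<lambda>x. 0"] assms(5) smooth_on_const[of "- K" 0] by simp
  then have "C_on (\<Omega> \<union> - K) n f" for n
    using assms(1,2) \<open>open (- K)\<close> by (intro C_on_Un) (auto simp: smooth_on_def)
  moreover have "\<Omega> \<union> - K = UNIV"
    using assms(4) by auto
  moreover have "closure {x. f x \<noteq> 0} \<subseteq> K"
    using assms(3,5) by (intro closure_minimal compact_imp_closed) auto
  moreover have "compact (closure {x. f x \<noteq> 0})"
    using compact_Int_closed[OF assms(3) closed_closure, of "{x. f x \<noteq> 0}"] calculation(3)
    by (simp add: Int_absorb1)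
  ultimately show ?thesis
    using assms(4) by (auto simp: Cc_infinity_def C_class_iff_C_on)
qed

lemma Cc_infinity_support:
  assumes "f \<in> Cc_infinity \<Omega>"
  shows "\<exists>K. compact K \<and> K \<subseteq> \<Omega> \<and> (\<forall>x. x \<notin> K \<longrightarrow> f x = 0)"
proof (intro exI conjI)
  show "compact (closure {x. f x \<noteq> 0})" "closure {x. f x \<noteq> 0} \<subseteq> \<Omega>"
    using assms by (auto simp: Cc_infinity_def)
  show "\<forall>x. x \<notin> closure {x. f x \<noteq> 0} \<longrightarrow> f x = 0"
    using closure_subset[of "{x. f x \<noteq> 0}"] by auto
qed

lemma Cc_infinity_smooth: "f \<in> Cc_infinity \<Omega> \<Longrightarrow> smooth_on S f"
  by (rule smooth_on_subset[of UNIV]) (auto simp: Cc_infinity_def C_class_iff_C_on smooth_on_def)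

lemma Cc_infinity_mult:
  assumes "open \<Omega>" "smooth_on \<Omega> a" "f \<in> Cc_infinity \<Omega>"
  shows "(\<lambda>x. a x * f x) \<in> Cc_infinity \<Omega>"
proof -
  obtain K where "compact K" "K \<subseteq> \<Omega>" "\<And>x. x \<notin> K \<Longrightarrow> f x = 0"
    using Cc_infinity_support[OF assms(3)] by blast
  then show ?thesis
    using assms by (intro Cc_infinityI[of \<Omega> _ K] smooth_on_mult) (auto intro: Cc_infinity_smooth)
qed

lemma Cc_infinity_add:
  assumes "open \<Omega>" "f \<in> Cc_infinity \<Omega>" "g \<in> Cc_infinity \<Omega>"
  shows "(\<lambda>x. f x + g x) \<in> Cc_infinity \<Omega>"
proof -
  obtain K where K: "compact K" "K \<subseteq> \<Omega>" "\<And>x. x \<notin> K \<Longrightarrow> f x = 0"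
    using Cc_infinity_support[OF assms(2)] by blast
  obtain L where L: "compact L" "L \<subseteq> \<Omega>" "\<And>x. x \<notin> L \<Longrightarrow> g x = 0"
    using Cc_infinity_support[OF assms(3)] by blast
  show ?thesis
    using assms K L
    by (intro Cc_infinityI[of \<Omega> _ "K \<union> L"] smooth_on_add) (auto intro: Cc_infinity_smooth)
qed

lemma Cc_infinity_lin:
  assumes "open \<Omega>" "f \<in> Cc_infinity \<Omega>" "g \<in> Cc_infinity \<Omega>"
  shows "(\<lambda>x. a * f x + b * g x) \<in> Cc_infinity \<Omega>"
  using assms by (intro Cc_infinity_add Cc_infinity_mult smooth_on_const)

lemma Cc_infinity_sum:
  assumes "open \<Omega>" "\<And>i. i \<in> I \<Longrightarrow> f i \<in> Cc_infinity \<Omega>"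
  shows "(\<lambda>x. \<Sum>i\<in>I. f i x) \<in> Cc_infinity \<Omega>"
proof -
  have "(\<lambda>x. 0) \<in> Cc_infinity \<Omega>"
    using assms(1) by (intro Cc_infinityI[of _ _ "{}"] smooth_on_const) auto
  with assms(2) show ?thesis
    by (induction I rule: infinite_finite_induct) (auto intro: Cc_infinity_add assms(1))
qed

lemma Cc_infinity_partial_deriv:
  assumes "open \<Omega>" "f \<in> Cc_infinity \<Omega>"
  shows "partial_deriv k f \<in> Cc_infinity \<Omega>"
proof -
  obtain K where K: "compact K" "K \<subseteq> \<Omega>" "\<And>x. x \<notin> K \<Longrightarrow> f x = 0"
    using Cc_infinity_support[OF assms(2)] by blast
  have "partial_deriv k f x = 0" if "x \<notin> K" for x
    using partial_deriv_cong[of "- K" x f "\<lambda>x. 0" k] K that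
    by (simp add: compact_imp_closed open_Compl)
  then show ?thesis
    using assms K
    by (intro Cc_infinityI[of \<Omega> _ K] smooth_on_partial_deriv) (auto intro: Cc_infinity_smooth)
qed

lemma Cc_infinity_continuous: "f \<in> Cc_infinity \<Omega> \<Longrightarrow> continuous_on S f"
  by (intro smooth_on_continuous Cc_infinity_smooth)

lemma Cc_infinity_integrable_lborel:
  assumes "f \<in> Cc_infinity \<Omega>"
  shows "integrable lborel f"
proof -
  obtain K where K: "compact K" "K \<subseteq> \<Omega>" "\<And>x. x \<notin> K \<Longrightarrow> f x = 0"
    using Cc_infinity_support[OF assms] by blast
  have "integrable lborel (\<lambda>x. indicator K x *\<^sub>R f x)"
    by (rule borel_integrable_compact[OF K(1) Cc_infinity_continuous[OF assms]])
  moreover have "(\<lambda>x. indicator K x *\<^sub>R f x) = f"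
    using K(3) by (auto simp: fun_eq_iff indicator_def)
  ultimately show ?thesis by simp
qed

lemma Cc_infinity_integral:
  assumes "open \<Omega>" "f \<in> Cc_infinity \<Omega>"
  shows Cc_infinity_integrable: "integrable (lebesgue_on \<Omega>) f"
    and Cc_infinity_integral_eq_lborel: "integral\<^sup>L (lebesgue_on \<Omega>) f = integral\<^sup>L lborel f"
proof -
  have eq: "(\<lambda>x. indicator \<Omega> x * f x) = f"
    using Cc_infinity_support[OF assms(2)] by (fastforce simp: fun_eq_iff indicator_def)
  have f: "integrable lborel f"
    by (rule Cc_infinity_integrable_lborel[OF assms(2)])
  then have "f \<in> borel_measurable lborel" by auto
  with f show "integrable (lebesgue_on \<Omega>) f" "integral\<^sup>L (lebesgue_on \<Omega>) f = integral\<^sup>L lborel f"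
    using assms(1)
    by (simp_all add: integrable_restrict_space integral_restrict_space eq integral_completion integrable_completion)
qed

lemma Cc_infinity_L2:
  assumes "open \<Omega>" "f \<in> Cc_infinity \<Omega>"
  shows "f \<in> L2 \<Omega>"
proof -
  have "(\<lambda>x. f x * f x) \<in> Cc_infinity \<Omega>"
    using assms by (auto intro: Cc_infinity_mult Cc_infinity_smooth)
  then show ?thesis
    using assms Cc_infinity_integrable[of \<Omega> "\<lambda>x. f x * f x"] Cc_infinity_continuous[OF assms(2)]
    by (auto simp: L2_def power2_eq_square intro: continuous_on_measurable_lebesgue_on)
qed

lemma partial_deriv_DERIV:
  assumes "f differentiable at (x + s *\<^sub>R axis k 1)"
  shows "((\<lambda>t. f (x + t *\<^sub>R axis k 1)) has_real_derivative partial_deriv k f (x + s *\<^sub>R axis k 1)) (at s)"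
proof -
  obtain f' where f': "(f has_derivative f') (at (x + s *\<^sub>R axis k 1))"
    using assms by (auto simp: differentiable_def)
  have "((\<lambda>t::real. x + t *\<^sub>R axis k 1) has_derivative (\<lambda>t. t *\<^sub>R axis k 1)) (at s)"
    by (auto intro!: derivative_eq_intros)
  then have "((\<lambda>t::real. f (x + t *\<^sub>R axis k 1)) has_derivative (\<lambda>t. f' (t *\<^sub>R axis k 1))) (at s)"
    using has_derivative_compose[of "\<lambda>t::real. x + t *\<^sub>R axis k 1" _ s UNIV f f'] f' by simp
  moreover have "f' (t *\<^sub>R axis k 1) = partial_deriv k f (x + s *\<^sub>R axis k 1) * t" for t
    using linear_scale[OF has_derivative_linear[OF f']] partial_deriv_eq_frechet[OF f'] by simp
  ultimately show ?thesis
    by (simp add: has_field_derivative_def)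
qed

text \<open>The difference quotients of \<open>f\<close> integrate to zero by translation invariance.\<close>

lemma integral_partial_deriv_lborel:
  assumes "f \<in> Cc_infinity (\<Omega> :: (real^'d::finite) set)"
  shows "integral\<^sup>L lborel (partial_deriv k f) = 0"
proof -
  define e :: "real^'d" where "e = axis k 1"
  define t where "t n = inverse (real (Suc n))" for n
  have t: "t n > 0" "t n \<le> 1" for n
    by (auto simp: t_def inverse_eq_divide)
  have t_lim: "t \<longlonglongrightarrow> 0"
    unfolding t_def by (rule LIMSEQ_inverse_real_of_nat)
  define D where "D n x = (f (x + t n *\<^sub>R e) - f x) / t n" for n x
  have f: "f \<in> Cc_infinity UNIV"
    using assms by (auto simp: Cc_infinity_def)
  obtain K where K: "compact K" "K \<subseteq> \<Omega>" "\<And>x. x \<notin> K \<Longrightarrow> f x = 0"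
    using Cc_infinity_support[OF assms] by blast
  obtain R where R: "\<And>x. x \<in> K \<Longrightarrow> norm x \<le> R"
    using compact_imp_bounded[OF K(1)] by (auto simp: bounded_iff)
  have diff: "f differentiable at x" for x
    by (rule smooth_on_differentiable[OF Cc_infinity_smooth[OF f], of _ UNIV]) simp
  have pd: "partial_deriv k f \<in> Cc_infinity UNIV"
    using f by (rule Cc_infinity_partial_deriv[rotated]) simp
  obtain K' where K': "compact K'" "K' \<subseteq> UNIV" "\<And>x. x \<notin> K' \<Longrightarrow> partial_deriv k f x = 0"
    using Cc_infinity_support[OF pd] by blast
  have "bounded (partial_deriv k f ` K')"
    by (intro compact_imp_bounded compact_continuous_image K'(1) Cc_infinity_continuous[OF pd])
  then obtain M where M: "\<And>x. x \<in> K' \<Longrightarrow> \<bar>partial_deriv k f x\<bar> \<le> M" and "M > 0"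
    unfolding bounded_pos by auto
  then have M: "\<bar>partial_deriv k f x\<bar> \<le> M" for x
    using K'(3)[of x] by (cases "x \<in> K'") auto
  have int: "integrable lborel f"
    by (rule Cc_infinity_integrable_lborel[OF f])
  have shift: "integrable lborel (\<lambda>x. f (c + x))" "(\<integral>x. f (c + x) \<partial>lborel) = integral\<^sup>L lborel f" for c
  proof -
    have m: "f \<in> borel_measurable borel" using int by auto
    have "integrable (distr lborel borel ((+) c)) f"
      using int by (simp add: lborel_distr_plus)
    then show "integrable lborel (\<lambda>x. f (c + x))"
      using m by (simp add: integrable_distr_eq)
    have "integral\<^sup>L (distr lborel borel ((+) c)) f = (\<integral>x. f (c + x) \<partial>lborel)"
      using m by (subst integral_distr) auto
    then show "(\<integral>x. f (c + x) \<partial>lborel) = integral\<^sup>L lborel f"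
      by (simp add: lborel_distr_plus)
  qed
  have int_D: "integral\<^sup>L lborel (D n) = 0" for n
    using shift[of "t n *\<^sub>R e"] int by (simp add: D_def[abs_def] add.commute)
  \<comment> \<open>Inside the ball the mean value theorem turns the quotient into a value of the
    derivative. Outside it, \<open>t n \<le> 1\<close> keeps both \<open>x\<close> and the shifted
    point off \<open>K\<close>, hence the radius \<open>R + 1\<close>.\<close>
  have bound: "norm (D n x) \<le> M * indicator (cball 0 (R + 1)) x" for n x
  proof (cases "x \<in> cball 0 (R + 1)")
    case True
    have "\<exists>z>0. z < t n \<and> f (x + t n *\<^sub>R e) - f (x + 0 *\<^sub>R e) = (t n - 0) * partial_deriv k f (x + z *\<^sub>R e)"
      unfolding e_def by (rule MVT2[OF t(1)]) (auto intro: partial_deriv_DERIV diff)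
    then obtain z where "f (x + t n *\<^sub>R e) - f x = t n * partial_deriv k f (x + z *\<^sub>R e)"
      by auto
    then have "D n x = partial_deriv k f (x + z *\<^sub>R e)"
      using t[of n] by (simp add: D_def)
    then show ?thesis
      using M True by simp
  next
    case False
    have "norm x \<le> norm (x + t n *\<^sub>R e) + norm (t n *\<^sub>R e)"
      using norm_triangle_ineq4[of "x + t n *\<^sub>R e" "t n *\<^sub>R e"] by simp
    moreover have "norm (t n *\<^sub>R e) \<le> 1"
      using t[of n] by (simp add: e_def)
    ultimately have "x \<notin> K" "x + t n *\<^sub>R e \<notin> K"
      using False R[of x] R[of "x + t n *\<^sub>R e"] by auto
    then show ?thesis
      using K(3) False by (simp add: D_def)
  qed
  have lim: "(\<lambda>n. D n x) \<longlonglongrightarrow> partial_deriv k f x" for x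
  proof -
    have "(\<lambda>h. (f (x + h *\<^sub>R e) - f x) / h) \<midarrow>0\<rightarrow> partial_deriv k f x"
      using partial_deriv_DERIV[of f x 0 k] diff by (simp add: DERIV_def e_def)
    moreover have "filterlim t (at 0) sequentially"
      using t_lim t(1) by (auto simp: filterlim_at order_less_imp_not_eq2)
    ultimately show ?thesis
      unfolding D_def by (rule filterlim_compose)
  qed
  have "(\<lambda>n. integral\<^sup>L lborel (D n)) \<longlonglongrightarrow> integral\<^sup>L lborel (partial_deriv k f)"
  proof (rule integral_dominated_convergence)
    show "integrable lborel (\<lambda>x::real^'d. M * indicator (cball 0 (R + 1)) x :: real)"
      by (intro integrable_mult_right integrable_real_indicator)
         (use emeasure_lborel_cball_finite[of "0::real^'d" "R + 1"] in auto)
    show "D n \<in> borel_measurable lborel" for n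
      using shift[of "t n *\<^sub>R e"] int by (auto simp: D_def[abs_def] add.commute)
    show "partial_deriv k f \<in> borel_measurable lborel"
      using Cc_infinity_integrable_lborel[OF pd] by auto
  qed (use lim bound in auto)
  then show ?thesis
    using int_D by (simp add: LIMSEQ_const_iff)
qed

lemma integral_partial_deriv:
  assumes "open \<Omega>" "f \<in> Cc_infinity \<Omega>"
  shows "integral\<^sup>L (lebesgue_on \<Omega>) (partial_deriv k f) = 0"
  using Cc_infinity_integral_eq_lborel[OF assms(1) Cc_infinity_partial_deriv[OF assms]]
    integral_partial_deriv_lborel[OF assms(2)] by simp

subsection \<open>The operator associated with a weighted form\<close>

definition h_polar :: "(real^'d::finite) set \<Rightarrow> (real^'d \<Rightarrow> real) \<Rightarrow> (real^'d \<Rightarrow> real) \<Rightarrow> (real^'d \<Rightarrow> real) \<Rightarrow> real" where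
  "h_polar \<Omega> c u v = (\<Sum>k\<in>UNIV. L2_inner \<Omega> (partial_deriv k u) (\<lambda>x. c x * partial_deriv k v x))"

definition divergence_op :: "(real^'d::finite \<Rightarrow> real) \<Rightarrow> (real^'d \<Rightarrow> real) \<Rightarrow> real^'d \<Rightarrow> real" where
  "divergence_op c u x = - (\<Sum>k\<in>UNIV. partial_deriv k (\<lambda>y. c y * partial_deriv k u y) x)"

locale weighted_form =
  fixes \<Omega> :: "(real^'d::finite) set" and c :: "real^'d \<Rightarrow> real"
  assumes open_dom: "open \<Omega>"
    and smooth_weight: "smooth_on \<Omega> c"
    and weight_nonneg: "x \<in> \<Omega> \<Longrightarrow> c x \<ge> 0"
begin

abbreviation core :: "(real^'d \<Rightarrow> real) set" where
  "core \<equiv> Cc_infinity \<Omega>"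

lemma weighted_deriv_core: "u \<in> core \<Longrightarrow> (\<lambda>x. c x * partial_deriv k u x) \<in> core"
  by (intro Cc_infinity_mult Cc_infinity_partial_deriv open_dom smooth_weight)

lemma deriv_core: "u \<in> core \<Longrightarrow> partial_deriv k u \<in> core"
  by (intro Cc_infinity_partial_deriv open_dom)

lemma core_L2: "u \<in> core \<Longrightarrow> u \<in> L2 \<Omega>"
  by (intro Cc_infinity_L2 open_dom)

lemma core_differentiable: "u \<in> core \<Longrightarrow> u differentiable at x"
  by (rule smooth_on_differentiable[of UNIV]) (auto intro: Cc_infinity_smooth)

lemma partial_deriv_lin:
  assumes "u \<in> core" "v \<in> core"
  shows "partial_deriv k (\<lambda>x. a * u x + b * v x) = (\<lambda>x. a * partial_deriv k u x + b * partial_deriv k v x)"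
proof
  fix x
  have "partial_deriv k (\<lambda>x. a * u x + b * v x) x
      = partial_deriv k (\<lambda>x. a * u x) x + partial_deriv k (\<lambda>x. b * v x) x"
    using assms by (intro partial_deriv_add) (auto intro!: differentiable_mult core_differentiable)
  then show "partial_deriv k (\<lambda>x. a * u x + b * v x) x = a * partial_deriv k u x + b * partial_deriv k v x"
    using assms by (simp add: partial_deriv_mult core_differentiable)
qed

sublocale form: semi_inner core "h_polar \<Omega> c"
proof
  fix u v assume uv: "u \<in> core" "v \<in> core"
  fix a b show "(\<lambda>x. a * u x + b * v x) \<in> core"
    by (rule Cc_infinity_lin[OF open_dom uv])
  show "h_polar \<Omega> c u v = h_polar \<Omega> c v u"
    unfolding h_polar_def L2_inner_def by (simp add: mult_ac)
  fix w assume w: "w \<in> core"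
  show "h_polar \<Omega> c (\<lambda>x. a * u x + b * v x) w = a * h_polar \<Omega> c u w + b * h_polar \<Omega> c v w"
    unfolding h_polar_def partial_deriv_lin[OF uv]
    using uv w by (simp add: L2.lin_left core_L2 deriv_core weighted_deriv_core sum.distrib sum_distrib_left)
next
  fix u assume "u \<in> core"
  show "0 \<le> h_polar \<Omega> c u u"
    unfolding h_polar_def L2_inner_def
    by (intro sum_nonneg Bochner_Integration.integral_nonneg) (auto simp: weight_nonneg mult.left_commute)
qed

lemma h_core_eq: "h_core \<Omega> c u = h_polar \<Omega> c u u"
  by (simp add: h_core_def h_polar_def)

lemma divergence_op_core:
  assumes "u \<in> core"
  shows "divergence_op c u \<in> core"
proof -
  have "(\<lambda>x. \<Sum>k\<in>UNIV. partial_deriv k (\<lambda>y. c y * partial_deriv k u y) x) \<in> core"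
    by (intro Cc_infinity_sum open_dom deriv_core weighted_deriv_core assms)
  from Cc_infinity_lin[OF open_dom this this, of "-1" 0] show ?thesis
    by (simp add: divergence_op_def[abs_def])
qed

text \<open>The product of \<open>c\<close>, the \<open>k\<close>-th derivative of \<open>u\<close>,
  and \<open>v\<close> is a test function, so its \<open>k\<close>-th derivative has integral zero;
  the product rule splits that integral.\<close>

lemma h_polar_eq_divergence_op:
  assumes u: "u \<in> core" and v: "v \<in> core"
  shows "h_polar \<Omega> c u v = L2_inner \<Omega> (divergence_op c u) v"
proof -
  let ?g = "\<lambda>k y. c y * partial_deriv k u y"
  have int: "integrable (lebesgue_on \<Omega>) (\<lambda>x. f x * g x)" if "f \<in> core" "g \<in> core" for f g
    using L2_mult_integrable core_L2 that by blast
  have k: "L2_inner \<Omega> (partial_deriv k u) (\<lambda>x. c x * partial_deriv k v x)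
      = - L2_inner \<Omega> (partial_deriv k (?g k)) v" for k
  proof -
    have gv: "(\<lambda>x. ?g k x * v x) \<in> core"
      using u v by (intro Cc_infinity_mult open_dom Cc_infinity_smooth[OF weighted_deriv_core])
    have "partial_deriv k (\<lambda>x. ?g k x * v x) = (\<lambda>x. ?g k x * partial_deriv k v x + partial_deriv k (?g k) x * v x)"
      using u v by (intro ext partial_deriv_mult core_differentiable weighted_deriv_core)
    then have "0 = (\<integral>x. ?g k x * partial_deriv k v x + partial_deriv k (?g k) x * v x \<partial>lebesgue_on \<Omega>)"
      using integral_partial_deriv[OF open_dom gv, of k] by simp
    also have "\<dots> = (\<integral>x. ?g k x * partial_deriv k v x \<partial>lebesgue_on \<Omega>)
        + (\<integral>x. partial_deriv k (?g k) x * v x \<partial>lebesgue_on \<Omega>)"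
      using u v by (intro Bochner_Integration.integral_add int weighted_deriv_core deriv_core)
    finally show ?thesis
      by (simp add: L2_inner_def mult_ac)
  qed
  have "L2_inner \<Omega> (divergence_op c u) v
      = (\<integral>x. (\<Sum>k\<in>UNIV. - (partial_deriv k (?g k) x * v x)) \<partial>lebesgue_on \<Omega>)"
    by (simp add: L2_inner_def divergence_op_def sum_distrib_right sum_negf)
  also have "\<dots> = (\<Sum>k\<in>UNIV. - L2_inner \<Omega> (partial_deriv k (?g k)) v)"
    using u v unfolding L2_inner_def
    by (subst Bochner_Integration.integral_sum)
       (auto intro!: Bochner_Integration.integrable_minus int weighted_deriv_core deriv_core)
  finally show ?thesis
    by (simp add: h_polar_def k)
qed

text \<open>Friedrichs' argument: the form of a positive symmetric operator is closable.\<close>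

lemma form_closable:
  assumes u: "\<And>n. u n \<in> core" and lim: "(\<lambda>n. L2_norm \<Omega> (u n)) \<longlonglongrightarrow> 0"
    and cauchy: "\<forall>e>0. \<exists>N. \<forall>m\<ge>N. \<forall>n\<ge>N. h_core \<Omega> c (\<lambda>x. u m x - u n x) < e"
  shows "(\<lambda>n. form.seminorm (u n)) \<longlonglongrightarrow> 0"
proof (rule LIMSEQ_I)
  fix r :: real assume "r > 0"
  then obtain N where N: "\<And>m n. m \<ge> N \<Longrightarrow> n \<ge> N \<Longrightarrow> h_core \<Omega> c (\<lambda>x. u m x - u n x) < (r / 2)\<^sup>2"
    using cauchy zero_less_power[of "r / 2" 2] by (metis half_gt_zero)
  have "form.seminorm (u n) \<le> r / 2" if n: "n \<ge> N" for n
  proof -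
    \<comment> \<open>Split \<open>h (u n, u n)\<close> as
      \<open>h (u n, u n - u m) + h (u n, u m)\<close>: the first part is small by the Cauchy
      property, the second moves to L2 by integration by parts.\<close>
    have le: "(form.seminorm (u n))\<^sup>2 \<le> form.seminorm (u n) * (r / 2)
        + L2_norm \<Omega> (divergence_op c (u n)) * L2_norm \<Omega> (u m)" if "m \<ge> N" for m
    proof -
      have d: "(\<lambda>x. u n x - u m x) \<in> core"
        using u by (intro form.diff_closed)
      have "form.seminorm (\<lambda>x. u n x - u m x) \<le> r / 2"
        unfolding form.seminorm_def
        using N[OF n that] \<open>r > 0\<close> by (intro real_le_lsqrt) (auto simp: h_core_eq form.nonneg d)
      then have "form.seminorm (u n) * form.seminorm (\<lambda>x. u n x - u m x) \<le> form.seminorm (u n) * (r / 2)"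
        using form.seminorm_nonneg[OF u] by (intro mult_left_mono)
      moreover have "h_polar \<Omega> c (u n) (u n)
          = h_polar \<Omega> c (u n) (\<lambda>x. u n x - u m x) + L2_inner \<Omega> (divergence_op c (u n)) (u m)"
        using u by (simp add: form.diff_right flip: h_polar_eq_divergence_op)
      ultimately show ?thesis
        using form.Cauchy_Schwarz[OF u d, of n] L2.Cauchy_Schwarz[OF core_L2[OF divergence_op_core[OF u]] core_L2[OF u], of n m]
        by (simp add: form.seminorm_power2 u L2_norm_eq_seminorm)
    qed
    \<comment> \<open>With \<open>n\<close> fixed, \<open>divergence_op c (u n)\<close> is one fixed
      element of L2, so the last term vanishes as \<open>m\<close> grows.\<close>
    have "(\<lambda>m. form.seminorm (u n) * (r / 2) + L2_norm \<Omega> (divergence_op c (u n)) * L2_norm \<Omega> (u m))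
        \<longlonglongrightarrow> form.seminorm (u n) * (r / 2) + L2_norm \<Omega> (divergence_op c (u n)) * 0"
      by (intro tendsto_intros lim)
    then have "(form.seminorm (u n))\<^sup>2 \<le> form.seminorm (u n) * (r / 2)"
      using le by (intro LIMSEQ_le_const) auto
    then have "form.seminorm (u n) * (form.seminorm (u n) - r / 2) \<le> 0"
      by (simp add: power2_eq_square algebra_simps)
    then show ?thesis
      using form.seminorm_nonneg[OF u, of n] \<open>r > 0\<close> by (auto simp: mult_le_0_iff)
  qed
  then show "\<exists>no. \<forall>n\<ge>no. norm (form.seminorm (u n) - 0) < r"
    using form.seminorm_nonneg[OF u] \<open>r > 0\<close> by (intro exI[of _ N]) fastforce
qed

abbreviation approx :: "(nat \<Rightarrow> real^'d \<Rightarrow> real) \<Rightarrow> (real^'d \<Rightarrow> real) \<Rightarrow> bool" where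
  "approx \<equiv> form_approx \<Omega> core (h_core \<Omega> c)"

lemma approx_seminorm_cauchy:
  assumes "approx u \<phi>" "e > 0"
  shows "\<exists>N. \<forall>m\<ge>N. \<forall>n\<ge>N. form.seminorm (\<lambda>x. u m x - u n x) < e"
proof -
  have "e\<^sup>2 > 0" using assms(2) by simp
  then obtain N where "\<forall>m\<ge>N. \<forall>n\<ge>N. h_core \<Omega> c (\<lambda>x. u m x - u n x) < e\<^sup>2"
    using assms(1) unfolding form_approx_def by blast
  then have "\<forall>m\<ge>N. \<forall>n\<ge>N. form.seminorm (\<lambda>x. u m x - u n x) < e"
    using assms(2) by (auto simp: form.seminorm_def h_core_eq intro: real_less_lsqrt)
  then show ?thesis by blast
qed

text \<open>The difference of two approximations of one function approximates 0, which is the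
  situation of \<open>form_closable\<close>. With a constant first sequence it also gives access to
  the form value of \<open>u n - \<phi>\<close>.\<close>

lemma approx_diff:
  assumes "approx u \<phi>" "approx v \<psi>" "\<phi> \<in> L2 \<Omega>" "\<psi> \<in> L2 \<Omega>"
  shows "approx (\<lambda>n x. u n x - v n x) (\<lambda>x. \<phi> x - \<psi> x)"
  unfolding form_approx_def
proof (intro conjI allI impI)
  have u: "u n \<in> core" and v: "v n \<in> core" for n
    using assms unfolding form_approx_def by auto
  then show "(\<lambda>x. u n x - v n x) \<in> core" for n
    by (intro form.diff_closed)
  have eq: "(\<lambda>x. u n x - v n x - (\<phi> x - \<psi> x)) = (\<lambda>x. (u n x - \<phi> x) - (v n x - \<psi> x))" for n
    by auto
  have le: "L2_norm \<Omega> (\<lambda>x. u n x - v n x - (\<phi> x - \<psi> x))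
      \<le> L2_norm \<Omega> (\<lambda>x. u n x - \<phi> x) + L2_norm \<Omega> (\<lambda>x. v n x - \<psi> x)" for n
  proof -
    have m: "(\<lambda>x. u n x - \<phi> x) \<in> L2 \<Omega>" "(\<lambda>x. \<psi> x - v n x) \<in> L2 \<Omega>"
      using u v core_L2 assms(3,4) by (auto intro: L2.diff_closed)
    show ?thesis
      using L2.seminorm_triangle[OF m] L2.seminorm_diff_commute[OF core_L2[OF v[of n]] assms(4)]
      by (simp add: L2_norm_eq_seminorm algebra_simps)
  qed
  show "(\<lambda>n. L2_norm \<Omega> (\<lambda>x. u n x - v n x - (\<phi> x - \<psi> x))) \<longlonglongrightarrow> 0"
  proof (rule tendsto_sandwich[OF always_eventually always_eventually tendsto_const])
    show "(\<lambda>n. L2_norm \<Omega> (\<lambda>x. u n x - \<phi> x) + L2_norm \<Omega> (\<lambda>x. v n x - \<psi> x)) \<longlonglongrightarrow> 0"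
      using assms(1,2) unfolding form_approx_def by (auto intro: tendsto_add_zero)
  qed (use le in \<open>auto simp: L2_norm_def L2_inner_def\<close>)
  fix e :: real assume "e > 0"
  then have "sqrt e / 2 > 0" by simp
  then obtain N1 N2 where
    N1: "\<forall>m\<ge>N1. \<forall>n\<ge>N1. form.seminorm (\<lambda>x. u m x - u n x) < sqrt e / 2" and
    N2: "\<forall>m\<ge>N2. \<forall>n\<ge>N2. form.seminorm (\<lambda>x. v m x - v n x) < sqrt e / 2"
    using approx_seminorm_cauchy assms(1,2) by meson
  have "h_core \<Omega> c (\<lambda>x. u m x - v m x - (u n x - v n x)) < e" if "m \<ge> max N1 N2" "n \<ge> max N1 N2" for m n
  proof -
    have m: "(\<lambda>x. u m x - u n x) \<in> core" "(\<lambda>x. v n x - v m x) \<in> core"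
      using u v by (auto intro: form.diff_closed)
    have "form.seminorm (\<lambda>x. u m x - v m x - (u n x - v n x))
        \<le> form.seminorm (\<lambda>x. u m x - u n x) + form.seminorm (\<lambda>x. v n x - v m x)"
      using form.seminorm_triangle[OF m] by (simp add: algebra_simps)
    also have "\<dots> < sqrt e"
      using N1 N2 that by (metis (no_types, lifting) add_strict_mono field_sum_of_halves max.bounded_iff)
    finally show ?thesis
      by (simp add: form.seminorm_def h_core_eq)
  qed
  then show "\<exists>N. \<forall>m\<ge>N. \<forall>n\<ge>N. h_core \<Omega> c (\<lambda>x. u m x - v m x - (u n x - v n x)) < e"
    by blast
qed

lemma approx_const:
  assumes "u \<in> core" shows "approx (\<lambda>n. u) u"
proof -
  have "h_core \<Omega> c (\<lambda>x. 0) = 0"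
    by (simp add: h_core_def L2_inner_def)
  then show ?thesis
    using assms by (simp add: form_approx_def L2_norm_def L2_inner_def)
qed

text \<open>\<open>h_form\<close> is a definite description, without known value until uniqueness is
  established. The form norms along \<open>u\<close> are a Cauchy sequence, and closability applied
  to the difference of two approximations gives every other approximation the same limit.\<close>

lemma h_form_tendsto:
  assumes "approx u \<phi>" "\<phi> \<in> L2 \<Omega>"
  shows "(\<lambda>n. h_core \<Omega> c (u n)) \<longlonglongrightarrow> h_form \<Omega> c \<phi>"
proof -
  have core: "u n \<in> core" if "approx u \<psi>" for u n \<psi>
    using that unfolding form_approx_def by auto
  have "Cauchy (\<lambda>n. form.seminorm (u n))"
    unfolding Cauchy_def dist_real_def
    using approx_seminorm_cauchy[OF assms(1)] form.seminorm_diff_le[OF core core, OF assms(1) assms(1)]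
    by (meson order_le_less_trans)
  then obtain l where l: "(\<lambda>n. form.seminorm (u n)) \<longlonglongrightarrow> l"
    using Cauchy_convergent convergent_def by blast
  have sq: "h_core \<Omega> c (v n) = (form.seminorm (v n))\<^sup>2" if "approx v \<phi>" for v n
    using core[OF that] by (simp add: form.seminorm_power2 h_core_eq)
  have lim: "(\<lambda>n. h_core \<Omega> c (v n)) \<longlonglongrightarrow> l\<^sup>2" if v: "approx v \<phi>" for v
  proof -
    have "approx (\<lambda>n x. u n x - v n x) (\<lambda>x. \<phi> x - \<phi> x)"
      using assms v by (intro approx_diff)
    then have d: "(\<lambda>n. form.seminorm (\<lambda>x. u n x - v n x)) \<longlonglongrightarrow> 0"
      unfolding form_approx_def by (intro form_closable) auto
    have "(\<lambda>n. form.seminorm (u n) - form.seminorm (v n)) \<longlonglongrightarrow> 0"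
      by (rule Lim_null_comparison[OF always_eventually d])
        (use form.seminorm_diff_le[OF core[OF assms(1)] core[OF v]] in auto)
    from tendsto_diff[OF l this] have "(\<lambda>n. form.seminorm (v n)) \<longlonglongrightarrow> l"
      by simp
    then show ?thesis
      unfolding sq[OF v] by (rule tendsto_power)
  qed
  have "h_form \<Omega> c \<phi> = l\<^sup>2"
    unfolding h_form_def form_closure_def
  proof (rule the_equality)
    show "\<exists>u. approx u \<phi> \<and> (\<lambda>n. h_core \<Omega> c (u n)) \<longlonglongrightarrow> l\<^sup>2"
      using assms(1) lim by blast
    show "a = l\<^sup>2" if "\<exists>u. approx u \<phi> \<and> (\<lambda>n. h_core \<Omega> c (u n)) \<longlonglongrightarrow> a" for a
      using that lim LIMSEQ_unique by blast
  qed
  then show ?thesis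
    using lim[OF assms(1)] by simp
qed

lemma core_h_dom: "u \<in> core \<Longrightarrow> u \<in> h_dom \<Omega> c"
  using approx_const core_L2 by (auto simp: h_dom_def form_closure_dom_def)

lemma h_form_core: "u \<in> core \<Longrightarrow> h_form \<Omega> c u = h_polar \<Omega> c u u"
  using h_form_tendsto[OF approx_const core_L2] by (simp add: LIMSEQ_const_iff h_core_eq)

end

text \<open>\<open>associated_operator\<close> only asserts that a square root exists; here one is
  fixed. Form values become squared L2 norms of its values, so the work on \<open>H\<close> is done
  with \<open>S\<close>.\<close>

locale weighted_operator = weighted_form \<Omega> c for \<Omega> :: "(real^'d::finite) set" and c +
  fixes H S :: "(real^'d \<Rightarrow> real) rel"
  assumes sqrt: "is_operator_sqrt \<Omega> S H"
    and dom_sqrt: "Domain S = h_dom \<Omega> c"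
    and form_sqrt: "(\<phi>, \<psi>) \<in> S \<Longrightarrow> h_form \<Omega> c \<phi> = (L2_norm \<Omega> \<psi>)\<^sup>2"
begin

lemma selfadjoint: "L2_adjoint \<Omega> S = S"
  and operator: "L2_operator \<Omega> S"
  and H_eq: "H = S O S"
  using sqrt by (auto simp: is_operator_sqrt_def positive_selfadjoint_def)

lemma S_L2: "(\<phi>, \<psi>) \<in> S \<Longrightarrow> \<phi> \<in> L2 \<Omega>" "(\<phi>, \<psi>) \<in> S \<Longrightarrow> \<psi> \<in> L2 \<Omega>"
  using operator by (auto simp: L2_operator_def)

lemma S_lin:
  "(\<phi>, \<psi>) \<in> S \<Longrightarrow> (\<phi>', \<psi>') \<in> S \<Longrightarrow> (\<lambda>x. a * \<phi> x + b * \<phi>' x, \<lambda>x. a * \<psi> x + b * \<psi>' x) \<in> S"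
  using operator by (simp add: L2_operator_def)

lemma S_symmetric: "(\<phi>, \<psi>) \<in> S \<Longrightarrow> (\<phi>', \<psi>') \<in> S \<Longrightarrow> L2_inner \<Omega> \<psi> \<phi>' = L2_inner \<Omega> \<phi> \<psi>'"
  using selfadjoint unfolding L2_adjoint_def by fast

text \<open>Polarisation: \<open>form_sqrt\<close> supplies the diagonal values only.\<close>

lemma inner_S_core:
  assumes "(u, \<psi>) \<in> S" "(v, \<psi>') \<in> S" "u \<in> core" "v \<in> core"
  shows "L2_inner \<Omega> \<psi> \<psi>' = h_polar \<Omega> c u v"
proof -
  have n: "L2_inner \<Omega> \<eta> \<eta> = h_polar \<Omega> c w w" if "(w, \<eta>) \<in> S" "w \<in> core" for w \<eta>
    using form_sqrt[OF that(1)] h_form_core[OF that(2)] S_L2[OF that(1)]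
    by (simp add: L2_norm_eq_seminorm L2.seminorm_power2)
  have "(\<lambda>x. u x + v x, \<lambda>x. \<psi> x + \<psi>' x) \<in> S"
    using S_lin[OF assms(1,2), of 1 1] by simp
  from n[OF this form.add_closed[OF assms(3,4)]] n[OF assms(1,3)] n[OF assms(2,4)] show ?thesis
    using S_L2[OF assms(1)] S_L2[OF assms(2)] assms(3,4) by (simp add: L2.expand_add form.expand_add)
qed

lemma S_approx:
  assumes "approx u \<phi>" "(\<phi>, \<psi>) \<in> S" "\<And>n. (u n, \<eta> n) \<in> S"
  shows "(\<lambda>n. L2_norm \<Omega> (\<lambda>x. \<eta> n x - \<psi> x)) \<longlonglongrightarrow> 0"
proof (rule LIMSEQ_I)
  fix r :: real assume "r > 0"
  then have "(r / 2)\<^sup>2 > 0" by simp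
  then obtain N where N: "\<And>m n. m \<ge> N \<Longrightarrow> n \<ge> N \<Longrightarrow> h_core \<Omega> c (\<lambda>x. u m x - u n x) < (r / 2)\<^sup>2"
    using assms(1) unfolding form_approx_def by meson
  have u: "u n \<in> core" for n
    using assms(1) unfolding form_approx_def by auto
  have "L2_norm \<Omega> (\<lambda>x. \<eta> n x - \<psi> x) < r" if "n \<ge> N" for n
  proof -
    \<comment> \<open>For fixed \<open>n\<close> the form value of \<open>u n - \<phi>\<close> is
      the limit in \<open>m\<close> of the values of \<open>u n - u m\<close>, all below
      \<open>(r / 2)^2\<close>.\<close>
    have "approx (\<lambda>m x. u n x - u m x) (\<lambda>x. u n x - \<phi> x)"
      by (intro approx_diff approx_const assms u core_L2 S_L2(1)[OF assms(2)])
    then have "(\<lambda>m. h_core \<Omega> c (\<lambda>x. u n x - u m x)) \<longlonglongrightarrow> h_form \<Omega> c (\<lambda>x. u n x - \<phi> x)"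
      by (rule h_form_tendsto) (intro L2.diff_closed core_L2 u S_L2(1)[OF assms(2)])
    then have "h_form \<Omega> c (\<lambda>x. u n x - \<phi> x) \<le> (r / 2)\<^sup>2"
      using N[OF that] by (intro LIMSEQ_le_const2) (auto intro: less_imp_le)
    moreover have "(\<lambda>x. u n x - \<phi> x, \<lambda>x. \<eta> n x - \<psi> x) \<in> S"
      using S_lin[OF assms(3,2), of 1 n "-1"] by simp
    ultimately have "(L2_norm \<Omega> (\<lambda>x. \<eta> n x - \<psi> x))\<^sup>2 \<le> (r / 2)\<^sup>2"
      using form_sqrt by simp
    then have "L2_norm \<Omega> (\<lambda>x. \<eta> n x - \<psi> x) \<le> r / 2"
      by (rule power2_le_imp_le) (use \<open>r > 0\<close> in simp)
    then show ?thesis using \<open>r > 0\<close> by simp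
  qed
  then show "\<exists>no. \<forall>n\<ge>no. norm (L2_norm \<Omega> (\<lambda>x. \<eta> n x - \<psi> x) - 0) < r"
    by (auto simp: L2_norm_def L2_inner_def)
qed

lemma ex_approx:
  assumes "(\<phi>, \<psi>) \<in> S"
  obtains u \<eta> where "approx u \<phi>" "\<And>n. (u n, \<eta> n) \<in> S" "\<And>n. u n \<in> core"
    "(\<lambda>n. L2_norm \<Omega> (\<lambda>x. \<eta> n x - \<psi> x)) \<longlonglongrightarrow> 0"
proof -
  have "\<phi> \<in> h_dom \<Omega> c"
    using assms dom_sqrt by auto
  then obtain u where u: "approx u \<phi>"
    by (auto simp: h_dom_def form_closure_dom_def)
  then have core: "u n \<in> core" for n
    unfolding form_approx_def by auto
  then have "\<exists>\<eta>. (u n, \<eta>) \<in> S" for n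
    using core_h_dom dom_sqrt by blast
  then obtain \<eta> where "\<And>n. (u n, \<eta> n) \<in> S"
    by metis
  then show ?thesis
    using that u core S_approx[OF u assms] by blast
qed

text \<open>As \<open>S\<close> is its own adjoint, \<open>S v\<close> lies in \<open>D(S)\<close>
  once \<open>(S f, S v) = (f, divergence_op c v)\<close> for all \<open>f\<close> in
  \<open>D(S)\<close>. For test functions \<open>f\<close> this is integration by parts, and both
  sides pass to the limit along a form approximation.\<close>

lemma core_in_H:
  assumes v: "v \<in> core"
  shows "(v, divergence_op c v) \<in> H"
proof -
  obtain \<psi> where \<psi>: "(v, \<psi>) \<in> S"
    using core_h_dom[OF v] dom_sqrt by blast
  have "L2_inner \<Omega> g \<psi> = L2_inner \<Omega> f (divergence_op c v)" if fg: "(f, g) \<in> S" for f g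
  proof -
    obtain u \<eta> where u: "approx u f" "\<And>n. (u n, \<eta> n) \<in> S" "\<And>n. u n \<in> core"
      "(\<lambda>n. L2_norm \<Omega> (\<lambda>x. \<eta> n x - g x)) \<longlonglongrightarrow> 0"
      using ex_approx[OF fg] by blast
    have "(\<lambda>n. L2_inner \<Omega> (\<eta> n) \<psi>) \<longlonglongrightarrow> L2_inner \<Omega> g \<psi>"
      using u(2,4) \<psi> fg by (intro L2.tendsto_left) (auto simp: L2_norm_eq_seminorm intro: S_L2)
    moreover have "L2_inner \<Omega> (\<eta> n) \<psi> = L2_inner \<Omega> (u n) (divergence_op c v)" for n
      using inner_S_core[OF u(2) \<psi> u(3) v] h_polar_eq_divergence_op[OF v u(3)] form.sym[OF u(3) v]
      by (simp add: L2_inner_def mult.commute)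
    moreover have "(\<lambda>n. L2_inner \<Omega> (u n) (divergence_op c v)) \<longlonglongrightarrow> L2_inner \<Omega> f (divergence_op c v)"
      using u(1,3) fg v unfolding form_approx_def
      by (intro L2.tendsto_left) (auto simp: L2_norm_eq_seminorm intro: S_L2 core_L2 divergence_op_core)
    ultimately show ?thesis
      using LIMSEQ_unique by fastforce
  qed
  then have "(\<psi>, divergence_op c v) \<in> L2_adjoint \<Omega> S"
    using S_L2[OF \<psi>] core_L2[OF divergence_op_core[OF v]] by (auto simp: L2_adjoint_def)
  then show ?thesis
    using \<psi> selfadjoint H_eq by auto
qed

lemma H_L2: "(\<phi>, \<eta>) \<in> H \<Longrightarrow> \<phi> \<in> L2 \<Omega>" "(\<phi>, \<eta>) \<in> H \<Longrightarrow> \<eta> \<in> L2 \<Omega>"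
  using S_L2 H_eq by auto

text \<open>The functions later paired with \<open>H \<phi>\<close> are truncations of
  \<open>u n\<close>: they vary with \<open>n\<close> and are only known to be bounded in form norm.
  The error for such a sequence is at most the norm of \<open>S (u n) - S \<phi>\<close> times that
  bound.\<close>

lemma H_weak_form:
  assumes "(\<phi>, \<eta>) \<in> H"
  obtains u where "\<And>n. u n \<in> core" "(\<lambda>n. L2_norm \<Omega> (\<lambda>x. u n x - \<phi> x)) \<longlonglongrightarrow> 0"
    "Bseq (\<lambda>n. form.seminorm (u n))"
    "\<And>v. (\<And>n. v n \<in> core) \<Longrightarrow> Bseq (\<lambda>n. form.seminorm (v n)) \<Longrightarrow>
      (\<lambda>n. L2_inner \<Omega> \<eta> (v n) - h_polar \<Omega> c (u n) (v n)) \<longlonglongrightarrow> 0"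
proof -
  obtain \<psi> where \<psi>: "(\<phi>, \<psi>) \<in> S" "(\<psi>, \<eta>) \<in> S"
    using assms H_eq by auto
  obtain u \<zeta> where u: "approx u \<phi>" "\<And>n. (u n, \<zeta> n) \<in> S" "\<And>n. u n \<in> core"
    "(\<lambda>n. L2_norm \<Omega> (\<lambda>x. \<zeta> n x - \<psi> x)) \<longlonglongrightarrow> 0"
    using ex_approx[OF \<psi>(1)] by blast
  have norm_eq: "L2_norm \<Omega> \<xi> = form.seminorm w" if "(w, \<xi>) \<in> S" "w \<in> core" for w \<xi>
    using inner_S_core[OF that(1) that(1) that(2) that(2)] by (simp add: L2_norm_def form.seminorm_def)
  have "(\<lambda>n. L2_norm \<Omega> (\<zeta> n)) \<longlonglongrightarrow> L2_norm \<Omega> \<psi>"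
    using u(4) S_L2[OF u(2)] S_L2[OF \<psi>(1)] unfolding L2_norm_eq_seminorm by (intro L2.tendsto_seminorm)
  then have "convergent (\<lambda>n. form.seminorm (u n))"
    using norm_eq[OF u(2,3)] by (auto simp: convergent_def)
  then have "Bseq (\<lambda>n. form.seminorm (u n))"
    by (rule convergent_imp_Bseq)
  moreover have "(\<lambda>n. L2_inner \<Omega> \<eta> (v n) - h_polar \<Omega> c (u n) (v n)) \<longlonglongrightarrow> 0"
    if v: "\<And>n. v n \<in> core" and B: "Bseq (\<lambda>n. form.seminorm (v n))" for v
  proof -
    have "\<exists>\<xi>. (v n, \<xi>) \<in> S" for n
      using core_h_dom[OF v] dom_sqrt by blast
    then obtain \<xi> where \<xi>: "\<And>n. (v n, \<xi> n) \<in> S"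
      by metis
    obtain K where K: "K > 0" "\<And>n. norm (form.seminorm (v n)) \<le> K"
      using B by (auto simp: Bseq_def)
    have le: "\<bar>L2_inner \<Omega> \<eta> (v n) - h_polar \<Omega> c (u n) (v n)\<bar> \<le> L2_norm \<Omega> (\<lambda>x. \<zeta> n x - \<psi> x) * K" for n
    proof -
      have m: "\<psi> \<in> L2 \<Omega>" "\<zeta> n \<in> L2 \<Omega>" "\<xi> n \<in> L2 \<Omega>"
        using S_L2(2)[OF \<psi>(1)] S_L2(2)[OF u(2)] S_L2(2)[OF \<xi>] by auto
      \<comment> \<open>Symmetry of \<open>S\<close> turns \<open>(H \<phi>, v)\<close> into
        \<open>(S \<phi>, S v)\<close>, and on test functions
        \<open>h (u, v) = (S u, S v)\<close>.\<close>
      have "L2_inner \<Omega> \<eta> (v n) - h_polar \<Omega> c (u n) (v n) = L2_inner \<Omega> \<psi> (\<xi> n) - L2_inner \<Omega> (\<zeta> n) (\<xi> n)"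
        using S_symmetric[OF \<psi>(2) \<xi>] inner_S_core[OF u(2) \<xi> u(3) v] by simp
      also have "\<dots> = - L2_inner \<Omega> (\<lambda>x. \<zeta> n x - \<psi> x) (\<xi> n)"
        using m by (simp add: L2.diff_left)
      finally have "\<bar>L2_inner \<Omega> \<eta> (v n) - h_polar \<Omega> c (u n) (v n)\<bar> \<le> L2_norm \<Omega> (\<lambda>x. \<zeta> n x - \<psi> x) * L2_norm \<Omega> (\<xi> n)"
        using L2.Cauchy_Schwarz[OF L2.diff_closed[OF m(2,1)] m(3)] by (simp add: L2_norm_eq_seminorm)
      also have "\<dots> \<le> L2_norm \<Omega> (\<lambda>x. \<zeta> n x - \<psi> x) * K"
        using K(2)[of n] norm_eq[OF \<xi> v, of n]
        by (intro mult_left_mono) (auto simp: L2_norm_def L2_inner_def)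
      finally show ?thesis .
    qed
    show ?thesis
    proof (rule Lim_null_comparison[OF always_eventually])
      show "(\<lambda>n. L2_norm \<Omega> (\<lambda>x. \<zeta> n x - \<psi> x) * K) \<longlonglongrightarrow> 0"
        using tendsto_mult_right[OF u(4), of K] by simp
    qed (use le in auto)
  qed
  ultimately show ?thesis
    using that u(1,3) unfolding form_approx_def by blast
qed

end

subsection \<open>Radial weights\<close>

lemma partial_deriv_norm:
  fixes x :: "real^'d::finite"
  assumes "x \<noteq> 0"
  shows "norm differentiable at x" "partial_deriv k norm x = x $ k / norm x"
proof -
  have d: "(norm has_derivative (\<lambda>h. h \<bullet> sgn x)) (at x)"
    using GDERIV_norm[OF assms] by (simp add: gderiv_def inner_commute)
  then show "norm differentiable at x"
    by (auto simp: differentiable_def)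
  show "partial_deriv k norm x = x $ k / norm x"
    using partial_deriv_eq_frechet[OF d, of k]
    by (simp add: inner_axis' sgn_div_norm divide_inverse)
qed

lemma partial_deriv_radial:
  fixes x :: "real^'d::finite"
  assumes "x \<noteq> 0" "(F has_real_derivative F') (at (norm x))"
  shows "(\<lambda>y. F (norm y)) differentiable at x"
    "partial_deriv k (\<lambda>y. F (norm y)) x = F' * (x $ k / norm x)"
  using partial_deriv_chain[OF assms(2) partial_deriv_norm(1)[OF assms(1)]] partial_deriv_norm(2)[OF assms(1)]
  by simp_all

lemma partial_deriv_coord: "partial_deriv k (\<lambda>x. x $ i) x = axis k 1 $ i"
  by (rule partial_deriv_eq_frechet[OF has_derivative_coord])

lemma sum_coord_square: "(\<Sum>k\<in>UNIV. x $ k * x $ k) = (norm (x :: real^'d::finite))\<^sup>2"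
  by (simp add: power2_norm_eq_inner inner_vec_def)

lemma partial_deriv_radial_field:
  fixes x :: "real^'d::finite"
  assumes "x \<noteq> 0" "(F has_real_derivative F') (at (norm x))"
  shows "(\<lambda>y. F (norm y) * y $ k) differentiable at x"
    and "partial_deriv k (\<lambda>y. F (norm y) * y $ k) x = F (norm x) + F' * (x $ k * x $ k) / norm x"
proof -
  have c: "(\<lambda>y::real^'d. y $ k) differentiable at x"
    using has_derivative_coord by (auto simp: differentiable_def)
  show "(\<lambda>y. F (norm y) * y $ k) differentiable at x"
    by (intro differentiable_mult partial_deriv_radial(1)[OF assms] c)
  show "partial_deriv k (\<lambda>y. F (norm y) * y $ k) x = F (norm x) + F' * (x $ k * x $ k) / norm x"
    by (simp add: partial_deriv_mult[OF partial_deriv_radial(1)[OF assms] c] partial_deriv_coord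
        partial_deriv_radial(2)[OF assms])
qed

lemma divergence_radial_field:
  fixes x :: "real^'d::finite"
  assumes "x \<noteq> 0" "(F has_real_derivative F') (at (norm x))"
  shows "(\<Sum>k\<in>UNIV. partial_deriv k (\<lambda>y. F (norm y) * y $ k) x) = real CARD('d) * F (norm x) + norm x * F'"
proof -
  have "(\<Sum>k\<in>UNIV. F' * (x $ k * x $ k) / norm x) = F' * (norm x)\<^sup>2 / norm x"
    by (simp add: sum_coord_square[symmetric] sum_distrib_left sum_divide_distrib)
  then show ?thesis
    using assms(1)
    by (simp add: partial_deriv_radial_field[OF assms] sum.distrib power2_eq_square)
qed

lemma smooth_on_divide:
  assumes "open S" "\<And>x. x \<in> S \<Longrightarrow> g x > 0" "smooth_on S f" "smooth_on S g"
  shows "smooth_on S (\<lambda>x. f x / g x)"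
proof -
  have "smooth_on S (\<lambda>x. f x * g x powr (-1))"
    using assms by (intro smooth_on_mult smooth_on_powr)
  moreover have "f x * g x powr (-1) = f x / g x" if "x \<in> S" for x
    using assms(2)[OF that] by (simp add: powr_minus_divide)
  ultimately show ?thesis
    by (simp only: smooth_on_cong[OF assms(1), of "\<lambda>x. f x * g x powr (-1)" "\<lambda>x. f x / g x"])
qed

lemma smooth_on_diff:
  assumes "open S" "smooth_on S f" "smooth_on S h"
  shows "smooth_on S (\<lambda>x. f x - h x)"
  using smooth_on_add[OF assms(1,2) smooth_on_mult[OF assms(1) smooth_on_const[OF assms(1), of "-1"] assms(3)]]
  by simp

lemma L2_norm_nonneg: "L2_norm \<Omega> f \<ge> 0"
  by (simp add: L2_norm_def L2_inner_def)

lemma L2_norm_power2: "(L2_norm \<Omega> f)\<^sup>2 = L2_inner \<Omega> f f"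
  by (simp add: L2_norm_def L2_inner_def)

locale rellich_weight =
  fixes \<delta> \<delta>' d :: real and c\<^sub>\<Omega> :: "real^'d::finite \<Rightarrow> real"
  assumes d_eq: "d = real CARD('d)"
    and weight_eq: "c\<^sub>\<Omega> = (\<lambda>x. c_weight \<delta> \<delta>' (norm x))"
    and exponents_nonneg: "\<delta> \<ge> 0" "\<delta>' \<ge> 0"
    and subcritical: "d + 2 * min \<delta> \<delta>' - 4 > 0"
begin

abbreviation punctured :: "(real^'d) set" where "punctured \<equiv> UNIV - {0}"

abbreviation c :: "real \<Rightarrow> real" where "c \<equiv> c_weight \<delta> \<delta>'"

text \<open>The logarithmic derivative \<open>r c'(r) / c(r)\<close>.\<close>

definition p :: "real \<Rightarrow> real" where "p r = \<delta> + (\<delta>' - \<delta>) * r / (1 + r)"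

definition \<omega> :: "real \<Rightarrow> real" where "\<omega> r = c r / r\<^sup>2"

definition A :: real where "A = d * (d + 2 * min \<delta> \<delta>' - 4) / 4"

text \<open>The truncation \<open>W N\<close> is a smooth bounded substitute for \<open>min \<omega> N\<close>; the factor \<open>g N\<close> satisfies
  \<open>W N = g N * \<omega>\<close> and \<open>r (W N)' = (p - 2) * g N * W N\<close>.\<close>

definition W :: "real \<Rightarrow> real \<Rightarrow> real" where "W N r = N * \<omega> r / (N + \<omega> r)"

definition g :: "real \<Rightarrow> real \<Rightarrow> real" where "g N r = N / (N + \<omega> r)"

section \<open>Elementary estimates for the weight, its logarithmic derivative and the
  truncation\<close>

lemma c_pos: "r > 0 \<Longrightarrow> c r > 0"
  by (simp add: c_weight_def)

lemma \<omega>_pos: "r > 0 \<Longrightarrow> \<omega> r > 0"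
  by (simp add: \<omega>_def c_pos)

lemma c_eq: "r > 0 \<Longrightarrow> c r = \<omega> r * r\<^sup>2"
  by (simp add: \<omega>_def)

lemma d_ge_1: "d \<ge> 1"
  by (simp add: d_eq Suc_le_eq)

lemma A_pos: "A > 0"
  using subcritical d_ge_1 by (simp add: A_def)

lemma g_range: "N > 0 \<Longrightarrow> r > 0 \<Longrightarrow> 0 < g N r \<and> g N r \<le> 1"
  using \<omega>_pos[of r] by (simp add: g_def)

lemma W_eq: "W N r = g N r * \<omega> r"
  by (simp add: W_def g_def)

lemma W_pos: "N > 0 \<Longrightarrow> r > 0 \<Longrightarrow> W N r > 0"
  by (simp add: W_eq g_range \<omega>_pos)

lemma W_le:
  assumes "N > 0" "r > 0"
  shows W_le_\<omega>: "W N r \<le> \<omega> r" and W_le_N: "W N r \<le> N"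
  using \<omega>_pos[OF assms(2)] assms(1) by (simp_all add: W_def field_simps)

text \<open>\<open>p\<close> is a convex combination of \<open>\<delta>\<close> and
  \<open>\<delta>'\<close>, with weight \<open>r / (1 + r)\<close> on the latter.\<close>

lemma p_bounds:
  assumes "r > 0"
  shows "\<bar>p r - 2\<bar> \<le> 2 + \<delta> + \<delta>'"
proof -
  define t where "t = r / (1 + r)"
  have "t \<ge> 0" "t \<le> 1"
    using assms by (auto simp: t_def)
  then have "(1 - t) * \<delta> \<ge> 0" "(1 - t) * \<delta> \<le> \<delta>" "t * \<delta>' \<ge> 0" "t * \<delta>' \<le> \<delta>'"
    using exponents_nonneg by (auto intro: mult_left_le_one_le)
  moreover have "p r = (1 - t) * \<delta> + t * \<delta>'"
    by (simp add: p_def t_def algebra_simps diff_divide_distrib)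
  ultimately show ?thesis by simp
qed

lemma c_deriv:
  assumes "r > 0"
  shows "(c has_real_derivative c r * p r / r) (at r)"
proof -
  have "((\<lambda>r. r powr \<delta> * (1 + r) powr (\<delta>' - \<delta>)) has_real_derivative
      (\<delta> * r powr (\<delta> - 1)) * (1 + r) powr (\<delta>' - \<delta>) + r powr \<delta> * ((\<delta>' - \<delta>) * (1 + r) powr (\<delta>' - \<delta> - 1))) (at r)"
    using assms by (auto intro!: derivative_eq_intros)
  moreover have "(\<delta> * r powr (\<delta> - 1)) * (1 + r) powr (\<delta>' - \<delta>)
      + r powr \<delta> * ((\<delta>' - \<delta>) * (1 + r) powr (\<delta>' - \<delta> - 1)) = c r * p r / r"
    using assms by (simp add: powr_diff[of r \<delta> 1] powr_diff[of "1 + r" "\<delta>' - \<delta>" 1] c_weight_def p_def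
        divide_simps) (simp add: algebra_simps)
  ultimately show ?thesis
    by (simp add: c_weight_def[abs_def])
qed

lemma p_deriv: "r > 0 \<Longrightarrow> (p has_real_derivative (\<delta>' - \<delta>) / (1 + r)\<^sup>2) (at r)"
  unfolding p_def[abs_def]
  by (auto intro!: derivative_eq_intros simp: power2_eq_square field_simps)

lemma \<omega>_deriv:
  assumes "r > 0"
  shows "(\<omega> has_real_derivative \<omega> r * (p r - 2) / r) (at r)"
proof -
  have "((\<lambda>r. c r / r\<^sup>2) has_real_derivative (c r * p r / r * r\<^sup>2 - c r * (2 * r)) / (r\<^sup>2 * r\<^sup>2)) (at r)"
    using assms by (auto intro!: derivative_eq_intros c_deriv)
  moreover have "(c r * p r / r * r\<^sup>2 - c r * (2 * r)) / (r\<^sup>2 * r\<^sup>2) = \<omega> r * (p r - 2) / r"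
    using assms by (simp add: \<omega>_def power2_eq_square divide_simps) (simp add: algebra_simps)
  ultimately show ?thesis
    by (simp add: \<omega>_def[abs_def])
qed

lemma W_deriv:
  assumes "N > 0" "r > 0"
  shows "(W N has_real_derivative W N r * (g N r * (p r - 2)) / r) (at r)"
proof -
  have pos: "N + \<omega> r > 0"
    using \<omega>_pos[OF assms(2)] assms(1) by simp
  let ?D = "\<omega> r * (p r - 2) / r"
  have "((\<lambda>r. N * \<omega> r / (N + \<omega> r)) has_real_derivative
      (N * ?D * (N + \<omega> r) - N * \<omega> r * ?D) / ((N + \<omega> r) * (N + \<omega> r))) (at r)"
    using pos by (auto intro!: derivative_eq_intros \<omega>_deriv assms(2))
  moreover have "N * D * (N + w) - N * w * D = N * D * N" for D w :: real
    by (simp add: algebra_simps)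
  then have "(N * ?D * (N + \<omega> r) - N * \<omega> r * ?D) / ((N + \<omega> r) * (N + \<omega> r))
      = W N r * (g N r * (p r - 2)) / r"
    by (simp only:) (simp add: W_def g_def mult_ac)
  ultimately show ?thesis
    by (simp only: W_def[abs_def])
qed

text \<open>The second summand is \<open>r p'\<close>. Both summands are nonnegative if
  \<open>\<delta> \<le> \<delta>'\<close>. Otherwise the second is minus \<open>r / (1 + r)\<close>
  times \<open>p r - min \<delta> \<delta>'\<close>, and \<open>r / (1 + r) \<le> 1 \<le> d\<close>
  lets the first absorb it.\<close>

lemma slope_inequality:
  assumes "r > 0"
  shows "d * (p r - min \<delta> \<delta>') + r * ((\<delta>' - \<delta>) / (1 + r)\<^sup>2) \<ge> 0"
proof -
  note d = d_ge_1
  show ?thesis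
  proof (cases "\<delta> \<le> \<delta>'")
    case True
    then show ?thesis
      using assms d by (simp add: p_def)
  next
    case False
    have p: "p r - min \<delta> \<delta>' = (\<delta> - \<delta>') / (1 + r)"
      using False assms by (simp add: p_def field_simps)
    have "r * ((\<delta>' - \<delta>) / (1 + r)\<^sup>2) = - ((\<delta> - \<delta>') / (1 + r)) * (r / (1 + r))"
      using assms by (simp add: power2_eq_square divide_simps) (simp add: algebra_simps)
    then have "d * (p r - min \<delta> \<delta>') + r * ((\<delta>' - \<delta>) / (1 + r)\<^sup>2)
        = ((\<delta> - \<delta>') / (1 + r)) * (d - r / (1 + r))"
      unfolding p by (simp only: algebra_simps)
    moreover have "r / (1 + r) \<le> d"
      using assms d by (intro order_trans[OF _ d]) simp
    then have "((\<delta> - \<delta>') / (1 + r)) * (d - r / (1 + r)) \<ge> 0"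
      using d False assms by (intro mult_nonneg_nonneg) auto
    ultimately show ?thesis
      by (simp only:)
  qed
qed

text \<open>As \<open>g \<le> 1\<close>, the worst case is \<open>g = 1\<close>. There the
  difference of squares factors as \<open>d (d - 4 + 2 p)\<close>, which exceeds \<open>4 A\<close>
  by \<open>2 d (p - min \<delta> \<delta>')\<close>; by \<open>slope_inequality\<close> this excess
  covers a negative \<open>r p'\<close>.\<close>

lemma bracket_inequality:
  assumes "N > 0" "r > 0"
  shows "A \<le> ((d - 2 + p r)\<^sup>2 - (g N r * (p r - 2))\<^sup>2) / 4 + r * ((\<delta>' - \<delta>) / (1 + r)\<^sup>2) / 2"
proof -
  have "(g N r)\<^sup>2 * (p r - 2)\<^sup>2 \<le> 1 * (p r - 2)\<^sup>2"
    using g_range[OF assms] by (intro mult_right_mono) (auto simp: power_le_one)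
  then have "((d - 2 + p r)\<^sup>2 - (p r - 2)\<^sup>2) / 4 \<le> ((d - 2 + p r)\<^sup>2 - (g N r * (p r - 2))\<^sup>2) / 4"
    by (simp add: power_mult_distrib)
  moreover have "((d - 2 + p r)\<^sup>2 - (p r - 2)\<^sup>2) / 4 = A + d * (p r - min \<delta> \<delta>') / 2"
    by (simp add: A_def power2_eq_square field_simps)
  moreover have comb: "A \<le> y + f / 2" if "x \<le> y" "x = A + e / 2" "0 \<le> e + f" for x y e f
    using that by linarith
  ultimately show ?thesis
    by (intro comb[OF _ _ slope_inequality[OF assms(2)]])
qed

section \<open>Smoothness of the radial weights and the form on the punctured space\<close>

lemma open_punctured: "open punctured"
  by (simp add: open_Diff)

lemma smooth_radial:
  shows smooth_c: "smooth_on punctured (\<lambda>x. c (norm x))"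
    and smooth_\<omega>: "smooth_on punctured (\<lambda>x. \<omega> (norm x))"
    and smooth_p: "smooth_on punctured (\<lambda>x. p (norm x))"
    and smooth_W: "N > 0 \<Longrightarrow> smooth_on punctured (\<lambda>x. W N (norm x))"
proof -
  note rules = open_punctured smooth_on_mult smooth_on_powr smooth_on_add smooth_on_const smooth_on_norm
    smooth_on_divide
  have n: "smooth_on punctured norm"
    by (intro smooth_on_norm open_punctured) simp
  show c: "smooth_on punctured (\<lambda>x. c (norm x))"
    unfolding c_weight_def by (intro rules n) (auto simp: add_pos_nonneg)
  show \<omega>: "smooth_on punctured (\<lambda>x. \<omega> (norm x))"
    unfolding \<omega>_def power2_eq_square by (intro rules n c) auto
  show "smooth_on punctured (\<lambda>x. p (norm x))"
    unfolding p_def by (intro rules n) (auto simp: add_pos_nonneg)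
  show "smooth_on punctured (\<lambda>x. W N (norm x))" if "N > 0"
    unfolding W_def using that \<omega>_pos by (intro rules n \<omega>) (auto simp: add_pos_pos)
qed

sublocale weighted_form punctured c\<^sub>\<Omega>
proof
  show "smooth_on punctured c\<^sub>\<Omega>"
    unfolding weight_eq by (rule smooth_c)
qed (auto simp: open_punctured weight_eq c_weight_def)

lemma trunc_core: "N > 0 \<Longrightarrow> u \<in> core \<Longrightarrow> (\<lambda>x. W N (norm x) * u x) \<in> core"
  by (intro Cc_infinity_mult open_punctured smooth_W)

lemma partial_deriv_trunc:
  assumes "N > 0" "u \<in> core" "x \<noteq> 0"
  shows "partial_deriv k (\<lambda>x. W N (norm x) * u x) x
    = W N (norm x) * (partial_deriv k u x + g N (norm x) * (p (norm x) - 2) * u x * x $ k / (norm x)\<^sup>2)"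
proof -
  have D: "(W N has_real_derivative W N (norm x) * (g N (norm x) * (p (norm x) - 2)) / norm x) (at (norm x))"
    using assms by (intro W_deriv) auto
  have "w * a + (w * (b * q) / r) * (y / r) * v = w * (a + b * q * v * y / r\<^sup>2)" for w a b q r y v :: real
    by (simp add: power2_eq_square distrib_left)
  moreover have "partial_deriv k (\<lambda>x. W N (norm x) * u x) x = W N (norm x) * partial_deriv k u x
      + (W N (norm x) * (g N (norm x) * (p (norm x) - 2)) / norm x) * (x $ k / norm x) * u x"
    using partial_deriv_mult[OF partial_deriv_radial(1)[OF assms(3) D] core_differentiable[OF assms(2)], of k]
    unfolding partial_deriv_radial(2)[OF assms(3) D] .
  ultimately show ?thesis
    by (rule trans[rotated])
qed

subsection \<open>The lower bound\<close>

text \<open>Write \<open>Y = d - 2 + p\<close> and \<open>Z = g (p - 2)\<close>. For a field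
  \<open>\<omega> W y x\<close>, half the divergence less the completed square leaves the
  coefficient \<open>y (Y + Z) / 2 - (y + Z)^2 / 4\<close>, apart from the derivative of
  \<open>y\<close>. It is largest at \<open>y = Y\<close>, the factor used here; the derivative of
  \<open>Y\<close> accounts for the term \<open>r p' / 2\<close>.\<close>

definition \<gamma> :: "real \<Rightarrow> real \<Rightarrow> real" where "\<gamma> N r = \<omega> r * W N r * (d - 2 + p r)"

lemma \<gamma>_deriv:
  assumes "N > 0" "r > 0"
  shows "(\<gamma> N has_real_derivative
    \<omega> r * W N r * (((p r - 2) + g N r * (p r - 2)) * (d - 2 + p r) + r * ((\<delta>' - \<delta>) / (1 + r)\<^sup>2)) / r) (at r)"
proof -
  have "((\<lambda>r. \<omega> r * W N r * (d - 2 + p r)) has_real_derivative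
      (\<omega> r * (p r - 2) / r * W N r + \<omega> r * (W N r * (g N r * (p r - 2)) / r)) * (d - 2 + p r)
        + \<omega> r * W N r * ((\<delta>' - \<delta>) / (1 + r)\<^sup>2)) (at r)"
    by (rule derivative_eq_intros \<omega>_deriv W_deriv p_deriv assms refl)+ (simp add: algebra_simps)
  moreover have "(w * q / r * v + w * (v * z / r)) * y + w * v * e = w * v * ((q + z) * y + r * e) / r"
    for w q v z y e :: real
    using assms(2) by (simp add: field_simps)
  ultimately show ?thesis
    by (simp only: \<gamma>_def[abs_def])
qed

lemma smooth_\<gamma>_field: "N > 0 \<Longrightarrow> smooth_on punctured (\<lambda>x. \<gamma> N (norm x) * x $ k)"
  unfolding \<gamma>_def diff_conv_add_uminus
  by (intro smooth_on_mult smooth_on_add smooth_on_const smooth_on_coord smooth_\<omega> smooth_p smooth_W open_punctured)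

text \<open>Half the divergence of the field \<open>\<gamma> N (norm x) x u\<^sup>2\<close> turns the integrand of the form into a
  complete square plus a multiple of \<open>u\<^sup>2\<close>.\<close>

lemma truncated_pointwise_inequality:
  assumes N: "N > 0" and u: "u \<in> core" and x: "x \<noteq> 0"
  shows "A * (W N (norm x) * u x)\<^sup>2 \<le>
    (\<Sum>k\<in>UNIV. partial_deriv k u x * (c\<^sub>\<Omega> x * partial_deriv k (\<lambda>x. W N (norm x) * u x) x))
    + (\<Sum>k\<in>UNIV. partial_deriv k (\<lambda>y. \<gamma> N (norm y) * y $ k * (u y * u y)) x) / 2"
proof -
  define r where "r = norm x"
  have r: "r > 0" using x by (simp add: r_def)
  define a where "a k = partial_deriv k u x" for k
  define U where "U = u x"
  define Y where "Y = d - 2 + p r"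
  define Z where "Z = g N r * (p r - 2)"
  define e where "e = r * ((\<delta>' - \<delta>) / (1 + r)\<^sup>2)"
  define \<rho> where "\<rho> = (\<Sum>k\<in>UNIV. a k * a k)"
  define \<sigma> where "\<sigma> = (\<Sum>k\<in>UNIV. x $ k * a k)"
  define V where "V = \<omega> r * W N r"
  have V: "V > 0"
    using \<omega>_pos[OF r] W_pos[OF N r] by (simp add: V_def)
  define \<gamma>' where "\<gamma>' = V * (((p r - 2) + Z) * Y + e) / r"
  have D: "(\<gamma> N has_real_derivative \<gamma>') (at (norm x))"
    using \<gamma>_deriv[OF N r] by (simp add: \<gamma>'_def V_def Y_def Z_def e_def r_def)
  have \<gamma>: "\<gamma> N r = V * Y"
    by (simp add: \<gamma>_def V_def Y_def)
  have sum_x: "(\<Sum>k\<in>UNIV. x $ k * x $ k) = r\<^sup>2"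
    by (simp add: sum_coord_square r_def)
  have form: "(\<Sum>k\<in>UNIV. partial_deriv k u x * (c\<^sub>\<Omega> x * partial_deriv k (\<lambda>x. W N (norm x) * u x) x))
      = V * (r\<^sup>2 * \<rho> + Z * U * \<sigma>)"
  proof -
    have "partial_deriv k u x * (c\<^sub>\<Omega> x * partial_deriv k (\<lambda>x. W N (norm x) * u x) x)
        = V * r\<^sup>2 * (a k * a k) + V * Z * U * (x $ k * a k)" for k
    proof -
      have "c\<^sub>\<Omega> x = \<omega> r * r\<^sup>2"
        using c_eq[OF r] by (simp add: weight_eq r_def)
      moreover have "partial_deriv k (\<lambda>x. W N (norm x) * u x) x = W N r * (a k + Z * U * x $ k / r\<^sup>2)"
        unfolding partial_deriv_trunc[OF N u x] by (simp add: a_def Z_def U_def r_def)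
      ultimately show ?thesis
        using r by (simp add: V_def a_def[symmetric] field_simps)
    qed
    then show ?thesis
      by (simp add: \<rho>_def \<sigma>_def sum.distrib distrib_left sum_distrib_left mult_ac)
  qed
  have div: "(\<Sum>k\<in>UNIV. partial_deriv k (\<lambda>y. \<gamma> N (norm y) * y $ k * (u y * u y)) x)
      = V * (Y * (Y + Z) + e) * U\<^sup>2 + 2 * V * Y * U * \<sigma>"
  proof -
    have "partial_deriv k (\<lambda>y. \<gamma> N (norm y) * y $ k * (u y * u y)) x
        = 2 * V * Y * U * (x $ k * a k) + partial_deriv k (\<lambda>y. \<gamma> N (norm y) * y $ k) x * U\<^sup>2" for k
    proof -
      have "(\<lambda>y. u y * u y) differentiable at x"
        by (intro differentiable_mult core_differentiable u)
      then show ?thesis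
        by (simp add: partial_deriv_mult partial_deriv_radial_field(1)[OF x D] core_differentiable[OF u])
          (simp add: \<gamma> r_def[symmetric] a_def U_def power2_eq_square)
    qed
    then have "(\<Sum>k\<in>UNIV. partial_deriv k (\<lambda>y. \<gamma> N (norm y) * y $ k * (u y * u y)) x)
        = 2 * V * Y * U * \<sigma> + (real CARD('d) * \<gamma> N (norm x) + norm x * \<gamma>') * U\<^sup>2"
      by (simp add: sum.distrib divergence_radial_field[OF x D, symmetric] \<sigma>_def sum_distrib_left sum_distrib_right)
    \<comment> \<open>The \<open>d\<close> from the divergence of \<open>x\<close> joins the
      \<open>p - 2\<close> from the derivative of \<open>\<omega>\<close> to give \<open>Y\<close>
      once more.\<close>
    also have "real CARD('d) * \<gamma> N (norm x) + norm x * \<gamma>' = V * (Y * (Y + Z) + e)"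
    proof -
      have "norm x * \<gamma>' = V * (((p r - 2) + Z) * Y + e)"
        using r by (simp add: \<gamma>'_def r_def[symmetric])
      then show ?thesis
        by (simp add: \<gamma> r_def[symmetric] d_eq[symmetric]) (simp add: Y_def algebra_simps)
    qed
    finally show ?thesis by simp
  qed
  have square: "0 \<le> r\<^sup>2 * \<rho> + (Y + Z) * U * \<sigma> + ((Y + Z) / 2)\<^sup>2 * U\<^sup>2"
  proof -
    \<comment> \<open>Half the coefficient of the mixed term, so that the squares of the components
      of \<open>r\<close> times the gradient plus \<open>\<mu> U x / r\<close> reproduce that term
      exactly.\<close>
    define \<mu> where "\<mu> = (Y + Z) / 2"
    have "0 \<le> (\<Sum>k\<in>UNIV. (r * a k + \<mu> * U / r * x $ k)\<^sup>2)"
      by (intro sum_nonneg) simp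
    also have "\<dots> = (\<Sum>k\<in>UNIV. r\<^sup>2 * (a k * a k) + 2 * \<mu> * U * (x $ k * a k) + (\<mu> * U / r)\<^sup>2 * (x $ k * x $ k))"
      using r by (intro sum.cong refl) (simp add: power2_eq_square field_simps)
    also have "\<dots> = r\<^sup>2 * \<rho> + 2 * \<mu> * U * \<sigma> + (\<mu> * U / r)\<^sup>2 * r\<^sup>2"
      by (simp only: sum.distrib \<rho>_def \<sigma>_def sum_x flip: sum_distrib_left)
    also have "(\<mu> * U / r)\<^sup>2 * r\<^sup>2 = \<mu>\<^sup>2 * U\<^sup>2"
      using r by (simp add: power_mult_distrib power_divide)
    finally have "0 \<le> r\<^sup>2 * \<rho> + 2 * \<mu> * U * \<sigma> + \<mu>\<^sup>2 * U\<^sup>2" .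
    moreover have "2 * \<mu> = Y + Z"
      by (simp add: \<mu>_def)
    ultimately show ?thesis
      by (simp only: \<mu>_def)
  qed
  \<comment> \<open>The form yields the weight \<open>\<omega> W\<close>, the norm has
    \<open>W^2\<close>; the gap has the right sign because \<open>A > 0\<close>.\<close>
  have "W N r * (W N r * U\<^sup>2) \<le> \<omega> r * (W N r * U\<^sup>2)"
    using W_le_\<omega>[OF N r] W_pos[OF N r] by (intro mult_right_mono) auto
  then have "A * (W N r * U)\<^sup>2 \<le> A * (V * U\<^sup>2)"
    using A_pos by (intro mult_left_mono) (auto simp: V_def power2_eq_square mult_ac)
  also have "\<dots> \<le> ((Y\<^sup>2 - Z\<^sup>2) / 4 + e / 2) * (V * U\<^sup>2)"
    using bracket_inequality[OF N r] V by (intro mult_right_mono) (auto simp: Y_def Z_def e_def)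
  also have "\<dots> \<le> ((Y\<^sup>2 - Z\<^sup>2) / 4 + e / 2) * (V * U\<^sup>2)
      + V * (r\<^sup>2 * \<rho> + (Y + Z) * U * \<sigma> + ((Y + Z) / 2)\<^sup>2 * U\<^sup>2)"
    using square V by simp
  \<comment> \<open>This rests on
    \<open>(Y^2 - Z^2) / 4 + (Y + Z)^2 / 4 = Y (Y + Z) / 2\<close>.\<close>
  also have "\<dots> = V * (r\<^sup>2 * \<rho> + Z * U * \<sigma>) + (V * (Y * (Y + Z) + e) * U\<^sup>2 + 2 * V * Y * U * \<sigma>) / 2"
    by (simp add: power2_eq_square field_simps)
  finally show ?thesis
    unfolding form div by (simp add: r_def U_def)
qed

text \<open>The divergence in the pointwise bound is that of a field of test functions, so it
  integrates to zero.\<close>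

lemma truncated_form_inequality:
  assumes N: "N > 0" and u: "u \<in> core"
  shows "A * (L2_norm punctured (\<lambda>x. W N (norm x) * u x))\<^sup>2
    \<le> h_polar punctured c\<^sub>\<Omega> u (\<lambda>x. W N (norm x) * u x)"
proof -
  let ?v = "\<lambda>x. W N (norm x) * u x"
  let ?M = "lebesgue_on punctured"
  let ?G = "\<lambda>k y. \<gamma> N (norm y) * y $ k * (u y * u y)"
  have v: "?v \<in> core"
    by (rule trunc_core[OF N u])
  have G: "?G k \<in> core" for k
    using u by (intro Cc_infinity_mult[OF open_dom smooth_\<gamma>_field[OF N]] Cc_infinity_mult[OF open_dom Cc_infinity_smooth])
  have int_form: "integrable ?M (\<lambda>x. partial_deriv k u x * (c\<^sub>\<Omega> x * partial_deriv k ?v x))" for k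
    using u v by (intro L2_mult_integrable core_L2 deriv_core weighted_deriv_core)
  have int_G: "integrable ?M (partial_deriv k (?G k))" for k
    by (intro Cc_infinity_integrable open_dom deriv_core G)
  have int_v: "integrable ?M (\<lambda>x. (?v x)\<^sup>2)"
    using core_L2[OF v] by (simp add: L2_def)
  have "A * (L2_norm punctured ?v)\<^sup>2 = (\<integral>x. A * (?v x)\<^sup>2 \<partial>?M)"
    unfolding L2_norm_power2 L2_inner_def by (simp add: power2_eq_square)
  also have "\<dots> \<le> (\<integral>x. (\<Sum>k\<in>UNIV. partial_deriv k u x * (c\<^sub>\<Omega> x * partial_deriv k ?v x))
    + (\<Sum>k\<in>UNIV. partial_deriv k (?G k) x) / 2 \<partial>?M)"
    using truncated_pointwise_inequality[OF N u]
    by (intro integral_mono Bochner_Integration.integrable_add Bochner_Integration.integrable_sum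
        integrable_mult_right integrable_divide int_form int_G int_v) auto
  also have "\<dots> = h_polar punctured c\<^sub>\<Omega> u ?v + (\<Sum>k\<in>UNIV. integral\<^sup>L ?M (partial_deriv k (?G k))) / 2"
    by (simp add: h_polar_def L2_inner_def Bochner_Integration.integral_add Bochner_Integration.integral_sum
        int_form int_G Bochner_Integration.integrable_sum)
  also have "\<dots> = h_polar punctured c\<^sub>\<Omega> u ?v"
    by (simp add: integral_partial_deriv[OF open_dom G])
  finally show ?thesis .
qed

text \<open>Product rule and \<open>(a + b)^2 \<le> 2 a^2 + 2 b^2\<close>. The gradient of
  \<open>u\<close> gets a factor \<open>W^2 \<le> N^2\<close>. The factor of \<open>u^2\<close> is
  \<open>c\<close> times the squared gradient of \<open>W\<close>, which equals
  \<open>g W^3 (p - 2)^2\<close> because \<open>\<omega> g = W\<close>; this explains the cube of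
  \<open>N\<close>.\<close>

lemma truncated_form_bound:
  assumes N: "N > 0" and u: "u \<in> core"
  shows "(form.seminorm (\<lambda>x. W N (norm x) * u x))\<^sup>2
    \<le> 2 * N\<^sup>2 * (form.seminorm u)\<^sup>2 + 2 * N ^ 3 * (2 + \<delta> + \<delta>')\<^sup>2 * (L2_norm punctured u)\<^sup>2"
proof -
  let ?v = "\<lambda>x. W N (norm x) * u x"
  let ?M = "lebesgue_on punctured"
  let ?C = "2 * N ^ 3 * (2 + \<delta> + \<delta>')\<^sup>2"
  have v: "?v \<in> core"
    by (rule trunc_core[OF N u])
  have int: "integrable ?M (\<lambda>x. partial_deriv k w x * (c\<^sub>\<Omega> x * partial_deriv k w x))" if "w \<in> core" for k w
    using that by (intro L2_mult_integrable core_L2 deriv_core weighted_deriv_core)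
  have int_u: "integrable ?M (\<lambda>x. (u x)\<^sup>2)"
    using core_L2[OF u] by (simp add: L2_def)
  have pw: "(\<Sum>k\<in>UNIV. partial_deriv k ?v x * (c\<^sub>\<Omega> x * partial_deriv k ?v x))
      \<le> 2 * N\<^sup>2 * (\<Sum>k\<in>UNIV. partial_deriv k u x * (c\<^sub>\<Omega> x * partial_deriv k u x)) + ?C * (u x)\<^sup>2"
    if x: "x \<noteq> 0" for x
  proof -
    define r where "r = norm x"
    have r: "r > 0" using x by (simp add: r_def)
    define Z where "Z = g N r * (p r - 2)"
    have cx: "c\<^sub>\<Omega> x = \<omega> r * r\<^sup>2"
      using c_eq[OF r] by (simp add: weight_eq r_def)
    have "partial_deriv k ?v x * (c\<^sub>\<Omega> x * partial_deriv k ?v x)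
      \<le> 2 * N\<^sup>2 * (partial_deriv k u x * (c\<^sub>\<Omega> x * partial_deriv k u x))
        + 2 * \<omega> r * (W N r)\<^sup>2 * Z\<^sup>2 * (u x)\<^sup>2 / r\<^sup>2 * (x $ k * x $ k)" for k
    proof -
      define a where "a = partial_deriv k u x"
      define b where "b = Z * u x * x $ k / r\<^sup>2"
      have pv: "partial_deriv k ?v x = W N r * (a + b)"
        unfolding partial_deriv_trunc[OF N u x] by (simp add: a_def b_def Z_def r_def)
      have "(a + b)\<^sup>2 \<le> 2 * a\<^sup>2 + 2 * b\<^sup>2"
        using sum_squares_bound[of a b] by (simp add: power2_sum)
      then have "c\<^sub>\<Omega> x * (W N r)\<^sup>2 * (a + b)\<^sup>2 \<le> c\<^sub>\<Omega> x * (W N r)\<^sup>2 * (2 * a\<^sup>2 + 2 * b\<^sup>2)"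
        using weight_nonneg[of x] x by (intro mult_left_mono) auto
      also have "\<dots> = 2 * (c\<^sub>\<Omega> x * a\<^sup>2) * (W N r)\<^sup>2 + 2 * (c\<^sub>\<Omega> x * (W N r)\<^sup>2 * b\<^sup>2)"
        by (simp add: algebra_simps)
      also have "\<dots> \<le> 2 * (c\<^sub>\<Omega> x * a\<^sup>2) * N\<^sup>2 + 2 * (c\<^sub>\<Omega> x * (W N r)\<^sup>2 * b\<^sup>2)"
        using W_le_N[OF N r] W_pos[OF N r] weight_nonneg[of x] x
        by (intro add_right_mono mult_left_mono power_mono) auto
      also have "c\<^sub>\<Omega> x * (W N r)\<^sup>2 * b\<^sup>2 = \<omega> r * (W N r)\<^sup>2 * Z\<^sup>2 * (u x)\<^sup>2 / r\<^sup>2 * (x $ k * x $ k)"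
        using r by (simp add: b_def cx power2_eq_square)
      finally show ?thesis
        unfolding pv by (simp add: a_def power2_eq_square mult_ac)
    qed
    then have "(\<Sum>k\<in>UNIV. partial_deriv k ?v x * (c\<^sub>\<Omega> x * partial_deriv k ?v x))
      \<le> (\<Sum>k\<in>UNIV. 2 * N\<^sup>2 * (partial_deriv k u x * (c\<^sub>\<Omega> x * partial_deriv k u x))
        + 2 * \<omega> r * (W N r)\<^sup>2 * Z\<^sup>2 * (u x)\<^sup>2 / r\<^sup>2 * (x $ k * x $ k))"
      by (rule sum_mono)
    also have "\<dots> = 2 * N\<^sup>2 * (\<Sum>k\<in>UNIV. partial_deriv k u x * (c\<^sub>\<Omega> x * partial_deriv k u x))
        + 2 * \<omega> r * (W N r)\<^sup>2 * Z\<^sup>2 * (u x)\<^sup>2 / r\<^sup>2 * r\<^sup>2"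
      by (simp only: sum.distrib r_def sum_coord_square flip: sum_distrib_left)
    also have "2 * \<omega> r * (W N r)\<^sup>2 * Z\<^sup>2 * (u x)\<^sup>2 / r\<^sup>2 * r\<^sup>2 = 2 * (g N r * W N r ^ 3) * (p r - 2)\<^sup>2 * (u x)\<^sup>2"
      using r by (simp add: Z_def W_eq power_mult_distrib power2_eq_square power3_eq_cube)
    also have "\<dots> \<le> ?C * (u x)\<^sup>2"
    proof -
      have "g N r * W N r ^ 3 \<le> 1 * N ^ 3"
        using g_range[OF N r] W_le_N[OF N r] W_pos[OF N r] by (intro mult_mono power_mono) auto
      moreover have "(p r - 2)\<^sup>2 \<le> (2 + \<delta> + \<delta>')\<^sup>2"
        using power_mono[OF p_bounds[OF r], of 2] by simp
      ultimately have "g N r * W N r ^ 3 * (p r - 2)\<^sup>2 \<le> N ^ 3 * (2 + \<delta> + \<delta>')\<^sup>2"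
        using N by (intro mult_mono) auto
      then show ?thesis
        by (intro mult_right_mono) auto
    qed
    finally show ?thesis by simp
  qed
  have "h_polar punctured c\<^sub>\<Omega> ?v ?v = (\<integral>x. (\<Sum>k\<in>UNIV. partial_deriv k ?v x * (c\<^sub>\<Omega> x * partial_deriv k ?v x)) \<partial>?M)"
    by (simp add: h_polar_def L2_inner_def Bochner_Integration.integral_sum int[OF v])
  also have "\<dots> \<le> (\<integral>x. 2 * N\<^sup>2 * (\<Sum>k\<in>UNIV. partial_deriv k u x * (c\<^sub>\<Omega> x * partial_deriv k u x)) + ?C * (u x)\<^sup>2 \<partial>?M)"
    using pw by (intro integral_mono Bochner_Integration.integrable_add Bochner_Integration.integrable_sum
        integrable_mult_right int u v int_u) auto
  also have "\<dots> = 2 * N\<^sup>2 * h_polar punctured c\<^sub>\<Omega> u u + ?C * (L2_norm punctured u)\<^sup>2"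
    unfolding h_polar_def L2_norm_power2 L2_inner_def
    by (subst Bochner_Integration.integral_add)
       (auto simp: Bochner_Integration.integral_sum power2_eq_square[of "u _"] int[OF u]
         intro!: integrable_mult_right int[OF u] int_u Bochner_Integration.integrable_sum
           int_u[unfolded power2_eq_square])
  finally show ?thesis
    using u v by (simp add: form.seminorm_power2)
qed

section \<open>From test functions to the operator domain, and removal of the truncation\<close>

lemma measurable_radial:
  "(\<lambda>x. \<omega> (norm x)) \<in> borel_measurable (lebesgue_on punctured)"
  "N > 0 \<Longrightarrow> (\<lambda>x. W N (norm x)) \<in> borel_measurable (lebesgue_on punctured)"
  using smooth_on_continuous[OF smooth_\<omega>] smooth_on_continuous[OF smooth_W, of N]
  by (auto intro!: continuous_on_measurable_lebesgue_on open_punctured)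

lemma trunc_L2:
  assumes "N > 0" "f \<in> L2 punctured"
  shows "(\<lambda>x. W N (norm x) * f x) \<in> L2 punctured"
    and "L2_norm punctured (\<lambda>x. W N (norm x) * f x) \<le> N * L2_norm punctured f"
proof -
  have m: "(\<lambda>x. W N (norm x) * f x) \<in> borel_measurable (lebesgue_on punctured)"
    using assms by (intro borel_measurable_times measurable_radial) (auto simp: L2_def)
  have b: "\<bar>W N (norm x) * f x\<bar> \<le> N * \<bar>f x\<bar>" if "x \<in> punctured" for x
    using that W_le_N[OF assms(1), of "norm x"] W_pos[OF assms(1), of "norm x"]
    by (auto simp: abs_mult intro!: mult_right_mono)
  show "(\<lambda>x. W N (norm x) * f x) \<in> L2 punctured"
    and "L2_norm punctured (\<lambda>x. W N (norm x) * f x) \<le> N * L2_norm punctured f"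
    using L2_dominated[OF assms(2) m _ b] assms(1) by auto
qed

text \<open>The form inequality holds along a form approximation \<open>u n\<close> of
  \<open>\<phi>\<close>. Since \<open>W u n\<close> stays bounded in form norm,
  \<open>h (u n, W u n)\<close> differs from \<open>(H \<phi>, W u n)\<close> by a null sequence,
  and in L2 \<open>W u n\<close> tends to \<open>W \<phi>\<close>.\<close>

lemma truncated_rellich:
  assumes "weighted_operator punctured c\<^sub>\<Omega> H S" "(\<phi>, \<eta>) \<in> H" and N: "N > 0"
  shows "A * L2_norm punctured (\<lambda>x. W N (norm x) * \<phi> x) \<le> L2_norm punctured \<eta>"
proof -
  interpret weighted_operator punctured c\<^sub>\<Omega> H S by fact
  let ?T = "\<lambda>f x. W N (norm x) * f x"
  obtain u where u: "\<And>n. u n \<in> core" and lim: "(\<lambda>n. L2_norm punctured (\<lambda>x. u n x - \<phi> x)) \<longlonglongrightarrow> 0"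
    and B: "Bseq (\<lambda>n. form.seminorm (u n))"
    and pair: "\<And>v. (\<And>n. v n \<in> core) \<Longrightarrow> Bseq (\<lambda>n. form.seminorm (v n)) \<Longrightarrow>
      (\<lambda>n. L2_inner punctured \<eta> (v n) - h_polar punctured c\<^sub>\<Omega> (u n) (v n)) \<longlonglongrightarrow> 0"
    using H_weak_form[OF assms(2)] by blast
  have \<phi>: "\<phi> \<in> L2 punctured" and \<eta>: "\<eta> \<in> L2 punctured"
    using H_L2[OF assms(2)] by auto
  have T\<phi>: "?T \<phi> \<in> L2 punctured"
    by (rule trunc_L2[OF N \<phi>])
  have Tu: "?T (u n) \<in> core" for n
    by (rule trunc_core[OF N u])
  have lim_T: "(\<lambda>n. L2.seminorm punctured (\<lambda>x. ?T (u n) x - ?T \<phi> x)) \<longlonglongrightarrow> 0"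
  proof (rule Lim_null_comparison[OF always_eventually])
    show "(\<lambda>n. N * L2_norm punctured (\<lambda>x. u n x - \<phi> x)) \<longlonglongrightarrow> 0"
      using tendsto_mult_left[OF lim, of N] by simp
    show "\<forall>n. norm (L2.seminorm punctured (\<lambda>x. ?T (u n) x - ?T \<phi> x)) \<le> N * L2_norm punctured (\<lambda>x. u n x - \<phi> x)"
      using trunc_L2(2)[OF N L2.diff_closed[OF core_L2[OF u] \<phi>]] L2_norm_nonneg[of punctured]
      by (simp add: right_diff_distrib L2_norm_eq_seminorm)
  qed
  have "Bseq (\<lambda>n. form.seminorm (?T (u n)))"
  proof -
    obtain K where K: "\<And>n. \<bar>form.seminorm (u n)\<bar> \<le> K" "K > 0"
      using B by (auto simp: Bseq_def)
    have "(\<lambda>n. L2_norm punctured (u n)) \<longlonglongrightarrow> L2_norm punctured \<phi>"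
      using u \<phi> lim core_L2 unfolding L2_norm_eq_seminorm by (intro L2.tendsto_seminorm) auto
    then have "Bseq (\<lambda>n. L2_norm punctured (u n))"
      by (intro convergent_imp_Bseq convergentI)
    then obtain L where L: "\<And>n. \<bar>L2_norm punctured (u n)\<bar> \<le> L" "L > 0"
      by (auto simp: Bseq_def)
    define R where "R = 2 * N\<^sup>2 * K\<^sup>2 + 2 * N ^ 3 * (2 + \<delta> + \<delta>')\<^sup>2 * L\<^sup>2"
    have "norm (form.seminorm (?T (u n))) \<le> sqrt R" for n
    proof -
      have "(form.seminorm (u n))\<^sup>2 \<le> K\<^sup>2" "(L2_norm punctured (u n))\<^sup>2 \<le> L\<^sup>2"
        using power_mono[OF K(1), of n 2] power_mono[OF L(1), of n 2] by simp_all
      then have "2 * N\<^sup>2 * (form.seminorm (u n))\<^sup>2 + 2 * N ^ 3 * (2 + \<delta> + \<delta>')\<^sup>2 * (L2_norm punctured (u n))\<^sup>2 \<le> R"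
        using N unfolding R_def by (intro add_mono mult_left_mono) auto
      then have "(form.seminorm (?T (u n)))\<^sup>2 \<le> R"
        using truncated_form_bound[OF N u, of n] by linarith
      then show ?thesis
        using form.seminorm_nonneg[OF Tu, of n] by (simp add: real_le_rsqrt)
    qed
    then show ?thesis
      by (rule BseqI')
  qed
  then have conv: "(\<lambda>n. L2_inner punctured \<eta> (?T (u n)) - h_polar punctured c\<^sub>\<Omega> (u n) (?T (u n))) \<longlonglongrightarrow> 0"
    by (intro pair Tu)
  have inner: "(\<lambda>n. L2_inner punctured \<eta> (?T (u n))) \<longlonglongrightarrow> L2_inner punctured \<eta> (?T \<phi>)"
    using L2.tendsto_left[OF core_L2[OF Tu] T\<phi> \<eta> lim_T]
    by (simp add: L2_inner_def mult.commute)
  have "(\<lambda>n. h_polar punctured c\<^sub>\<Omega> (u n) (?T (u n))) \<longlonglongrightarrow> L2_inner punctured \<eta> (?T \<phi>)"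
    using tendsto_diff[OF inner conv] by simp
  moreover have "(\<lambda>n. A * (L2_norm punctured (?T (u n)))\<^sup>2) \<longlonglongrightarrow> A * (L2_norm punctured (?T \<phi>))\<^sup>2"
    unfolding L2_norm_eq_seminorm
    by (intro tendsto_intros L2.tendsto_seminorm core_L2 Tu T\<phi> lim_T)
  ultimately have "A * (L2_norm punctured (?T \<phi>))\<^sup>2 \<le> L2_inner punctured \<eta> (?T \<phi>)"
    using truncated_form_inequality[OF N u] by (intro LIMSEQ_le) auto
  also have "\<dots> \<le> L2_norm punctured \<eta> * L2_norm punctured (?T \<phi>)"
    using L2.Cauchy_Schwarz[OF \<eta> T\<phi>] by (simp add: L2_norm_eq_seminorm)
  \<comment> \<open>One factor, the norm of \<open>W \<phi>\<close>, is to be cancelled; it may be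
    zero, and then the claim is trivial.\<close>
  finally have "L2_norm punctured (?T \<phi>) * (A * L2_norm punctured (?T \<phi>) - L2_norm punctured \<eta>) \<le> 0"
    by (simp add: power2_eq_square algebra_simps)
  then show ?thesis
    using L2_norm_nonneg[of punctured "?T \<phi>"] L2_norm_nonneg[of punctured \<eta>]
    by (auto simp: mult_le_0_iff)
qed

text \<open>The bound is uniform in \<open>N\<close> and the truncations increase to
  \<open>\<omega>\<close>, so monotone convergence along \<open>N = n + 1\<close> gives the
  square-integrability of \<open>\<omega> \<phi>\<close> together with the inequality.\<close>

lemma rellich_lower_bound:
  assumes "weighted_operator punctured c\<^sub>\<Omega> H S" "(\<phi>, \<eta>) \<in> H"
  shows "(\<lambda>x. \<omega> (norm x) * \<phi> x) \<in> L2 punctured"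
    and "A\<^sup>2 * L2_inner punctured (\<lambda>x. \<omega> (norm x) * \<phi> x) (\<lambda>x. \<omega> (norm x) * \<phi> x) \<le> L2_inner punctured \<eta> \<eta>"
proof -
  interpret weighted_operator punctured c\<^sub>\<Omega> H S by fact
  let ?M = "lebesgue_on punctured"
  define f where "f n x = (W (real (Suc n)) (norm x) * \<phi> x)\<^sup>2" for n x
  define F where "F x = (\<omega> (norm x) * \<phi> x)\<^sup>2" for x
  have \<phi>: "\<phi> \<in> L2 punctured"
    using H_L2[OF assms(2)] by auto
  have \<phi>_meas: "(\<lambda>x. \<omega> (norm x) * \<phi> x) \<in> borel_measurable ?M"
    using \<phi> by (intro borel_measurable_times measurable_radial) (auto simp: L2_def)
  have int: "integrable ?M (f n)" for n
    using trunc_L2(1)[OF _ \<phi>, of "real (Suc n)"] by (simp add: L2_def f_def[abs_def])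
  have le: "A\<^sup>2 * integral\<^sup>L ?M (f n) \<le> L2_inner punctured \<eta> \<eta>" for n
  proof -
    have "(A * L2_norm punctured (\<lambda>x. W (real (Suc n)) (norm x) * \<phi> x))\<^sup>2 \<le> (L2_norm punctured \<eta>)\<^sup>2"
      using truncated_rellich[OF assms, of "real (Suc n)"] A_pos
      by (intro power_mono mult_nonneg_nonneg) (auto simp: L2_norm_nonneg)
    then show ?thesis
      unfolding power_mult_distrib L2_norm_power2 by (simp add: L2_inner_def f_def[abs_def] power2_eq_square)
  qed
  have W_mono: "W N r \<le> W N' r" if "0 < N" "N \<le> N'" "r > 0" for N N' r
    using that \<omega>_pos[OF that(3)] by (simp add: W_def field_simps mult_right_mono)
  have mono: "AE x in ?M. mono (\<lambda>n. f n x)"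
  proof (rule AE_I2)
    fix x assume "x \<in> space ?M"
    then have x: "norm x > 0" by simp
    show "mono (\<lambda>n. f n x)"
      unfolding f_def power_mult_distrib
      by (intro monoI mult_right_mono power_mono W_mono x)
         (use W_pos[OF _ x] in \<open>auto intro: less_imp_le\<close>)
  qed
  have W_lim: "(\<lambda>n. W (real (Suc n)) r) \<longlonglongrightarrow> \<omega> r" if "r > 0" for r
  proof -
    \<comment> \<open>Dividing numerator and denominator by \<open>N\<close> gives
      \<open>W N = \<omega> / (1 + \<omega> / N)\<close>.\<close>
    have "(\<lambda>n. \<omega> r / (1 + \<omega> r * inverse (real (Suc n)))) \<longlonglongrightarrow> \<omega> r / (1 + \<omega> r * 0)"
      by (intro tendsto_intros LIMSEQ_inverse_real_of_nat) auto
    moreover have "\<omega> r / (1 + \<omega> r * inverse N) = W N r" if "N > 0" for N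
      using that \<omega>_pos[OF \<open>r > 0\<close>] by (simp add: W_def field_simps)
    ultimately show ?thesis by simp
  qed
  have lim: "AE x in ?M. (\<lambda>n. f n x) \<longlonglongrightarrow> F x"
    unfolding f_def F_def by (intro AE_I2 tendsto_intros W_lim) auto
  have "incseq (\<lambda>n. integral\<^sup>L ?M (f n))"
    by (intro monoI integral_mono_AE int) (use mono in \<open>auto simp: mono_def\<close>)
  moreover have "\<forall>n. integral\<^sup>L ?M (f n) \<le> L2_inner punctured \<eta> \<eta> / A\<^sup>2"
    using le A_pos by (simp add: field_simps)
  ultimately obtain l where l: "(\<lambda>n. integral\<^sup>L ?M (f n)) \<longlonglongrightarrow> l"
    using incseq_convergent by blast
  have F_meas: "F \<in> borel_measurable ?M"
    unfolding F_def[abs_def] using \<phi>_meas by measurable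
  show "(\<lambda>x. \<omega> (norm x) * \<phi> x) \<in> L2 punctured"
    using integrable_monotone_convergence[OF int mono lim l F_meas] \<phi>_meas by (simp add: L2_def F_def[abs_def])
  have "integral\<^sup>L ?M F = l"
    by (rule integral_monotone_convergence[OF int mono lim l F_meas])
  moreover have "A\<^sup>2 * l \<le> L2_inner punctured \<eta> \<eta>"
    by (rule LIMSEQ_le_const2[OF tendsto_mult_left[OF l]]) (use le in auto)
  ultimately show "A\<^sup>2 * L2_inner punctured (\<lambda>x. \<omega> (norm x) * \<phi> x) (\<lambda>x. \<omega> (norm x) * \<phi> x) \<le> L2_inner punctured \<eta> \<eta>"
    by (simp add: L2_inner_def F_def[abs_def] power2_eq_square)
qed

end

subsection \<open>Bump functions and logarithmic shells\<close>

lemma exp_minus_le_inverse: "x > 0 \<Longrightarrow> exp (- x) \<le> 1 / (x :: real)"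
proof -
  assume "x > 0"
  moreover have "x \<le> exp x"
    using exp_ge_add_one_self[of x] by linarith
  ultimately show ?thesis
    by (simp add: exp_minus field_simps)
qed

text \<open>The standard bump \<open>exp (- 1 / (1 - t^2))\<close> on the interval from -1 to
  1.\<close>

definition bump :: "real \<Rightarrow> real" where "bump t = flat 0 (1 - t\<^sup>2)"

text \<open>Written out explicitly because the operator differentiates a test function twice and
  uniform bounds on both derivatives of the bump are needed.\<close>

definition bump' :: "real \<Rightarrow> real" where "bump' t = - 2 * t * flat (- 2) (1 - t\<^sup>2)"

definition bump'' :: "real \<Rightarrow> real" where
  "bump'' t = - 2 * flat (- 2) (1 - t\<^sup>2) + 4 * t\<^sup>2 * (- 2 * flat (- 3) (1 - t\<^sup>2) + flat (- 4) (1 - t\<^sup>2))"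

lemma flat_compose_deriv:
  "((\<lambda>t. flat a (1 - t\<^sup>2)) has_real_derivative
    (a * flat (a - 1) (1 - t\<^sup>2) + flat (a - 2) (1 - t\<^sup>2)) * (- 2 * t)) (at t)"
proof -
  have "((\<lambda>t. 1 - t\<^sup>2) has_real_derivative - 2 * t) (at t)"
    by (auto intro!: derivative_eq_intros)
  from DERIV_chain2[OF flat_has_derivative this] show ?thesis by simp
qed

lemma bump_deriv: "(bump has_real_derivative bump' t) (at t)"
  using flat_compose_deriv[of 0 t] by (simp add: bump_def[abs_def] bump'_def mult_ac)

lemma bump'_deriv: "(bump' has_real_derivative bump'' t) (at t)"
  unfolding bump'_def[abs_def]
  by (rule derivative_eq_intros flat_compose_deriv refl)+ (simp add: bump''_def power2_eq_square algebra_simps)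

lemma flat_abs_le: "\<bar>flat 0 t\<bar> \<le> 1"
  by (simp add: flat_def)

lemma bump_abs_le: "\<bar>bump t\<bar> \<le> 1"
  by (simp add: bump_def flat_abs_le)

lemma bump_eq_0:
  assumes "\<bar>t\<bar> \<ge> 1"
  shows "bump t = 0" "bump' t = 0" "bump'' t = 0"
proof -
  have "1 - t\<^sup>2 \<le> 0"
    using power_mono[OF assms, of 2] by simp
  then show "bump t = 0" "bump' t = 0" "bump'' t = 0"
    by (simp_all add: bump_def bump'_def bump''_def flat_def)
qed

lemma bump_ge:
  assumes "\<bar>t\<bar> \<le> 1 / 2"
  shows "bump t \<ge> exp (- 4 / 3)"
proof -
  have "t\<^sup>2 \<le> 1 / 4"
    using power_mono[OF assms, of 2] by (simp add: power_divide)
  then have "1 / (1 - t\<^sup>2) \<le> 4 / 3"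
    by (simp add: field_simps)
  then show ?thesis
    using \<open>t\<^sup>2 \<le> 1 / 4\<close> by (simp add: bump_def flat_def)
qed

lemma bump_bounded: "\<exists>K>0. \<forall>t. \<bar>bump' t\<bar> \<le> K \<and> \<bar>bump'' t\<bar> \<le> K"
proof -
  have flat: "continuous_on S (\<lambda>t. flat a (1 - t\<^sup>2))" for S a
    by (intro DERIV_continuous_on[OF has_field_derivative_at_within[OF flat_compose_deriv]])
  have "continuous_on {-1..1} bump'" "continuous_on {-1..1} bump''"
    unfolding bump'_def[abs_def] bump''_def[abs_def] by (intro continuous_intros flat)+
  then have "bounded (bump' ` {-1..1})" "bounded (bump'' ` {-1..1})"
    by (simp_all add: compact_continuous_image compact_imp_bounded)
  then obtain K1 K2 where K: "K1 > 0" "K2 > 0"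
    "\<And>t. t \<in> {-1..1} \<Longrightarrow> \<bar>bump' t\<bar> \<le> K1" "\<And>t. t \<in> {-1..1} \<Longrightarrow> \<bar>bump'' t\<bar> \<le> K2"
    unfolding bounded_pos by auto
  have "\<bar>bump' t\<bar> \<le> max K1 K2 \<and> \<bar>bump'' t\<bar> \<le> max K1 K2" for t
  proof (cases "\<bar>t\<bar> \<ge> 1")
    case True
    then show ?thesis using K(1) by (simp add: bump_eq_0)
  next
    case False
    then have "t \<in> {-1..1}" by auto
    from K(3,4)[OF this] show ?thesis by (auto simp: le_max_iff_disj)
  qed
  then show ?thesis
    using K(1) by (intro exI[of _ "max K1 K2"]) auto
qed

text \<open>On the scale \<open>ln (norm x)\<close> an interval of length \<open>n\<close> starting
  at \<open>a\<close>, half-open so that consecutive shells are disjoint and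
  \<open>shell_fun_sum\<close> holds at every point.\<close>

definition shell :: "real \<Rightarrow> nat \<Rightarrow> (real^'d::finite) set" where
  "shell a n = ball 0 (exp (a + real n)) - ball 0 (exp a)"

text \<open>The model for \<open>\<omega> r powr (- s)\<close>: its square is scale invariant, in
  the sense that a shell of logarithmic length one carries the same mass wherever it lies.\<close>

definition shell_fun :: "real \<Rightarrow> nat \<Rightarrow> real^'d::finite \<Rightarrow> real" where
  "shell_fun a n x = indicator (shell a n) x * norm x powr (- real CARD('d) / 2)"

text \<open>The volume of the annulus from radius 1 to \<open>exp 1\<close>. It depends on the
  dimension alone, hence the type argument.\<close>

definition shell_mass :: "'d::finite itself \<Rightarrow> real" where
  "shell_mass _ = (exp (real CARD('d)) - 1) * unit_ball_vol (real CARD('d))"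

lemma shell_mass_pos: "shell_mass TYPE('d::finite) > 0"
  unfolding shell_mass_def by (intro mult_pos_pos) auto

lemma in_shell: "x \<in> shell a n \<longleftrightarrow> exp a \<le> norm x \<and> norm x < exp (a + real n)"
  by (auto simp: shell_def)

lemma shell_fun_square:
  fixes x :: "real^'d::finite"
  shows "(shell_fun a n x)\<^sup>2 = indicator (shell a n) x * norm x powr (- real CARD('d))"
  by (simp add: shell_fun_def power2_eq_square indicator_def flip: powr_add)

lemma shell_fun_sum:
  fixes x :: "real^'d::finite"
  shows "(shell_fun a n x)\<^sup>2 = (\<Sum>i<n. (shell_fun (a + real i) 1 x)\<^sup>2)"
proof (induction n)
  case 0
  then show ?case by (auto simp: shell_fun_def indicator_def in_shell)
next
  case (Suc n)
  have split: "(if l \<le> t \<and> t < h then 1 else 0) = (if l \<le> t \<and> t < m then 1 else 0) + (if m \<le> t \<and> t < h then 1 else 0 :: real)"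
    if "l \<le> m" "m \<le> h" for l m h t :: real
    using that by auto
  have eq: "a + real n + real 1 = a + real (Suc n)" by simp
  have "indicator (shell a (Suc n)) x = (indicator (shell a n) x + indicator (shell (a + real n) 1) x :: real)"
    unfolding indicator_def in_shell eq of_bool_def by (rule split) simp_all
  then have "(shell_fun a (Suc n) x)\<^sup>2 = (shell_fun a n x)\<^sup>2 + (shell_fun (a + real n) 1 x)\<^sup>2"
    unfolding shell_fun_square by (simp add: distrib_right)
  then show ?case using Suc by simp
qed

lemma integral_indicator_shell:
  "integrable (lebesgue_on (UNIV - {0})) (indicator (shell a 1) :: real^'d::finite \<Rightarrow> real)"
  "integral\<^sup>L (lebesgue_on (UNIV - {0})) (indicator (shell a 1) :: real^'d \<Rightarrow> real)
    = exp (a * real CARD('d)) * shell_mass TYPE('d)"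
proof -
  let ?S = "shell a 1 :: (real^'d) set" and ?M = "lebesgue_on (UNIV - {0} :: (real^'d) set)"
  have sub: "?S \<subseteq> UNIV - {0}"
    by (auto simp: in_shell not_less[symmetric])
  have S: "?S \<in> sets ?M"
    using sub by (simp add: sets_restrict_space_iff shell_def)
  have le: "exp a \<le> exp (a + real 1)" by simp
  have fin: "emeasure lborel (ball (0::real^'d) r) < \<infinity>" for r
    by (rule emeasure_lborel_ball_finite)
  have "emeasure ?M ?S = emeasure lebesgue ?S"
    using sub by (intro emeasure_restrict_space) auto
  also have "\<dots> = emeasure lborel ?S"
    by (simp add: shell_def)
  finally have em: "emeasure ?M ?S = emeasure lborel ?S" .
  have fm: "emeasure lborel ?S < \<infinity>"
    unfolding shell_def by (rule order_le_less_trans[OF emeasure_mono fin]) auto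
  show "integrable ?M (indicator ?S :: _ \<Rightarrow> real)"
    using S fm em by (intro integrable_real_indicator) auto
  have "?S \<inter> space ?M = ?S"
    using sub by auto
  then have "integral\<^sup>L ?M (indicator ?S :: _ \<Rightarrow> real) = measure ?M ?S"
    by simp
  also have "\<dots> = measure lborel ?S"
    unfolding measure_def em ..
  also have "\<dots> = measure lborel (ball (0::real^'d) (exp (a + real 1))) - measure lborel (ball (0::real^'d) (exp a))"
    unfolding shell_def using fin le
    by (intro measure_Diff subset_ball) (auto simp: less_top[symmetric])
  also have "\<dots> = exp (a * real CARD('d)) * shell_mass TYPE('d)"
  proof -
    have pw: "exp t ^ CARD('d) = exp (t * real CARD('d))" for t :: real
      by (metis exp_of_nat_mult mult.commute)
    have "exp (a + real 1) ^ CARD('d) = exp (a * real CARD('d)) * exp (real CARD('d))"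
      by (subst pw) (simp add: distrib_right exp_add)
    moreover have "measure lborel (ball (0::real^'d) (exp t)) = unit_ball_vol (real CARD('d)) * exp t ^ CARD('d)" for t
      by (simp add: content_ball)
    ultimately show ?thesis
      by (simp only: pw[of a]) (simp add: shell_mass_def algebra_simps)
  qed
  finally show "integral\<^sup>L ?M (indicator ?S :: _ \<Rightarrow> real) = exp (a * real CARD('d)) * shell_mass TYPE('d)" .
qed

text \<open>On a shell of logarithmic length one \<open>norm x powr (- d)\<close> varies by a factor
  of at most \<open>exp d\<close>, and its size \<open>exp (- a d)\<close> cancels the volume growth
  \<open>exp (a d)\<close>. Bounds uniform in \<open>a\<close> are enough, which avoids integration
  in polar coordinates.\<close>

lemma shell_fun_mass_1:
  fixes a :: real
  defines "M \<equiv> lebesgue_on (UNIV - {0} :: (real^'d::finite) set)"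
  shows "integrable M (\<lambda>x. (shell_fun a 1 x)\<^sup>2)"
    and "integral\<^sup>L M (\<lambda>x. (shell_fun a 1 x)\<^sup>2) \<le> shell_mass TYPE('d)"
    and "exp (- real CARD('d)) * shell_mass TYPE('d) \<le> integral\<^sup>L M (\<lambda>x. (shell_fun a 1 x)\<^sup>2)"
proof -
  let ?d = "real CARD('d)" and ?I = "indicator (shell a 1) :: real^'d \<Rightarrow> real"
  have le: "(shell_fun a 1 x)\<^sup>2 \<le> exp (- a * ?d) * ?I x"
    and ge: "exp (- (a + 1) * ?d) * ?I x \<le> (shell_fun a 1 x)\<^sup>2" for x :: "real^'d"
  proof -
    have "norm x powr (- ?d) \<le> exp (- a * ?d)" "exp (- (a + 1) * ?d) \<le> norm x powr (- ?d)" if "x \<in> shell a 1"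
    proof -
      have x: "exp a \<le> norm x" "norm x \<le> exp (a + 1)" "norm x > 0"
        using that less_le_trans[OF exp_gt_zero, of a "norm x"] by (auto simp: in_shell)
      have e: "exp t powr (- ?d) = exp (- t * ?d)" for t :: real
        by (simp add: powr_def mult.commute)
      have "norm x powr (- ?d) \<le> exp a powr (- ?d)" "exp (a + 1) powr (- ?d) \<le> norm x powr (- ?d)"
        using powr_mono2'[of "- ?d" "exp a" "norm x"] powr_mono2'[of "- ?d" "norm x" "exp (a + 1)"] x
        by simp_all
      then show "norm x powr (- ?d) \<le> exp (- a * ?d)" "exp (- (a + 1) * ?d) \<le> norm x powr (- ?d)"
        by (simp_all only: e)
    qed
    then show "(shell_fun a 1 x)\<^sup>2 \<le> exp (- a * ?d) * ?I x"
      and "exp (- (a + 1) * ?d) * ?I x \<le> (shell_fun a 1 x)\<^sup>2"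
      unfolding shell_fun_square by (auto simp: indicator_def)
  qed
  note I = integral_indicator_shell[where 'd = 'd, of a, folded M_def]
  have meas: "(\<lambda>x. (shell_fun a 1 x)\<^sup>2) \<in> borel_measurable M"
  proof -
    have "?I \<in> borel_measurable M"
      using I(1) by auto
    moreover have "(\<lambda>x::real^'d. norm x powr (- ?d)) \<in> borel_measurable M"
      unfolding M_def
      by (intro continuous_on_measurable_lebesgue_on) (auto intro!: continuous_intros simp: open_Diff)
    ultimately show ?thesis
      unfolding shell_fun_square by (rule borel_measurable_times)
  qed
  show int: "integrable M (\<lambda>x. (shell_fun a 1 x)\<^sup>2)"
    by (rule Bochner_Integration.integrable_bound[OF integrable_mult_right[OF I(1), of "exp (- a * ?d)"] meas])
       (use le in auto)
  have "integral\<^sup>L M (\<lambda>x. (shell_fun a 1 x)\<^sup>2) \<le> (\<integral>x. exp (- a * ?d) * ?I x \<partial>M)"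
    by (intro integral_mono int integrable_mult_right I(1) le)
  also have "\<dots> = exp (- a * ?d) * (exp (a * ?d) * shell_mass TYPE('d))"
    using I(2) by simp
  also have "\<dots> = shell_mass TYPE('d)"
    using mult_exp_exp[of "- a * ?d" "a * ?d"] by (simp only: mult.assoc[symmetric]) simp
  finally show "integral\<^sup>L M (\<lambda>x. (shell_fun a 1 x)\<^sup>2) \<le> shell_mass TYPE('d)" .
  have "exp (- ?d) * shell_mass TYPE('d) = exp (- (a + 1) * ?d) * (exp (a * ?d) * shell_mass TYPE('d))"
  proof -
    have "exp (- (a + 1) * ?d) * exp (a * ?d) = exp (- ?d)"
      by (simp add: mult_exp_exp algebra_simps)
    then show ?thesis
      by (simp only: mult.assoc[symmetric])
  qed
  also have "\<dots> = (\<integral>x. exp (- (a + 1) * ?d) * ?I x \<partial>M)"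
    using I(2) by simp
  also have "\<dots> \<le> integral\<^sup>L M (\<lambda>x. (shell_fun a 1 x)\<^sup>2)"
    by (intro integral_mono int integrable_mult_right I(1) ge)
  finally show "exp (- ?d) * shell_mass TYPE('d) \<le> integral\<^sup>L M (\<lambda>x. (shell_fun a 1 x)\<^sup>2)" .
qed

text \<open>Linear growth in \<open>n\<close> from both sides makes norms over shells of
  proportional lengths comparable, with a constant independent of \<open>n\<close> and of the
  position.\<close>

lemma shell_fun_norm:
  fixes a :: real
  defines "\<Omega> \<equiv> UNIV - {0} :: (real^'d::finite) set"
  shows "shell_fun a n \<in> L2 \<Omega>"
    and "(L2_norm \<Omega> (shell_fun a n))\<^sup>2 \<le> real n * shell_mass TYPE('d)"
    and "real n * (exp (- real CARD('d)) * shell_mass TYPE('d)) \<le> (L2_norm \<Omega> (shell_fun a n))\<^sup>2"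
proof -
  note m = shell_fun_mass_1[where 'd = 'd, folded \<Omega>_def]
  have "(L2_norm \<Omega> (shell_fun a n))\<^sup>2 = (\<integral>x. (shell_fun a n x)\<^sup>2 \<partial>lebesgue_on \<Omega>)"
    unfolding L2_norm_power2 L2_inner_def by (simp only: power2_eq_square)
  also have "\<dots> = (\<integral>x. (\<Sum>i<n. (shell_fun (a + real i) 1 x)\<^sup>2) \<partial>lebesgue_on \<Omega>)"
    by (simp only: shell_fun_sum[of a n])
  also have "\<dots> = (\<Sum>i<n. \<integral>x. (shell_fun (a + real i) 1 x)\<^sup>2 \<partial>lebesgue_on \<Omega>)"
    by (intro Bochner_Integration.integral_sum m(1))
  finally have eq: "(L2_norm \<Omega> (shell_fun a n))\<^sup>2 = (\<Sum>i<n. \<integral>x. (shell_fun (a + real i) 1 x)\<^sup>2 \<partial>lebesgue_on \<Omega>)" .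
  have "integrable (lebesgue_on \<Omega>) (\<lambda>x. (shell_fun a n x)\<^sup>2)"
    unfolding shell_fun_sum[of a n] by (intro Bochner_Integration.integrable_sum m(1))
  moreover have "shell_fun a n \<in> borel_measurable (lebesgue_on \<Omega>)"
  proof -
    have "(\<lambda>x. (shell_fun a n x)\<^sup>2) \<in> borel_measurable (lebesgue_on \<Omega>)"
      using \<open>integrable (lebesgue_on \<Omega>) (\<lambda>x. (shell_fun a n x)\<^sup>2)\<close> by auto
    \<comment> \<open>Measurability is read off from the square, the function being
      nonnegative.\<close>
    then have "(\<lambda>x. sqrt ((shell_fun a n x)\<^sup>2)) \<in> borel_measurable (lebesgue_on \<Omega>)"
      by measurable
    moreover have "(\<lambda>x. sqrt ((shell_fun a n x)\<^sup>2)) = (shell_fun a n :: real^'d \<Rightarrow> real)"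
      by (auto simp: shell_fun_def)
    ultimately show ?thesis by simp
  qed
  ultimately show "shell_fun a n \<in> L2 \<Omega>"
    by (simp add: L2_def)
  show "(L2_norm \<Omega> (shell_fun a n))\<^sup>2 \<le> real n * shell_mass TYPE('d)"
    unfolding eq by (rule order_trans[OF sum_bounded_above[OF m(2)]]) simp
  show "real n * (exp (- real CARD('d)) * shell_mass TYPE('d)) \<le> (L2_norm \<Omega> (shell_fun a n))\<^sup>2"
    unfolding eq by (rule order_trans[OF _ sum_bounded_below[OF m(3)]]) simp
qed

subsection \<open>Optimality of the constant\<close>

context rellich_weight
begin

definition s :: real where "s = (d + 2 * min \<delta> \<delta>' - 4) / 2"

definition \<tau> :: "real \<Rightarrow> real \<Rightarrow> real \<Rightarrow> real" where "\<tau> b L r = (ln r - b) / L"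

definition test :: "real \<Rightarrow> real \<Rightarrow> real \<Rightarrow> real" where
  "test b L r = r powr (- s) * bump (\<tau> b L r)"

text \<open>The failure of the test function to be an eigenfunction, after division by
  \<open>\<omega> r powr (- s)\<close>. The first term is small where \<open>p\<close> is near its
  minimal exponent; the others carry powers of \<open>1 / L\<close> from differentiating the dilated
  bump.\<close>

definition defect :: "real \<Rightarrow> real \<Rightarrow> real \<Rightarrow> real" where
  "defect b L r = s * (p r - min \<delta> \<delta>') * bump (\<tau> b L r)
    - (d + p r - 2 - 2 * s) * (bump' (\<tau> b L r) / L) - bump'' (\<tau> b L r) / L\<^sup>2"

lemma s_pos: "s > 0"
  using subcritical by (simp add: s_def)

lemma \<tau>_deriv:
  assumes "\<And>t. (F has_real_derivative F' t) (at t)" "r > 0" "L > 0"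
  shows "((\<lambda>r. F (\<tau> b L r)) has_real_derivative F' (\<tau> b L r) / L / r) (at r)"
proof -
  have "(\<tau> b L has_real_derivative 1 / L / r) (at r)"
    unfolding \<tau>_def[abs_def] using assms(2,3) by (auto intro!: derivative_eq_intros simp: field_simps)
  from DERIV_chain2[OF assms(1) this] show ?thesis by simp
qed

lemma powr_s_deriv: "r > 0 \<Longrightarrow> ((\<lambda>r. r powr (- s)) has_real_derivative - s * r powr (- s) / r) (at r)"
  using has_real_derivative_powr[of r "- s"] by (simp add: powr_diff)

lemma test_deriv:
  assumes "r > 0" "L > 0"
  shows "(test b L has_real_derivative
    r powr (- s) * (bump' (\<tau> b L r) / L - s * bump (\<tau> b L r)) / r) (at r)"
proof -
  have "((\<lambda>r. r powr (- s) * bump (\<tau> b L r)) has_real_derivative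
      - s * r powr (- s) / r * bump (\<tau> b L r) + bump' (\<tau> b L r) / L / r * r powr (- s)) (at r)"
    by (rule DERIV_mult[OF powr_s_deriv[OF assms(1)] \<tau>_deriv[OF bump_deriv assms]])
  moreover have "- s * w / r * B + B' / L / r * w = w * (B' / L - s * B) / r" for w B B'
    using assms by (simp add: field_simps)
  ultimately show ?thesis
    by (simp only: test_def[abs_def])
qed

text \<open>The flux: \<open>c\<close> times the gradient of the radial test function is
  \<open>\<kappa> (norm x)\<close> times \<open>x\<close>, because
  \<open>c = \<omega> r^2\<close>.\<close>

definition \<kappa> :: "real \<Rightarrow> real \<Rightarrow> real \<Rightarrow> real" where
  "\<kappa> b L r = \<omega> r * (r powr (- s) * (bump' (\<tau> b L r) / L - s * bump (\<tau> b L r)))"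

lemma \<kappa>_deriv:
  assumes "r > 0" "L > 0"
  shows "(\<kappa> b L has_real_derivative
    \<omega> r * (r powr (- s) * ((p r - 2 - s) * (bump' (\<tau> b L r) / L - s * bump (\<tau> b L r))
      + bump'' (\<tau> b L r) / L\<^sup>2 - s * (bump' (\<tau> b L r) / L))) / r) (at r)"
proof -
  let ?B = "bump (\<tau> b L r)" and ?B' = "bump' (\<tau> b L r)" and ?B'' = "bump'' (\<tau> b L r)"
  have "((\<lambda>r. bump' (\<tau> b L r) / L - s * bump (\<tau> b L r)) has_real_derivative
      ?B'' / L / r / L - s * (?B' / L / r)) (at r)"
    by (intro DERIV_diff DERIV_cdivide DERIV_cmult \<tau>_deriv assms bump_deriv bump'_deriv)
  from DERIV_mult[OF \<omega>_deriv[OF assms(1)] DERIV_mult[OF powr_s_deriv[OF assms(1)] this]]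
  have "(\<kappa> b L has_real_derivative
      \<omega> r * (p r - 2) / r * (r powr (- s) * (?B' / L - s * ?B))
      + (- s * r powr (- s) / r * (?B' / L - s * ?B) + (?B'' / L / r / L - s * (?B' / L / r)) * r powr (- s)) * \<omega> r) (at r)"
    by (simp only: \<kappa>_def[abs_def])
  moreover have "w * q / r * (v * E) + (- s * v / r * E + (B'' / L / r / L - s * (B' / L / r)) * v) * w
      = w * (v * ((q - s) * E + B'' / L\<^sup>2 - s * (B' / L))) / r" for w q v E B' B''
    using assms by (simp add: power2_eq_square divide_simps) (simp add: algebra_simps)
  ultimately show ?thesis
    by (simp only:)
qed

lemma test_core:
  assumes "L > 0"
  shows "(\<lambda>x. test b L (norm x)) \<in> core"
proof (rule Cc_infinityI[OF open_dom])
  show "smooth_on punctured (\<lambda>x. test b L (norm x))"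
    unfolding test_def bump_def \<tau>_def divide_inverse power2_eq_square
    by (intro smooth_on_mult smooth_on_powr smooth_on_flat smooth_on_diff smooth_on_const smooth_on_ln
        smooth_on_norm open_dom) auto
  \<comment> \<open>The annulus where \<open>ln (norm x)\<close> is within \<open>L\<close> of
    \<open>b\<close>.\<close>
  let ?K = "cball 0 (exp (b + L)) - ball 0 (exp (b - L)) :: (real^'d) set"
  show "compact ?K"
    by (intro compact_diff) auto
  show "?K \<subseteq> punctured"
    by auto
  show "test b L (norm x) = 0" if "x \<notin> ?K" for x
  proof (cases "x = 0")
    \<comment> \<open>The convention \<open>0 powr (- s) = 0\<close> makes the test function vanish
      at the origin.\<close>
    case True
    then show ?thesis by (simp add: test_def)
  next
    case False
    then have "exp (b + L) < exp (ln (norm x)) \<or> exp (ln (norm x)) < exp (b - L)"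
      using that by auto
    then have "\<bar>ln (norm x) - b\<bar> \<ge> L"
      unfolding exp_less_cancel_iff by auto
    then have "\<bar>\<tau> b L (norm x)\<bar> \<ge> 1"
      using assms by (simp add: \<tau>_def)
    then show ?thesis
      by (simp add: test_def bump_eq_0)
  qed
qed

text \<open>The flux has divergence \<open>d \<kappa> + r \<kappa>'\<close>. With \<open>p\<close>
  replaced by its limit \<open>m = min \<delta> \<delta>'\<close> and derivatives of the bump
  dropped, the factor left is \<open>s (d + m - 2 - s)\<close>, which is \<open>s d / 2 = A\<close>
  by the choice of \<open>s\<close>; the rest is \<open>defect\<close>.\<close>

lemma divergence_op_test:
  assumes "L > 0" "x \<noteq> 0"
  shows "divergence_op c\<^sub>\<Omega> (\<lambda>x. test b L (norm x)) x
    = \<omega> (norm x) * (norm x powr (- s) * (A * bump (\<tau> b L (norm x)) + defect b L (norm x)))"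
proof -
  define r where "r = norm x"
  have r: "r > 0" using assms(2) by (simp add: r_def)
  have field: "c\<^sub>\<Omega> y * partial_deriv k (\<lambda>x. test b L (norm x)) y = \<kappa> b L (norm y) * y $ k" if "y \<in> punctured" for y k
  proof -
    have y: "y \<noteq> 0" "norm y > 0" using that by auto
    have "c\<^sub>\<Omega> y = \<omega> (norm y) * (norm y)\<^sup>2"
      using c_eq[OF y(2)] by (simp add: weight_eq)
    then show ?thesis
      using y by (simp add: partial_deriv_radial(2)[OF y(1) test_deriv[OF y(2) assms(1)]] \<kappa>_def power2_eq_square)
  qed
  have "divergence_op c\<^sub>\<Omega> (\<lambda>x. test b L (norm x)) x
      = - (\<Sum>k\<in>UNIV. partial_deriv k (\<lambda>y. \<kappa> b L (norm y) * y $ k) x)"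
    unfolding divergence_op_def
    by (intro arg_cong[where f = uminus] sum.cong refl partial_deriv_cong[OF open_dom _ field])
       (use assms(2) in auto)
  also have "\<dots> = - (d * \<kappa> b L r + \<omega> r * (r powr (- s) * ((p r - 2 - s) * (bump' (\<tau> b L r) / L - s * bump (\<tau> b L r))
      + bump'' (\<tau> b L r) / L\<^sup>2 - s * (bump' (\<tau> b L r) / L))))"
    using r unfolding r_def
    by (simp add: divergence_radial_field[OF assms(2) \<kappa>_deriv[OF _ assms(1)], folded d_eq])
  also have "\<dots> = \<omega> r * (r powr (- s) * (A * bump (\<tau> b L r) + defect b L r))"
  proof -
    have A: "A = s * (d + min \<delta> \<delta>' - 2 - s)"
      by (simp add: A_def s_def field_simps)
    have "- (d * (w * (v * (E' - s * E))) + w * (v * ((q - 2 - s) * (E' - s * E) + E'' - s * E')))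
        = w * (v * (s * (d + m - 2 - s) * E + (s * (q - m) * E - (d + q - 2 - 2 * s) * E' - E'')))"
      for w v E E' E'' q m
      by (simp add: algebra_simps)
    then show ?thesis
      unfolding A defect_def \<kappa>_def .
  qed
  finally show ?thesis
    by (simp add: r_def)
qed

text \<open>The test functions live where \<open>c\<close> has the smaller exponent: near the origin if
  \<open>\<delta> \<le> \<delta>'\<close>, near infinity otherwise.\<close>

definition center :: "real \<Rightarrow> real" where
  "center L = (if \<delta> \<le> \<delta>' then - 2 * L else 2 * L)"

text \<open>The centre is at distance \<open>2 L\<close> from 0 on the logarithmic scale, so the
  whole support has \<open>ln r \<le> - L\<close> or \<open>ln r \<ge> L\<close>. There
  \<open>p\<close> is exponentially close to its limit; the weaker \<open>1 / L\<close> is kept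
  since the other terms of \<open>defect\<close> are of that size.\<close>

lemma slope_near_center:
  assumes "L > 0" "r > 0" "\<bar>ln r - center L\<bar> \<le> L"
  shows "\<bar>p r - min \<delta> \<delta>'\<bar> \<le> \<bar>\<delta> - \<delta>'\<bar> / L"
proof (cases "\<delta> \<le> \<delta>'")
  case True
  then have "exp (ln r) \<le> exp (- L)"
    using assms(3) by (simp add: center_def abs_le_iff)
  then have "r \<le> 1 / L"
    using exp_minus_le_inverse[OF assms(1)] assms(2) by simp
  moreover have "r / (1 + r) \<le> r"
    using assms(2) by (simp add: field_simps)
  moreover have "p r - min \<delta> \<delta>' = (\<delta>' - \<delta>) * (r / (1 + r))"
    using True by (simp add: p_def)
  ultimately show ?thesis
    using True assms mult_left_mono[of "r / (1 + r)" "1 / L" "\<delta>' - \<delta>"] by (simp add: abs_mult)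
next
  case False
  then have "exp L \<le> exp (ln r)"
    using assms(3) by (simp add: center_def abs_le_iff)
  then have "r \<ge> L"
    using exp_ge_add_one_self[of L] unfolding exp_ln[OF assms(2)] by linarith
  then have "1 / (1 + r) \<le> 1 / L"
    using assms(1) by (simp add: frac_le)
  moreover have "p r - min \<delta> \<delta>' = (\<delta> - \<delta>') * (1 / (1 + r))"
    using False assms(2) by (simp add: p_def field_simps)
  ultimately show ?thesis
    using False assms mult_left_mono[of "1 / (1 + r)" "1 / L" "\<delta> - \<delta>'"] by (simp add: abs_mult)
qed

text \<open>The quotient \<open>\<theta>\<close> of \<open>c\<close> by
  \<open>r powr min \<delta> \<delta>'\<close> is a power with exponent
  \<open>\<bar>\<delta> - \<delta>'\<bar>\<close> of \<open>1 + r\<close> near the origin and of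
  \<open>r / (1 + r)\<close> near infinity. These bases lie in [1, 2] and [1/2, 1], so
  \<open>\<theta>\<close> lies between \<open>1 / K\<close> and \<open>K\<close>. The other powers
  combine to \<open>r powr (- d / 2)\<close> by the choice of \<open>s\<close>.\<close>

lemma weight_near_center:
  assumes "L > 0" "r > 0" "\<bar>ln r - center L\<bar> \<le> L"
  defines "K \<equiv> 2 powr \<bar>\<delta> - \<delta>'\<bar>"
  shows "\<omega> r * r powr (- s) \<le> K * r powr (- d / 2)"
    and "r powr (- d / 2) \<le> K * (\<omega> r * r powr (- s))"
proof -
  let ?m = "min \<delta> \<delta>'"
  define \<theta> where "\<theta> = c r * r powr (- ?m)"
  have "r powr (- s) / r\<^sup>2 = r powr (- s - 2)"
    using assms(2) by (simp add: powr_diff powr_numeral)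
  also have "\<dots> = r powr (- ?m) * r powr (- d / 2)"
  proof -
    have "- s - 2 = - ?m + - d / 2"
      by (simp add: s_def field_simps)
    then show ?thesis
      by (simp only: powr_add)
  qed
  finally have "r powr (- s) / r\<^sup>2 = r powr (- ?m) * r powr (- d / 2)" .
  moreover have "\<omega> r * r powr (- s) = c r * (r powr (- s) / r\<^sup>2)"
    by (simp add: \<omega>_def)
  ultimately have eq: "\<omega> r * r powr (- s) = \<theta> * r powr (- d / 2)"
    by (simp only: \<theta>_def mult.assoc)
  have "\<theta> \<le> K \<and> 1 \<le> K * \<theta>"
  proof (cases "\<delta> \<le> \<delta>'")
    case True
    have "exp (ln r) \<le> exp 0"
      using assms(1,3) True unfolding exp_le_cancel_iff by (simp add: center_def abs_le_iff)
    then have r: "r \<le> 1"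
      using assms(2) by simp
    have \<theta>: "\<theta> = (1 + r) powr (\<delta>' - \<delta>)"
      using True assms(2) by (simp add: \<theta>_def c_weight_def powr_minus)
    have "\<theta> \<le> K"
      using r assms(2) True unfolding \<theta> K_def by (simp add: powr_mono2)
    moreover have "1 \<le> \<theta>"
      using assms(2) True unfolding \<theta> by (simp add: ge_one_powr_ge_zero)
    moreover have "1 \<le> K"
      unfolding K_def by (simp add: ge_one_powr_ge_zero)
    ultimately show ?thesis
      using mult_mono[of 1 K 1 \<theta>] by simp
  next
    case False
    have "exp 0 \<le> exp (ln r)"
      using assms(1,3) False unfolding exp_le_cancel_iff by (simp add: center_def abs_le_iff)
    then have r: "r \<ge> 1"
      using assms(2) by simp
    have \<theta>: "\<theta> = (r / (1 + r)) powr (\<delta> - \<delta>')"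
    proof -
      have "\<theta> = r powr (\<delta> - \<delta>') * (1 + r) powr (- (\<delta> - \<delta>'))"
        using False assms(2) by (simp add: \<theta>_def c_weight_def mult_ac powr_diff powr_minus_divide)
      then show ?thesis
        using assms(2) by (simp add: powr_divide powr_minus_divide del: minus_diff_eq)
    qed
    have "\<theta> \<le> 1"
      using False assms(2) unfolding \<theta> by (intro powr_le1) auto
    moreover have "1 \<le> K"
      unfolding K_def by (simp add: ge_one_powr_ge_zero)
    moreover have "K * \<theta> = (2 * (r / (1 + r))) powr (\<delta> - \<delta>')"
      using False assms(2) unfolding \<theta> K_def by (subst powr_mult) auto
    moreover have "2 * (r / (1 + r)) \<ge> 1"
      using r by (simp add: field_simps)
    ultimately show ?thesis
      using False by (simp add: ge_one_powr_ge_zero)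
  qed
  then have "\<theta> * r powr (- d / 2) \<le> K * r powr (- d / 2)" "1 * r powr (- d / 2) \<le> K * \<theta> * r powr (- d / 2)"
    using mult_right_mono[of \<theta> K "r powr (- d / 2)"] mult_right_mono[of 1 "K * \<theta>" "r powr (- d / 2)"] by auto
  then show "\<omega> r * r powr (- s) \<le> K * r powr (- d / 2)"
    and "r powr (- d / 2) \<le> K * (\<omega> r * r powr (- s))"
    unfolding eq by (simp_all add: mult.assoc)
qed

lemma defect_bound:
  obtains C where "C > 0" "\<And>L r. L \<ge> 1 \<Longrightarrow> r > 0 \<Longrightarrow> \<bar>ln r - center L\<bar> \<le> L \<Longrightarrow> \<bar>defect (center L) L r\<bar> \<le> C / L"
proof -
  obtain K where K: "K > 0" "\<And>t. \<bar>bump' t\<bar> \<le> K" "\<And>t. \<bar>bump'' t\<bar> \<le> K"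
    using bump_bounded by blast
  \<comment> \<open>\<open>Q\<close> bounds the coefficient \<open>d + p - 2 - 2 s\<close> of the
    first derivative, by \<open>p_bounds\<close>.\<close>
  define Q where "Q = d + (2 + \<delta> + \<delta>') + 2 * s"
  define C where "C = s * \<bar>\<delta> - \<delta>'\<bar> + Q * K + K"
  have Q: "Q \<ge> 0"
    using d_ge_1 exponents_nonneg s_pos by (simp add: Q_def)
  have "C > 0"
    unfolding C_def using K(1) Q s_pos by (intro add_nonneg_pos add_nonneg_nonneg mult_nonneg_nonneg) auto
  moreover have "\<bar>defect (center L) L r\<bar> \<le> C / L" if L: "L \<ge> 1" and r: "r > 0" and near: "\<bar>ln r - center L\<bar> \<le> L" for L r
  proof -
    let ?t = "\<tau> (center L) L r"
    have L0: "L > 0" using L by simp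
    have "\<bar>s * (p r - min \<delta> \<delta>') * bump ?t\<bar> \<le> s * (\<bar>\<delta> - \<delta>'\<bar> / L) * 1"
      unfolding abs_mult using slope_near_center[OF L0 r near] bump_abs_le s_pos L0
      by (intro mult_mono) auto
    moreover have "\<bar>(d + p r - 2 - 2 * s) * (bump' ?t / L)\<bar> \<le> Q * (K / L)"
    proof -
      have "\<bar>d + p r - 2 - 2 * s\<bar> \<le> Q"
        using p_bounds[OF r] d_ge_1 s_pos unfolding Q_def by linarith
      moreover have "\<bar>bump' ?t / L\<bar> \<le> K / L"
        using K(2) L0 by (simp add: divide_right_mono)
      ultimately show ?thesis
        unfolding abs_mult using Q by (intro mult_mono) auto
    qed
    moreover have "\<bar>bump'' ?t / L\<^sup>2\<bar> \<le> K / L"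
    proof -
      have "\<bar>bump'' ?t / L\<^sup>2\<bar> \<le> K / L\<^sup>2"
        using K(3) by (simp add: divide_right_mono)
      also have "\<dots> \<le> K / L"
        using K(1) L by (intro divide_left_mono) (auto simp: power2_eq_square)
      finally show ?thesis .
    qed
    ultimately have "\<bar>defect (center L) L r\<bar> \<le> s * (\<bar>\<delta> - \<delta>'\<bar> / L) * 1 + Q * (K / L) + K / L"
      unfolding defect_def by linarith
    also have "\<dots> = C / L"
      by (simp add: C_def add_divide_distrib)
    finally show ?thesis .
  qed
  ultimately show ?thesis
    using that by blast
qed

lemma defect_eq_0: "L > 0 \<Longrightarrow> \<bar>ln r - b\<bar> \<ge> L \<Longrightarrow> defect b L r = 0"
  by (simp add: defect_def bump_eq_0 \<tau>_def)

text \<open>The residual is at most \<open>O(1 / L)\<close> times the model \<open>shell_fun\<close>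
  on the whole support, while the main part is at least a constant times the model on the middle
  half, where the bump is bounded below. The model norms over these two shells are comparable, so
  the relative error is \<open>O(1 / n)\<close>.\<close>

lemma near_optimizer:
  obtains C where "\<And>n. n > 0 \<Longrightarrow> \<exists>v\<in>core. L2_norm punctured (\<lambda>x. \<omega> (norm x) * v x) > 0 \<and>
    L2_norm punctured (divergence_op c\<^sub>\<Omega> v) \<le> (A + C / real n) * L2_norm punctured (\<lambda>x. \<omega> (norm x) * v x)"
proof -
  obtain C where C: "C > 0"
    "\<And>L r. L \<ge> 1 \<Longrightarrow> r > 0 \<Longrightarrow> \<bar>ln r - center L\<bar> \<le> L \<Longrightarrow> \<bar>defect (center L) L r\<bar> \<le> C / L"
    using defect_bound by blast
  define K where "K = 2 powr \<bar>\<delta> - \<delta>'\<bar>"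
  have K: "K > 0" by (simp add: K_def)
  define \<beta> where "\<beta> = exp (- 4 / 3 :: real)"
  have \<beta>: "\<beta> > 0" by (simp add: \<beta>_def)
  \<comment> \<open>The factors in order: defect bound, upper weight bound, ratio of the outer to
    the inner model norm (from \<open>4 n\<close> against \<open>2 n exp (- d)\<close>), and lower
    weight bound divided by the least value of the bump on the middle half.\<close>
  define C' where "C' = C * K * sqrt (2 * exp d) * (K / \<beta>)"
  have "\<exists>v\<in>core. L2_norm punctured (\<lambda>x. \<omega> (norm x) * v x) > 0 \<and>
    L2_norm punctured (divergence_op c\<^sub>\<Omega> v) \<le> (A + C' / real n) * L2_norm punctured (\<lambda>x. \<omega> (norm x) * v x)"
    if n: "n > 0" for n
  proof -
    \<comment> \<open>An even \<open>L\<close> lets both the support, of logarithmic length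
      \<open>2 L = 4 n\<close>, and its middle half, of length \<open>2 n\<close>, be covered by
      shells of integer length.\<close>
    define L where "L = 2 * real n"
    have L: "L \<ge> 1" "L > 0" using n by (auto simp: L_def)
    define b where "b = center L"
    define v where "v x = test b L (norm x)" for x :: "real^'d"
    define wv where "wv x = \<omega> (norm x) * v x" for x
    define e where "e x = divergence_op c\<^sub>\<Omega> v x - A * wv x" for x
    define f_out where "f_out = (shell_fun (b - L) (4 * n) :: real^'d \<Rightarrow> real)"
    define f_in where "f_in = (shell_fun (b - real n) (2 * n) :: real^'d \<Rightarrow> real)"
    let ?N = "L2_norm punctured"
    have v: "v \<in> core"
      unfolding v_def using test_core[OF L(2)] .
    have wv: "wv \<in> core"
      unfolding wv_def using Cc_infinity_mult[OF open_dom smooth_\<omega> v] .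
    have wv2: "wv \<in> L2 punctured" and dv2: "divergence_op c\<^sub>\<Omega> v \<in> L2 punctured"
      by (intro core_L2 wv divergence_op_core v)+
    then have e2: "e \<in> L2 punctured"
      using L2.lin_closed[OF dv2 wv2, of 1 "- A"] by (simp add: e_def[abs_def])
    have e_eq: "e x = \<omega> (norm x) * norm x powr (- s) * defect b L (norm x)" if "x \<noteq> 0" for x
      unfolding e_def v_def[abs_def] wv_def divergence_op_test[OF L(2) that]
      by (simp add: v_def test_def algebra_simps)
    have e_le: "\<bar>e x\<bar> \<le> C / L * K * \<bar>f_out x\<bar>" if "x \<in> punctured" for x
    proof -
      define r where "r = norm x"
      have r: "r > 0" using that by (simp add: r_def)
      show ?thesis
      proof (cases "\<bar>ln r - b\<bar> < L")
        case True
        then have "exp (b - L) \<le> exp (ln r)" "exp (ln r) < exp (b - L + real (4 * n))"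
          unfolding exp_le_cancel_iff exp_less_cancel_iff by (auto simp: L_def)
        then have "x \<in> shell (b - L) (4 * n)"
          unfolding exp_ln[OF r] by (simp add: in_shell r_def)
        then have f: "f_out x = r powr (- d / 2)"
          by (simp add: f_out_def shell_fun_def r_def d_eq)
        have "\<bar>e x\<bar> = (\<omega> r * r powr (- s)) * \<bar>defect b L r\<bar>"
          using that \<omega>_pos[OF r] by (simp add: e_eq r_def abs_mult)
        also have "\<dots> \<le> (K * r powr (- d / 2)) * (C / L)"
        proof (rule mult_mono)
          show "\<omega> r * r powr (- s) \<le> K * r powr (- d / 2)" "\<bar>defect b L r\<bar> \<le> C / L"
            using weight_near_center(1)[OF L(2) r] C(2)[OF L(1) r] True unfolding b_def K_def by auto
        qed (use K in auto)
        finally show ?thesis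
          using f by (simp add: mult_ac)
      next
        case False
        then have "e x = 0"
          using that defect_eq_0[OF L(2), of r b] by (simp add: e_eq r_def)
        then show ?thesis
          using C(1) L K by simp
      qed
    qed
    have in_le: "\<bar>f_in x\<bar> \<le> K / \<beta> * \<bar>wv x\<bar>" if "x \<in> punctured" for x
    proof (cases "x \<in> shell (b - real n) (2 * n)")
      case True
      define r where "r = norm x"
      have r: "r > 0" using that by (simp add: r_def)
      have "exp (b - real n) \<le> exp (ln r)" "exp (ln r) < exp (b + real n)"
        using True r by (auto simp: in_shell r_def algebra_simps)
      then have near: "\<bar>ln r - b\<bar> \<le> real n"
        unfolding exp_le_cancel_iff exp_less_cancel_iff by auto
      then have "\<bar>\<tau> b L r\<bar> \<le> 1 / 2"
        using n by (simp add: \<tau>_def L_def)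
      then have "\<beta> \<le> bump (\<tau> b L r)"
        unfolding \<beta>_def by (rule bump_ge)
      then have "K / \<beta> * (\<omega> r * r powr (- s) * \<beta>) \<le> K / \<beta> * (\<omega> r * r powr (- s) * bump (\<tau> b L r))"
        using K \<beta> \<omega>_pos[OF r] by (intro mult_left_mono) auto
      moreover have "r powr (- d / 2) \<le> K * (\<omega> r * r powr (- s))"
        using weight_near_center(2)[OF L(2) r] near n unfolding b_def K_def by (simp add: L_def)
      moreover have "wv x = \<omega> r * r powr (- s) * bump (\<tau> b L r)"
        by (simp add: wv_def v_def test_def r_def)
      moreover have "\<bar>f_in x\<bar> = r powr (- d / 2)"
        using True by (simp add: f_in_def shell_fun_def r_def d_eq)
      ultimately show ?thesis
        using \<beta> K mult_left_mono[OF abs_ge_self[of "wv x"], of "K / \<beta>"] by simp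
    next
      case False
      then show ?thesis
        using K \<beta> by (simp add: f_in_def shell_fun_def)
    qed
    note shell = shell_fun_norm[where 'd = 'd, folded d_eq]
    have "?N e \<le> C / L * K * ?N f_out"
      using e2 e_le C(1) L K unfolding f_out_def
      by (intro L2_dominated(2) shell(1)) (auto simp: L2_def)
    also have "\<dots> \<le> C / L * K * (sqrt (2 * exp d) * ?N f_in)"
    proof (intro mult_left_mono)
      have S: "shell_mass TYPE('d) > 0"
        by (rule shell_mass_pos)
      have "(?N f_out)\<^sup>2 \<le> real (4 * n) * shell_mass TYPE('d)"
        unfolding f_out_def by (rule shell(2))
      also have "\<dots> = 2 * exp d * (real (2 * n) * (exp (- d) * shell_mass TYPE('d)))"
        by (simp add: exp_minus)
      also have "\<dots> \<le> 2 * exp d * (?N f_in)\<^sup>2"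
        unfolding f_in_def by (intro mult_left_mono shell(3)) auto
      also have "\<dots> = (sqrt (2 * exp d) * ?N f_in)\<^sup>2"
        by (simp add: power_mult_distrib)
      finally show "?N f_out \<le> sqrt (2 * exp d) * ?N f_in"
        by (rule power2_le_imp_le) (simp add: L2_norm_nonneg)
    qed (use C(1) L K in auto)
    also have "\<dots> \<le> C / L * K * (sqrt (2 * exp d) * (K / \<beta> * ?N wv))"
      using C(1) L K \<beta> wv2 in_le shell(1) unfolding f_in_def
      by (intro mult_left_mono L2_dominated(2)) (auto simp: L2_def)
    also have "\<dots> = C' / L * ?N wv"
      by (simp add: C'_def mult_ac)
    also have "\<dots> \<le> C' / real n * ?N wv"
    proof (intro mult_right_mono divide_left_mono)
      show "0 \<le> C'"
        using C(1) K \<beta> by (simp add: C'_def)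
    qed (use n in \<open>auto simp: L_def L2_norm_nonneg\<close>)
    finally have e_norm: "?N e \<le> C' / real n * ?N wv" .
    have "?N (\<lambda>x. e x + A * wv x) \<le> ?N e + A * ?N wv"
    proof -
      have "(\<lambda>x. A * wv x) \<in> L2 punctured" "?N (\<lambda>x. A * wv x) \<le> A * ?N wv"
        using wv2 A_pos by (intro L2_dominated[OF wv2]; auto simp: L2_def abs_mult)+
      then show ?thesis
        using L2.seminorm_triangle[OF e2, of "\<lambda>x. A * wv x"] by (simp add: L2_norm_eq_seminorm)
    qed
    then have "?N (divergence_op c\<^sub>\<Omega> v) \<le> (A + C' / real n) * ?N wv"
      using e_norm by (simp add: e_def distrib_right)
    moreover have "?N wv > 0"
    proof -
      have "0 < real (2 * n) * (exp (- d) * shell_mass TYPE('d))"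
        using n shell_mass_pos[where 'd = 'd] by simp
      also have "\<dots> \<le> (?N f_in)\<^sup>2"
        unfolding f_in_def by (rule shell(3))
      finally have "0 < ?N f_in"
        using L2_norm_nonneg[of punctured f_in] by (simp add: zero_less_power2)
      also have "\<dots> \<le> K / \<beta> * ?N wv"
        using K \<beta> wv2 in_le shell(1) unfolding f_in_def
        by (intro L2_dominated(2)) (auto simp: L2_def)
      finally show ?thesis
        using K \<beta> by (simp add: zero_less_divide_iff zero_less_mult_iff)
    qed
    ultimately show ?thesis
      using v unfolding wv_def by blast
  qed
  then show ?thesis
    using that by blast
qed

text \<open>Test functions lie in \<open>D(H)\<close> by \<open>core_in_H\<close>, so the hypothesis
  applies to the near-optimizers. Their weighted norm is positive and cancels; then \<open>n\<close>
  tends to infinity.\<close>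

lemma rellich_optimal:
  assumes "weighted_operator punctured c\<^sub>\<Omega> H S"
    and rellich: "\<And>\<phi> \<eta>. (\<phi>, \<eta>) \<in> H \<Longrightarrow>
      a * L2_inner punctured (\<lambda>x. \<omega> (norm x) * \<phi> x) (\<lambda>x. \<omega> (norm x) * \<phi> x) \<le> L2_inner punctured \<eta> \<eta>"
  shows "a \<le> A\<^sup>2"
proof -
  interpret weighted_operator punctured c\<^sub>\<Omega> H S by fact
  obtain C where C: "\<And>n. n > 0 \<Longrightarrow> \<exists>v\<in>core. L2_norm punctured (\<lambda>x. \<omega> (norm x) * v x) > 0 \<and>
    L2_norm punctured (divergence_op c\<^sub>\<Omega> v) \<le> (A + C / real n) * L2_norm punctured (\<lambda>x. \<omega> (norm x) * v x)"
    using near_optimizer by blast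
  have "a \<le> (A + C / real n)\<^sup>2" if n: "n > 0" for n
  proof -
    obtain v where v: "v \<in> core" and pos: "L2_norm punctured (\<lambda>x. \<omega> (norm x) * v x) > 0"
      and le: "L2_norm punctured (divergence_op c\<^sub>\<Omega> v)
        \<le> (A + C / real n) * L2_norm punctured (\<lambda>x. \<omega> (norm x) * v x)"
      using C[OF n] by blast
    let ?X = "L2_norm punctured (\<lambda>x. \<omega> (norm x) * v x)"
    have "a * ?X\<^sup>2 \<le> (L2_norm punctured (divergence_op c\<^sub>\<Omega> v))\<^sup>2"
      using rellich[OF core_in_H[OF v]] by (simp add: L2_norm_power2)
    also have "\<dots> \<le> ((A + C / real n) * ?X)\<^sup>2"
      by (rule power_mono[OF le L2_norm_nonneg])
    finally show ?thesis
      using pos by (simp add: power_mult_distrib)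
  qed
  then have "\<forall>n\<ge>1. a \<le> (A + C / real n)\<^sup>2"
    by auto
  moreover have "(\<lambda>n. (A + C / real n)\<^sup>2) \<longlonglongrightarrow> (A + 0)\<^sup>2"
    by (intro tendsto_intros lim_const_over_n)
  ultimately show ?thesis
    by (intro LIMSEQ_le_const[of _ "A\<^sup>2"]) auto
qed

end

theorem mainTheorem12:
  fixes \<Omega> :: "(real^'d::finite) set"
    and c\<^sub>\<Omega> :: "real^'d \<Rightarrow> real"
    and \<delta> \<delta>' :: real
    and H :: "(real^'d \<Rightarrow> real) rel"
  assumes "\<Omega> = UNIV - {0}"
    and "\<delta> \<ge> 0" and "\<delta>' \<ge> 0"
    and "c\<^sub>\<Omega> = (\<lambda>x. c_weight \<delta> \<delta>' (norm x))"
    and "associated_operator \<Omega> (h_dom \<Omega> c\<^sub>\<Omega>) (h_form \<Omega> c\<^sub>\<Omega>) H"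
    and "\<delta> + \<delta>' \<le> 4"
    and "real CARD('d) + 2 * min \<delta> \<delta>' - 4 > 0"
  shows "rellich_inequality \<Omega> c\<^sub>\<Omega> H
           ((real CARD('d))\<^sup>2 * (real CARD('d) + 2 * min \<delta> \<delta>' - 4)\<^sup>2 / 16) \<and>
         (\<forall>a. rellich_inequality \<Omega> c\<^sub>\<Omega> H a \<longrightarrow>
           a \<le> (real CARD('d))\<^sup>2 * (real CARD('d) + 2 * min \<delta> \<delta>' - 4)\<^sup>2 / 16)"
proof -
  interpret rellich_weight \<delta> \<delta>' "real CARD('d)" c\<^sub>\<Omega>
    by unfold_locales (use assms in auto)
  obtain S where S: "is_operator_sqrt \<Omega> S H" "Domain S = h_dom \<Omega> c\<^sub>\<Omega>"
    "\<forall>(\<phi>, \<psi>)\<in>S. h_form \<Omega> c\<^sub>\<Omega> \<phi> = (L2_norm \<Omega> \<psi>)\<^sup>2"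
    using assms(5) unfolding associated_operator_def by blast
  have op: "weighted_operator (UNIV - {0}) c\<^sub>\<Omega> H S"
    by unfold_locales (use S assms(1) in auto)
  have weight: "c\<^sub>\<Omega> x / (boundary_dist \<Omega> x)\<^sup>2 = \<omega> (norm x)" for x
    by (simp add: assms(1,4) boundary_dist_punctured \<omega>_def)
  have A: "(real CARD('d))\<^sup>2 * (real CARD('d) + 2 * min \<delta> \<delta>' - 4)\<^sup>2 / 16 = A\<^sup>2"
    by (simp add: A_def power_mult_distrib power_divide)
  show ?thesis
    unfolding A rellich_inequality_def weight
  proof (intro conjI allI impI)
    show "\<forall>(\<phi>, \<eta>)\<in>H. (\<lambda>x. \<omega> (norm x) * \<phi> x) \<in> L2 \<Omega> \<and>
        A\<^sup>2 * L2_inner \<Omega> (\<lambda>x. \<omega> (norm x) * \<phi> x) (\<lambda>x. \<omega> (norm x) * \<phi> x) \<le> L2_inner \<Omega> \<eta> \<eta>"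
      using rellich_lower_bound[OF op] by (auto simp: assms(1))
    show "a \<le> A\<^sup>2" if "\<forall>(\<phi>, \<eta>)\<in>H. (\<lambda>x. \<omega> (norm x) * \<phi> x) \<in> L2 \<Omega> \<and>
        a * L2_inner \<Omega> (\<lambda>x. \<omega> (norm x) * \<phi> x) (\<lambda>x. \<omega> (norm x) * \<phi> x) \<le> L2_inner \<Omega> \<eta> \<eta>" for a
      by (rule rellich_optimal[OF op]) (use that assms(1) in auto)
  qed
qed

end
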